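(* Let $R$ be a Cohen--Macaulay Noetherian domain such that $R_{\mathfrak m}$ has Krull dimension $2$ for each maximal ideal $\mathfrak m$ of $R$. Let $G$ be a finite edge-labeled graph over $R$ all of whose edge labels are non-zero principal ideals of $R$, and suppose that the module of generalized splines $R_G$ has finite projective dimension over $R$. Then $R_G$ is a finite (i.e. finitely generated) projective $R$-module. In particular, if all finite projective $R$-modules are free, then $R_G$ is free.
   Context: Let $R$ be a commutative ring. A finite edge-labeled graph $G=(G,\alpha)$ over $R$ consists of a finite graph with vertex set $V$ and edge set $E$ together with a function $\alpha$ assigning to each edge $e\in E$ an ideal $I_e:=\alpha(e)$ of $R$ (its edge label). The module of generalized splines is the $R$-submodule $$R_G=\{(r_v)_{v\in V}\in \bigoplus_{v\in V}R : r_u-r_v\in I_e \text{ for every edge } e\in E \text{ with endpoints } u,v\}.$$ *)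

theory Defs
  imports "HOL-Algebra.Module" "HOL-Algebra.Ring_Divisibility" "HOL-Library.Extended_Nat"
begin

section \<open>Localization, Krull dimension, Cohen--Macaulay rings\<close>

text \<open>The fraction \<open>a / s\<close>, as the class of \<open>(a, s)\<close> in \<open>carrier R \<times> S\<close>.\<close>
definition frac_class :: "('a, 'm) ring_scheme \<Rightarrow> 'a set \<Rightarrow> 'a \<Rightarrow> 'a \<Rightarrow> ('a \<times> 'a) set" where
  "frac_class R S a s = {(b, t). b \<in> carrier R \<and> t \<in> S \<and>
     (\<exists>u\<in>S. u \<otimes>\<^bsub>R\<^esub> (t \<otimes>\<^bsub>R\<^esub> a \<ominus>\<^bsub>R\<^esub> s \<otimes>\<^bsub>R\<^esub> b) = \<zero>\<^bsub>R\<^esub>)}"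

text \<open>Each union below runs over all representatives of the two classes, as for \<open>rcoset_mult\<close>; all its
  members coincide when \<open>S\<close> is multiplicative.\<close>
definition fraction_ring :: "('a, 'm) ring_scheme \<Rightarrow> 'a set \<Rightarrow> ('a \<times> 'a) set ring" where
  "fraction_ring R S =
    \<lparr>carrier = {frac_class R S a s | a s. a \<in> carrier R \<and> s \<in> S},
     mult = (\<lambda>A B. \<Union>(a, s)\<in>A. \<Union>(b, t)\<in>B. frac_class R S (a \<otimes>\<^bsub>R\<^esub> b) (s \<otimes>\<^bsub>R\<^esub> t)),
     one = frac_class R S \<one>\<^bsub>R\<^esub> \<one>\<^bsub>R\<^esub>,
     zero = frac_class R S \<zero>\<^bsub>R\<^esub> \<one>\<^bsub>R\<^esub>,
     add = (\<lambda>A B. \<Union>(a, s)\<in>A. \<Union>(b, t)\<in>B.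
              frac_class R S (t \<otimes>\<^bsub>R\<^esub> a \<oplus>\<^bsub>R\<^esub> s \<otimes>\<^bsub>R\<^esub> b) (s \<otimes>\<^bsub>R\<^esub> t))\<rparr>"

lemma (in cring) frac_class_eqI:
  assumes S: "S \<subseteq> carrier R" "\<And>s t. s \<in> S \<Longrightarrow> t \<in> S \<Longrightarrow> s \<otimes> t \<in> S"
    and a: "a \<in> carrier R" "s \<in> S" and b: "(b, t) \<in> frac_class R S a s"
  shows "frac_class R S b t \<subseteq> frac_class R S a s"
proof (clarsimp)
  fix c w assume c: "(c, w) \<in> frac_class R S b t"
  from b obtain u where u: "u \<in> S" "u \<otimes> (t \<otimes> a \<ominus> s \<otimes> b) = \<zero>" and bt: "b \<in> carrier R" "t \<in> S"
    by (auto simp: frac_class_def)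
  from c obtain v where v: "v \<in> S" "v \<otimes> (w \<otimes> b \<ominus> t \<otimes> c) = \<zero>" and cw: "c \<in> carrier R" "w \<in> S"
    by (auto simp: frac_class_def)
  have car: "u \<in> carrier R" "v \<in> carrier R" "s \<in> carrier R" "t \<in> carrier R" "w \<in> carrier R"
    using S u v bt cw a by auto
  have "(u \<otimes> v \<otimes> t) \<otimes> (w \<otimes> a \<ominus> s \<otimes> c)
     = v \<otimes> w \<otimes> (u \<otimes> (t \<otimes> a \<ominus> s \<otimes> b)) \<oplus> u \<otimes> s \<otimes> (v \<otimes> (w \<otimes> b \<ominus> t \<otimes> c))"
    using car a(1) bt(1) cw(1) by algebra
  also have "\<dots> = \<zero>" unfolding u(2) v(2) using car by simp
  finally show "(c, w) \<in> frac_class R S a s"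
    using cw S(2) u v bt unfolding frac_class_def by blast
qed

lemma (in cring) frac_class_eq_iff:
  assumes S: "S \<subseteq> carrier R" "\<And>s t. s \<in> S \<Longrightarrow> t \<in> S \<Longrightarrow> s \<otimes> t \<in> S"
    and a: "a \<in> carrier R" "s \<in> S" and b: "b \<in> carrier R" "t \<in> S"
  shows "frac_class R S a s = frac_class R S b t \<longleftrightarrow> (\<exists>u\<in>S. u \<otimes> (t \<otimes> a \<ominus> s \<otimes> b) = \<zero>)"
proof
  have car: "s \<in> carrier R" "t \<in> carrier R" using S a b by auto
  have "(b, t) \<in> frac_class R S b t"
    using b car by (auto simp: frac_class_def minus_eq r_neg intro!: bexI[of _ t])
  then show "frac_class R S a s = frac_class R S b t \<Longrightarrow> \<exists>u\<in>S. u \<otimes> (t \<otimes> a \<ominus> s \<otimes> b) = \<zero>"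
    by (auto simp: frac_class_def set_eq_iff)
  assume "\<exists>u\<in>S. u \<otimes> (t \<otimes> a \<ominus> s \<otimes> b) = \<zero>"
  then obtain u where u: "u \<in> S" "u \<otimes> (t \<otimes> a \<ominus> s \<otimes> b) = \<zero>" by blast
  then have uc: "u \<in> carrier R" using S by auto
  have "u \<otimes> (s \<otimes> b \<ominus> t \<otimes> a) = \<ominus> (u \<otimes> (t \<otimes> a \<ominus> s \<otimes> b))" using uc car a b by algebra
  then have "u \<otimes> (s \<otimes> b \<ominus> t \<otimes> a) = \<zero>" using u by simp
  then have "(a, s) \<in> frac_class R S b t" "(b, t) \<in> frac_class R S a s"
    using u a b by (auto simp: frac_class_def)
  then show "frac_class R S a s = frac_class R S b t"
    using frac_class_eqI[of S, OF S] a b by blast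
qed

lemma (in cring) fraction_ring_ops:
  assumes S: "S \<subseteq> carrier R" "\<And>s t. s \<in> S \<Longrightarrow> t \<in> S \<Longrightarrow> s \<otimes> t \<in> S"
    and a: "a \<in> carrier R" "s \<in> S" and b: "b \<in> carrier R" "t \<in> S"
  shows "frac_class R S a s \<otimes>\<^bsub>fraction_ring R S\<^esub> frac_class R S b t = frac_class R S (a \<otimes> b) (s \<otimes> t)"
    and "frac_class R S a s \<oplus>\<^bsub>fraction_ring R S\<^esub> frac_class R S b t = frac_class R S (t \<otimes> a \<oplus> s \<otimes> b) (s \<otimes> t)"
proof -
  have car: "s \<in> carrier R" "t \<in> carrier R" using S a b by auto
  have mem: "(a, s) \<in> frac_class R S a s" "(b, t) \<in> frac_class R S b t"
    using a b car by (auto simp: frac_class_def minus_eq r_neg intro!: bexI[of _ t] bexI[of _ s])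
  have "frac_class R S (a' \<otimes> b') (s' \<otimes> t') = frac_class R S (a \<otimes> b) (s \<otimes> t) \<and>
     frac_class R S (t' \<otimes> a' \<oplus> s' \<otimes> b') (s' \<otimes> t') = frac_class R S (t \<otimes> a \<oplus> s \<otimes> b) (s \<otimes> t)"
    if "(a', s') \<in> frac_class R S a s" "(b', t') \<in> frac_class R S b t" for a' s' b' t'
  proof -
    from that obtain u v where u: "u \<in> S" "u \<otimes> (s' \<otimes> a \<ominus> s \<otimes> a') = \<zero>" "a' \<in> carrier R" "s' \<in> S"
      and v: "v \<in> S" "v \<otimes> (t' \<otimes> b \<ominus> t \<otimes> b') = \<zero>" "b' \<in> carrier R" "t' \<in> S"
      by (auto simp: frac_class_def)
    have car': "u \<in> carrier R" "v \<in> carrier R" "s' \<in> carrier R" "t' \<in> carrier R" using S u v by auto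
    have z: "p \<otimes> \<zero> \<oplus> q \<otimes> \<zero> = \<zero>" if "p \<in> carrier R" "q \<in> carrier R" for p q using that by simp
    have "(u \<otimes> v) \<otimes> (s \<otimes> t \<otimes> (a' \<otimes> b') \<ominus> s' \<otimes> t' \<otimes> (a \<otimes> b)) =
       (\<ominus> (v \<otimes> t' \<otimes> b)) \<otimes> (u \<otimes> (s' \<otimes> a \<ominus> s \<otimes> a')) \<oplus> (\<ominus> (u \<otimes> s \<otimes> a')) \<otimes> (v \<otimes> (t' \<otimes> b \<ominus> t \<otimes> b'))"
      using car car' a(1) b(1) u(3) v(3) by algebra
    then have 1: "(u \<otimes> v) \<otimes> (s \<otimes> t \<otimes> (a' \<otimes> b') \<ominus> s' \<otimes> t' \<otimes> (a \<otimes> b)) = \<zero>"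
      unfolding u(2) v(2) using z car car' a(1) b(1) u(3) v(3) by simp
    have "(u \<otimes> v) \<otimes> (s \<otimes> t \<otimes> (t' \<otimes> a' \<oplus> s' \<otimes> b') \<ominus> s' \<otimes> t' \<otimes> (t \<otimes> a \<oplus> s \<otimes> b)) =
       (\<ominus> (v \<otimes> t \<otimes> t')) \<otimes> (u \<otimes> (s' \<otimes> a \<ominus> s \<otimes> a')) \<oplus> (\<ominus> (u \<otimes> s \<otimes> s')) \<otimes> (v \<otimes> (t' \<otimes> b \<ominus> t \<otimes> b'))"
      using car car' a(1) b(1) u(3) v(3) by algebra
    then have 2: "(u \<otimes> v) \<otimes> (s \<otimes> t \<otimes> (t' \<otimes> a' \<oplus> s' \<otimes> b') \<ominus> s' \<otimes> t' \<otimes> (t \<otimes> a \<oplus> s \<otimes> b)) = \<zero>"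
      unfolding u(2) v(2) using z car car' a(1) b(1) u(3) v(3) by simp
    have uv: "u \<otimes> v \<in> S" and st: "s \<otimes> t \<in> S" "s' \<otimes> t' \<in> S"
      using S(2) u v a b by blast+
    show ?thesis
    proof
      show "frac_class R S (a' \<otimes> b') (s' \<otimes> t') = frac_class R S (a \<otimes> b) (s \<otimes> t)"
        by (rule frac_class_eq_iff[of S, OF S, THEN iffD2])
          (use 1 uv st a b u v in \<open>auto intro: bexI[of _ "u \<otimes> v"]\<close>)
      show "frac_class R S (t' \<otimes> a' \<oplus> s' \<otimes> b') (s' \<otimes> t') = frac_class R S (t \<otimes> a \<oplus> s \<otimes> b) (s \<otimes> t)"
        by (rule frac_class_eq_iff[of S, OF S, THEN iffD2])
          (use 2 uv st a b u v car car' in \<open>auto intro: bexI[of _ "u \<otimes> v"]\<close>)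
    qed
  qed
  then have *: "\<And>a' s' b' t'. (a', s') \<in> frac_class R S a s \<Longrightarrow> (b', t') \<in> frac_class R S b t \<Longrightarrow>
      frac_class R S (a' \<otimes> b') (s' \<otimes> t') = frac_class R S (a \<otimes> b) (s \<otimes> t)"
    and **: "\<And>a' s' b' t'. (a', s') \<in> frac_class R S a s \<Longrightarrow> (b', t') \<in> frac_class R S b t \<Longrightarrow>
      frac_class R S (t' \<otimes> a' \<oplus> s' \<otimes> b') (s' \<otimes> t') = frac_class R S (t \<otimes> a \<oplus> s \<otimes> b) (s \<otimes> t)"
    by blast+
  have UN: "(\<Union>(a, s)\<in>A. \<Union>(b, t)\<in>B. h a s b t) = C"
    if "\<And>a s b t. (a, s) \<in> A \<Longrightarrow> (b, t) \<in> B \<Longrightarrow> h a s b t = C" "(x, y) \<in> A" "(z, w) \<in> B"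
    for A B :: "('a \<times> 'a) set" and h and C :: "('a \<times> 'a) set" and x y z w
    using that by blast
  show "frac_class R S a s \<otimes>\<^bsub>fraction_ring R S\<^esub> frac_class R S b t = frac_class R S (a \<otimes> b) (s \<otimes> t)"
    unfolding fraction_ring_def monoid.simps by (rule UN[OF * mem])
  show "frac_class R S a s \<oplus>\<^bsub>fraction_ring R S\<^esub> frac_class R S b t = frac_class R S (t \<otimes> a \<oplus> s \<otimes> b) (s \<otimes> t)"
    unfolding fraction_ring_def ring_record_simps by (rule UN[OF ** mem])
qed

definition localization_at :: "('a, 'm) ring_scheme \<Rightarrow> 'a set \<Rightarrow> ('a \<times> 'a) set ring" where
  "localization_at R \<pp> = fraction_ring R (carrier R - \<pp>)"

text \<open>Supremum of the lengths of chains \<open>\<pp>\<^sub>0 \<subset> \<dots> \<subset> \<pp>\<^sub>n\<close> of primes. The zero ring, which has no primes,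
  gets the value 0.\<close>
definition krull_dim :: "('a, 'm) ring_scheme \<Rightarrow> enat" where
  "krull_dim R = Sup {enat n | n. \<exists>\<pp>. (\<forall>i\<le>n. primeideal (\<pp> i) R) \<and> (\<forall>i<n. \<pp> i \<subset> \<pp> (Suc i))}"

definition regular_sequence :: "('a, 'm) ring_scheme \<Rightarrow> 'a list \<Rightarrow> bool" where
  "regular_sequence R xs \<longleftrightarrow> set xs \<subseteq> carrier R \<and>
     (\<forall>i<length xs. \<forall>r\<in>carrier R.
        xs ! i \<otimes>\<^bsub>R\<^esub> r \<in> Idl\<^bsub>R\<^esub> (set (take i xs)) \<longrightarrow> r \<in> Idl\<^bsub>R\<^esub> (set (take i xs))) \<and>
     Idl\<^bsub>R\<^esub> (set xs) \<noteq> carrier R"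

definition depth_in :: "('a, 'm) ring_scheme \<Rightarrow> 'a set \<Rightarrow> enat" where
  "depth_in R I = Sup {enat (length xs) | xs. regular_sequence R xs \<and> set xs \<subseteq> I}"

text \<open>Here \<open>\<mm>\<close> is the unique maximal ideal of the local ring \<open>R\<close>.\<close>
definition cohen_macaulay_local :: "('a, 'm) ring_scheme \<Rightarrow> bool" where
  "cohen_macaulay_local R \<longleftrightarrow> cring R \<and> noetherian_ring R \<and>
     (\<exists>\<mm>. (\<forall>J. maximalideal J R \<longleftrightarrow> J = \<mm>) \<and> depth_in R \<mm> = krull_dim R)"

definition cohen_macaulay :: "('a, 'm) ring_scheme \<Rightarrow> bool" where
  "cohen_macaulay R \<longleftrightarrow> cring R \<and> noetherian_ring R \<and>
     (\<forall>\<mm>. maximalideal \<mm> R \<longrightarrow> cohen_macaulay_local (localization_at R \<mm>))"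


section \<open>Modules\<close>

definition module_maps ::
    "('a, 'm) ring_scheme \<Rightarrow> ('a, 'b, 'p) module_scheme \<Rightarrow> ('a, 'c, 'q) module_scheme \<Rightarrow> ('b \<Rightarrow> 'c) set" where
  "module_maps R M N = {h \<in> hom (add_monoid M) (add_monoid N).
     \<forall>a\<in>carrier R. \<forall>x\<in>carrier M. h (a \<odot>\<^bsub>M\<^esub> x) = a \<odot>\<^bsub>N\<^esub> h x}"

definition module_isomorphic ::
    "('a, 'm) ring_scheme \<Rightarrow> ('a, 'b, 'p) module_scheme \<Rightarrow> ('a, 'c, 'q) module_scheme \<Rightarrow> bool" where
  "module_isomorphic R M N \<longleftrightarrow> (\<exists>h\<in>module_maps R M N. bij_betw h (carrier M) (carrier N))"

text \<open>\<open>\<Oplus>\<^sub>i\<^sub>\<in>\<^sub>I R\<close>. The ring fields of the record that play no role for a module are left unspecified.\<close>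
definition free_module :: "('a, 'm) ring_scheme \<Rightarrow> 'i set \<Rightarrow> ('a, 'i \<Rightarrow> 'a) module" where
  "free_module R I =
    \<lparr>carrier = {f \<in> I \<rightarrow>\<^sub>E carrier R. finite {i \<in> I. f i \<noteq> \<zero>\<^bsub>R\<^esub>}},
     mult = undefined, one = undefined,
     zero = (\<lambda>i\<in>I. \<zero>\<^bsub>R\<^esub>),
     add = (\<lambda>f g. \<lambda>i\<in>I. f i \<oplus>\<^bsub>R\<^esub> g i),
     smult = (\<lambda>a f. \<lambda>i\<in>I. a \<otimes>\<^bsub>R\<^esub> f i)\<rparr>"

lemma (in cring) free_module_is_module: "module R (free_module R I)"
proof (rule moduleI)
  let ?F = "free_module R I"
  have sup: "finite {i \<in> I. (\<lambda>i\<in>I. f i \<oplus> g i) i \<noteq> \<zero>}"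
    if "f \<in> I \<rightarrow>\<^sub>E carrier R" "g \<in> I \<rightarrow>\<^sub>E carrier R" "finite {i \<in> I. f i \<noteq> \<zero>}" "finite {i \<in> I. g i \<noteq> \<zero>}" for f g
    by (rule finite_subset[of _ "{i \<in> I. f i \<noteq> \<zero>} \<union> {i \<in> I. g i \<noteq> \<zero>}"]) (use that in auto)
  have addc: "f \<oplus>\<^bsub>?F\<^esub> g \<in> carrier ?F" if "f \<in> carrier ?F" "g \<in> carrier ?F" for f g
    using that sup[of f g] by (auto simp: free_module_def)
  show "abelian_group ?F"
  proof (rule abelian_groupI)
    fix x assume x: "x \<in> carrier ?F"
    have "(\<ominus> \<one>) \<odot>\<^bsub>?F\<^esub> x \<oplus>\<^bsub>?F\<^esub> x = \<zero>\<^bsub>?F\<^esub>"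
    proof -
      have "x i \<in> carrier R" if "i \<in> I" for i using x that by (auto simp: free_module_def)
      then show ?thesis by (simp add: free_module_def fun_eq_iff l_minus l_neg)
    qed
    moreover have "(\<ominus> \<one>) \<odot>\<^bsub>?F\<^esub> x \<in> carrier ?F"
    proof -
      have c: "x i \<in> carrier R" if "i \<in> I" for i using x that by (auto simp: free_module_def)
      have "{i \<in> I. (\<lambda>i\<in>I. \<ominus> \<one> \<otimes> x i) i \<noteq> \<zero>} \<subseteq> {i \<in> I. x i \<noteq> \<zero>}" by auto
      then have "finite {i \<in> I. (\<lambda>i\<in>I. \<ominus> \<one> \<otimes> x i) i \<noteq> \<zero>}"
        by (rule finite_subset) (use x in \<open>simp add: free_module_def\<close>)
      then show ?thesis using c by (simp add: free_module_def)
    qed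
    ultimately show "\<exists>y\<in>carrier ?F. y \<oplus>\<^bsub>?F\<^esub> x = \<zero>\<^bsub>?F\<^esub>" by blast
  next
    show "\<zero>\<^bsub>?F\<^esub> \<in> carrier ?F" by (simp add: free_module_def)
    fix x y z assume x: "x \<in> carrier ?F" and y: "y \<in> carrier ?F" and z: "z \<in> carrier ?F"
    show "x \<oplus>\<^bsub>?F\<^esub> y \<in> carrier ?F" using x y by (rule addc)
    have c: "x i \<in> carrier R" "y i \<in> carrier R" "z i \<in> carrier R" if "i \<in> I" for i
      using x y z that by (auto simp: free_module_def)
    have e: "x i = undefined" if "i \<notin> I" for i using x that by (auto simp: free_module_def)
    show "x \<oplus>\<^bsub>?F\<^esub> y \<oplus>\<^bsub>?F\<^esub> z = x \<oplus>\<^bsub>?F\<^esub> (y \<oplus>\<^bsub>?F\<^esub> z)"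
      using c by (simp add: free_module_def fun_eq_iff a_assoc)
    show "x \<oplus>\<^bsub>?F\<^esub> y = y \<oplus>\<^bsub>?F\<^esub> x"
      using c by (simp add: free_module_def fun_eq_iff a_comm)
    show "\<zero>\<^bsub>?F\<^esub> \<oplus>\<^bsub>?F\<^esub> x = x"
      using c e by (simp add: free_module_def fun_eq_iff)
  qed
next
  let ?F = "free_module R I"
  show "cring R" by (rule is_cring)
  fix x assume x: "x \<in> carrier ?F"
  have c: "x i \<in> carrier R" if "i \<in> I" for i
    using x that by (auto simp: free_module_def)
  have e: "x i = undefined" if "i \<notin> I" for i using x that by (auto simp: free_module_def)
  show "\<one> \<odot>\<^bsub>?F\<^esub> x = x"
    using c e by (simp add: free_module_def fun_eq_iff)
  fix a assume a: "a \<in> carrier R"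
  have "{i \<in> I. (\<lambda>i\<in>I. a \<otimes> x i) i \<noteq> \<zero>} \<subseteq> {i \<in> I. x i \<noteq> \<zero>}" using a by auto
  then have "finite {i \<in> I. (\<lambda>i\<in>I. a \<otimes> x i) i \<noteq> \<zero>}"
    by (rule finite_subset) (use x in \<open>simp add: free_module_def\<close>)
  then show "a \<odot>\<^bsub>?F\<^esub> x \<in> carrier ?F" using a c by (simp add: free_module_def)
  {
    fix y assume y: "y \<in> carrier ?F"
    then have "y i \<in> carrier R" if "i \<in> I" for i using that by (auto simp: free_module_def)
    then show "a \<odot>\<^bsub>?F\<^esub> (x \<oplus>\<^bsub>?F\<^esub> y) = a \<odot>\<^bsub>?F\<^esub> x \<oplus>\<^bsub>?F\<^esub> a \<odot>\<^bsub>?F\<^esub> y"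
      using a c by (simp add: free_module_def fun_eq_iff r_distr)
  }
  fix b assume b: "b \<in> carrier R"
  show "(a \<oplus> b) \<odot>\<^bsub>?F\<^esub> x = a \<odot>\<^bsub>?F\<^esub> x \<oplus>\<^bsub>?F\<^esub> b \<odot>\<^bsub>?F\<^esub> x"
    using a b c by (simp add: free_module_def fun_eq_iff l_distr)
  show "(a \<otimes> b) \<odot>\<^bsub>?F\<^esub> x = a \<odot>\<^bsub>?F\<^esub> (b \<odot>\<^bsub>?F\<^esub> x)"
    using a b c by (simp add: free_module_def fun_eq_iff m_assoc)
qed

text \<open>In the next two definitions it is no restriction that the index set \<open>I\<close> consists of elements of
  the type of \<open>M\<close>: a basis of \<open>M\<close>, respectively \<open>carrier M\<close>, can serve as \<open>I\<close>.\<close>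
definition is_free_module :: "('a, 'm) ring_scheme \<Rightarrow> ('a, 'b, 'p) module_scheme \<Rightarrow> bool" where
  "is_free_module R M \<longleftrightarrow> module R M \<and> (\<exists>I :: 'b set. module_isomorphic R M (free_module R I))"

text \<open>Projective: isomorphic to a direct summand \<open>N\<close> of a free module \<open>F = N \<oplus> Q\<close>.\<close>
definition is_projective_module :: "('a, 'm) ring_scheme \<Rightarrow> ('a, 'b, 'p) module_scheme \<Rightarrow> bool" where
  "is_projective_module R M \<longleftrightarrow> module R M \<and>
     (\<exists>(I :: 'b set) N Q.
        let F = free_module R I in
          submodule N R F \<and> submodule Q R F \<and>
          N \<inter> Q = {\<zero>\<^bsub>F\<^esub>} \<and> N <+>\<^bsub>F\<^esub> Q = carrier F \<and>
          module_isomorphic R M (F\<lparr>carrier := N\<rparr>))"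

definition is_finite_module :: "('a, 'm) ring_scheme \<Rightarrow> ('a, 'b, 'p) module_scheme \<Rightarrow> bool" where
  "is_finite_module R M \<longleftrightarrow> module R M \<and>
     (\<exists>S. finite S \<and> S \<subseteq> carrier M \<and> (\<forall>N. submodule N R M \<and> S \<subseteq> N \<longrightarrow> N = carrier M))"

text \<open>Every finite projective module is isomorphic to a direct summand of \<open>R\<^sup>n = free_module R {..<n}\<close>
  for some \<open>n\<close>, so modules with elements of type \<^typ>\<open>nat \<Rightarrow> 'a\<close> represent all of them.\<close>
definition all_finite_projectives_free :: "('a, 'm) ring_scheme \<Rightarrow> bool" where
  "all_finite_projectives_free R \<longleftrightarrow>
     (\<forall>P :: ('a, nat \<Rightarrow> 'a) module. is_finite_module R P \<and> is_projective_module R P \<longrightarrow> is_free_module R P)"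

text \<open>An exact sequence \<open>\<dots> \<rightarrow> P\<^sub>2 \<rightarrow> P\<^sub>1 \<rightarrow> P\<^sub>0 \<rightarrow> M \<rightarrow> 0\<close> with maps \<open>d i : P (i + 1) \<rightarrow> P i\<close> and
  \<open>\<epsilon> : P 0 \<rightarrow> M\<close>.\<close>
definition projective_resolution ::
    "('a, 'm) ring_scheme \<Rightarrow> ('a, 'b, 'p) module_scheme \<Rightarrow>
     (nat \<Rightarrow> ('a, 'c) module) \<Rightarrow> (nat \<Rightarrow> 'c \<Rightarrow> 'c) \<Rightarrow> ('c \<Rightarrow> 'b) \<Rightarrow> bool" where
  "projective_resolution R M P d \<epsilon> \<longleftrightarrow>
     (\<forall>i. is_projective_module R (P i)) \<and>
     (\<forall>i. d i \<in> module_maps R (P (Suc i)) (P i)) \<and>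
     \<epsilon> \<in> module_maps R (P 0) M \<and>
     \<epsilon> ` carrier (P 0) = carrier M \<and>
     d 0 ` carrier (P 1) = a_kernel (P 0) M \<epsilon> \<and>
     (\<forall>i. d (Suc i) ` carrier (P (Suc (Suc i))) = a_kernel (P (Suc i)) (P i) (d i))"

text \<open>A HOL definition cannot quantify over types, so the type \<open>'c\<close> of the elements of the resolving
  modules is a parameter. Where \<open>'c\<close> is a type variable occurring only in a hypothesis, that
  hypothesis says that a resolution of finite length exists in some type.\<close>
definition finite_projective_dimension ::
    "'c itself \<Rightarrow> ('a, 'm) ring_scheme \<Rightarrow> ('a, 'b, 'p) module_scheme \<Rightarrow> bool" where
  "finite_projective_dimension _ R M \<longleftrightarrow> module R M \<and>
     (\<exists>n (P :: nat \<Rightarrow> ('a, 'c) module) d \<epsilon>.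
        projective_resolution R M P d \<epsilon> \<and> (\<forall>i>n. carrier (P i) = {\<zero>\<^bsub>P i\<^esub>}))"


section \<open>Edge-labeled graphs and generalized splines\<close>

text \<open>\<open>ends e\<close> is the set of endpoints of the edge \<open>e\<close>. Multiple edges and loops are allowed; a simple
  graph has \<open>E\<close> a set of two-element subsets of \<open>V\<close> and \<open>ends\<close> the identity.\<close>
locale edge_labeled_graph = cring R
  for R :: "('a, 'm) ring_scheme" (structure)
    and V :: "'v set" and E :: "'e set" and ends :: "'e \<Rightarrow> 'v set" and \<alpha> :: "'e \<Rightarrow> 'a set" +
  assumes finite_V: "finite V"
    and finite_E: "finite E"
    and ends: "e \<in> E \<Longrightarrow> \<exists>u\<in>V. \<exists>v\<in>V. ends e = {u, v}"
    and label_ideal: "e \<in> E \<Longrightarrow> ideal (\<alpha> e) R"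

definition spline_module ::
    "('a, 'm) ring_scheme \<Rightarrow> 'v set \<Rightarrow> 'e set \<Rightarrow> ('e \<Rightarrow> 'v set) \<Rightarrow> ('e \<Rightarrow> 'a set) \<Rightarrow> ('a, 'v \<Rightarrow> 'a) module" where
  "spline_module R V E ends \<alpha> = (free_module R V)
     \<lparr>carrier := {r \<in> carrier (free_module R V).
        \<forall>e\<in>E. \<forall>u v. ends e = {u, v} \<longrightarrow> r u \<ominus>\<^bsub>R\<^esub> r v \<in> \<alpha> e}\<rparr>"

lemma (in edge_labeled_graph) spline_module_submodule:
  "submodule (carrier (spline_module R V E ends \<alpha>)) R (free_module R V)"
proof -
  interpret F: module R "free_module R V" by (rule free_module_is_module)
  have V: "u \<in> V \<and> v \<in> V" if "e \<in> E" "ends e = {u, v}" for e u v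
    using ends[OF that(1)] that(2) by (auto simp: doubleton_eq_iff)
  show ?thesis
  proof (rule F.submoduleI)
    note F.zero_closed[simp]
    let ?H = "carrier (spline_module R V E ends \<alpha>)"
    have eq: "?H = {r \<in> carrier (free_module R V). \<forall>e\<in>E. \<forall>u v. ends e = {u, v} \<longrightarrow> r u \<ominus> r v \<in> \<alpha> e}"
      by (simp add: spline_module_def)
    have car: "r u \<in> carrier R" if "r \<in> carrier (free_module R V)" "u \<in> V" for r u
      using that by (auto simp: free_module_def)
    have sm: "a \<odot>\<^bsub>free_module R V\<^esub> x \<in> ?H" if a: "a \<in> carrier R" and x: "x \<in> ?H" for a x
    proof -
      have "a \<otimes> x u \<ominus> a \<otimes> x v \<in> \<alpha> e" if e: "e \<in> E" "ends e = {u, v}" for e u v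
      proof -
        interpret ideal "\<alpha> e" R using label_ideal e by blast
        have m: "a \<otimes> (x u \<ominus> x v) \<in> \<alpha> e" using x e a by (auto simp: eq intro: I_l_closed)
        have "x u \<in> carrier R" "x v \<in> carrier R" using x V[OF e] car by (auto simp: eq)
        then have "a \<otimes> (x u \<ominus> x v) = a \<otimes> x u \<ominus> a \<otimes> x v" using a by algebra
        with m show ?thesis by simp
      qed
      moreover have "a \<odot>\<^bsub>free_module R V\<^esub> x = (\<lambda>i\<in>V. a \<otimes> x i)" by (simp add: free_module_def)
      moreover have "a \<odot>\<^bsub>free_module R V\<^esub> x \<in> carrier (free_module R V)" using a x by (auto simp: eq)
      ultimately show ?thesis using V by (auto simp: eq)
    qed
    show "?H \<subseteq> carrier (free_module R V)" by (auto simp: eq)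
    show "\<zero>\<^bsub>free_module R V\<^esub> \<in> ?H"
    proof -
      have "\<zero> \<ominus> \<zero> \<in> \<alpha> e" if "e \<in> E" for e
        using additive_subgroup.zero_closed[OF ideal.axioms(1)[OF label_ideal[OF that]]] by (simp add: minus_eq)
      moreover have "\<zero>\<^bsub>free_module R V\<^esub> = (\<lambda>i\<in>V. \<zero>)" by (simp add: free_module_def)
      ultimately show ?thesis using V F.zero_closed by (auto simp: eq)
    qed
    show "\<And>a x. \<lbrakk>a \<in> carrier R; x \<in> ?H\<rbrakk> \<Longrightarrow> a \<odot>\<^bsub>free_module R V\<^esub> x \<in> ?H" by (rule sm)
    show "\<ominus>\<^bsub>free_module R V\<^esub> x \<in> ?H" if x: "x \<in> ?H" for x
    proof -
      have "\<ominus>\<^bsub>free_module R V\<^esub> x = (\<ominus> \<one>) \<odot>\<^bsub>free_module R V\<^esub> x"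
        using x F.smult_l_minus[of \<one> x] by (auto simp: eq)
      with sm[of "\<ominus> \<one>" x] x show ?thesis by simp
    qed
    show "x \<oplus>\<^bsub>free_module R V\<^esub> y \<in> ?H" if x: "x \<in> ?H" and y: "y \<in> ?H" for x y
    proof -
      have "(x u \<oplus> y u) \<ominus> (x v \<oplus> y v) \<in> \<alpha> e" if e: "e \<in> E" "ends e = {u, v}" for e u v
      proof -
        interpret ideal "\<alpha> e" R using label_ideal e by blast
        have m: "(x u \<ominus> x v) \<oplus> (y u \<ominus> y v) \<in> \<alpha> e" using x y e by (auto simp: eq)
        have "x u \<in> carrier R" "x v \<in> carrier R" "y u \<in> carrier R" "y v \<in> carrier R"
          using x y V[OF e] car by (auto simp: eq)
        then have "(x u \<ominus> x v) \<oplus> (y u \<ominus> y v) = (x u \<oplus> y u) \<ominus> (x v \<oplus> y v)" by algebra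
        with m show ?thesis by simp
      qed
      moreover have "x \<oplus>\<^bsub>free_module R V\<^esub> y = (\<lambda>i\<in>V. x i \<oplus> y i)" by (simp add: free_module_def)
      moreover have "x \<oplus>\<^bsub>free_module R V\<^esub> y \<in> carrier (free_module R V)" using x y by (auto simp: eq)
      ultimately show ?thesis using V by (auto simp: eq)
    qed
  qed
qed

end

theory Submission
  imports Defs
begin

text \<open>Write \<open>M\<close> for the module of splines. Two properties of \<open>M\<close> are used: it has finite projective dimension, and
  at every maximal ideal it has depth at least two. The second one is elementary. The local rings
  \<open>R\<^sub>\<mm>\<close> have a regular sequence \<open>x, y\<close>; if \<open>x n + y n' = 0\<close> with splines \<open>n, n'\<close>, then \<open>x\<close> divides every
  coordinate of \<open>n'\<close> locally at \<open>\<mm>\<close>, and the quotients form a spline again, because each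
  edge condition \<open>n u - n v = k a\<^sub>e\<close> with \<open>a\<^sub>e \<noteq> 0\<close> passes the relation \<open>x k + y k' = 0\<close> on to the
  cofactors \<open>k, k'\<close> (\<open>spline_module_depth_two\<close>).

  As the depth of \<open>R\<^sub>\<mm>\<close> is two as well, the Auslander--Buchsbaum formula predicts projective dimension zero. The
  following argument proves this without passing to modules over \<open>R\<^sub>\<mm>\<close>. Take a resolution of \<open>M\<close> by
  free modules \<open>F\<^sub>i\<close> of finite rank and call a map \<open>d\<close> split if \<open>d \<tau> d = d\<close> for some
  linear \<open>\<tau>\<close>; then its image and its kernel are direct summands.

  Far out, the differentials split. Lifting the identity of \<open>M\<close> to chain maps from the \<open>F\<^sub>i\<close> to the given
  projective resolution \<open>P\<close> of finite length and back yields an endomorphism of the complex \<open>F\<close> that is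
  homotopic to the identity and vanishes where \<open>P\<close> does; there the homotopy \<open>h\<close> satisfies
  \<open>d h d = d\<close> (\<open>comparison_step\<close>). The splitting thus takes place among modules of finite rank, although
  the ranks of the \<open>P\<^sub>i\<close> may be infinite.

  Splittings move down the resolution, one differential at a time (\<open>splitting_descends\<close>). Let \<open>A\<close> and
  \<open>B\<close> be consecutive differentials with \<open>A\<close> split, and \<open>K\<close> the image of \<open>B\<close> in the free module \<open>F\<close>.
  The cokernel \<open>F / K\<close> is \<open>M\<close> or a syzygy of \<open>M\<close>, and a syzygy has depth two since it is a submodule of a free
  module with torsion-free quotient (\<open>depth_two_submodule_of_cokernel\<close>). Therefore \<open>x\<close> and \<open>y\<close> satisfy \<open>(x, y) F \<inter> K = (x, y) K\<close> locally at \<open>\<mm>\<close>.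
  As the depth of \<open>R\<^sub>\<mm>\<close> is exactly two, some \<open>s\<close> outside \<open>(x, y)\<close> satisfies \<open>\<mm> s \<subseteq> (x, y)\<close> locally. So
  \<open>k \<in> K \<inter> \<mm> F\<close> gives \<open>s k \<in> (x, y) K\<close>, and hence \<open>k \<in> \<mm> K\<close> because \<open>K\<close>
  is projective. Thus \<open>K / \<mm> K\<close> embeds into \<open>F / \<mm> F\<close>, from which Gaussian elimination produces
  a splitting of \<open>B\<close> up to a factor outside \<open>\<mm>\<close> (\<open>splitting_near_maximal_ideal\<close>). The factors
  that occur for all \<open>\<mm>\<close> generate the unit ideal, so \<open>B\<close> splits.

  When the first differential is reached, \<open>M\<close> is a direct summand of a free module of finite rank.\<close>

section \<open>Prime avoidance and associated primes\<close>

lemma (in noetherian_ring) ideal_family_has_maximal: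
  assumes ideals: "\<And>I. I \<in> C \<Longrightarrow> ideal I R" and I0: "I0 \<in> C"
  shows "\<exists>M\<in>C. I0 \<subseteq> M \<and> (\<forall>J\<in>C. \<not> M \<subset> J)"
proof -
  let ?A = "{I \<in> C. I0 \<subseteq> I}"
  have "\<exists>M\<in>?A. \<forall>X\<in>?A. M \<subseteq> X \<longrightarrow> X = M"
  proof (rule subset_Zorn_nonempty)
    show "?A \<noteq> {}" using I0 by auto
    fix D assume D: "D \<noteq> {}" "subset.chain ?A D"
    then have "subset.chain {I. ideal I R} D" using ideals by (auto simp: subset.chain_def)
    then have "\<Union>D \<in> D" using ideal_chain_is_trivial D by blast
    then show "\<Union>D \<in> ?A" using D by (auto simp: subset.chain_def)
  qed
  then obtain M where M: "M \<in> ?A" "\<forall>X\<in>?A. M \<subseteq> X \<longrightarrow> X = M" by (elim bexE)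
  then have "\<not> M \<subset> J" if "J \<in> C" for J using that by auto
  then show ?thesis using M(1) by auto
qed

lemma (in noetherian_ring) proper_ideal_le_maximalideal:
  assumes "ideal I R" "I \<noteq> carrier R"
  shows "\<exists>\<mm>. maximalideal \<mm> R \<and> I \<subseteq> \<mm>"
proof -
  let ?C = "{J. ideal J R \<and> J \<noteq> carrier R}"
  have "\<exists>M\<in>?C. I \<subseteq> M \<and> (\<forall>J\<in>?C. \<not> M \<subset> J)"
    by (rule ideal_family_has_maximal) (use assms in auto)
  then obtain M where "M \<in> ?C" and IM: "I \<subseteq> M" and max: "\<forall>J\<in>?C. \<not> M \<subset> J"
    by (elim bexE conjE)
  then have M: "ideal M R" "M \<noteq> carrier R" by simp_all
  have "maximalideal M R"
  proof (rule maximalidealI)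
    show "J = M \<or> J = carrier R" if "ideal J R" "M \<subseteq> J" "J \<subseteq> carrier R" for J
      using max that by auto
  qed (use M in simp_all)
  with IM show ?thesis by (intro exI conjI)
qed

text \<open>A product of elements chosen outside the prime \<open>P\<close>, one from each ideal, stays outside \<open>P\<close>.\<close>
lemma (in cring) prime_avoid_intersection:
  assumes P: "primeideal P R" and A: "ideal A R" "\<not> A \<subseteq> P"
    and Q: "finite Q" "\<And>B. B \<in> Q \<Longrightarrow> ideal B R \<and> \<not> B \<subseteq> P"
  shows "\<exists>b\<in>A. b \<notin> P \<and> (\<forall>B\<in>Q. b \<in> B)"
  using Q
proof (induction Q rule: finite_induct)
  case empty
  then show ?case using A by auto
next
  case (insert B Q)
  then obtain b where b: "b \<in> A" "b \<notin> P" "\<forall>B\<in>Q. b \<in> B" by auto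
  obtain c where c: "c \<in> B" "c \<notin> P" using insert.prems[of B] by auto
  have car: "b \<in> carrier R" "c \<in> carrier R"
    using ideal.Icarr[OF A(1) b(1)] ideal.Icarr[OF _ c(1)] insert.prems[of B] by auto
  have "b \<otimes> c \<notin> P" using b c car primeideal.I_prime[OF P] by blast
  moreover have "b \<otimes> c \<in> A" using A b car by (simp add: ideal.I_r_closed)
  moreover have "b \<otimes> c \<in> B" using insert.prems[of B] c car by (auto simp: ideal.I_l_closed)
  moreover have "b \<otimes> c \<in> B'" if "B' \<in> Q" for B'
    using insert.prems[of B'] b car that by (auto simp: ideal.I_r_closed)
  ultimately show ?case by blast
qed

text \<open>Prime avoidance. Assuming that the primes are pairwise incomparable shortens the induction: if an
  element \<open>a\<close> avoiding the old primes lies in the new one, it is corrected by an element of all old primes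
  outside the new one.\<close>
lemma (in cring) prime_avoidance_antichain:
  assumes A: "ideal A R" and "finite Q"
    and "\<And>P. P \<in> Q \<Longrightarrow> primeideal P R \<and> \<not> A \<subseteq> P"
    and "\<And>P P'. P \<in> Q \<Longrightarrow> P' \<in> Q \<Longrightarrow> \<not> P \<subset> P'"
  shows "\<exists>a\<in>A. \<forall>P\<in>Q. a \<notin> P"
  using assms(2-)
proof (induction Q rule: finite_induct)
  case empty
  then show ?case using additive_subgroup.zero_closed[OF ideal.axioms(1)[OF A]] by auto
next
  case (insert P Q)
  obtain a where a: "a \<in> A" "\<forall>B\<in>Q. a \<notin> B"
    using insert.IH insert.prems by blast
  show ?case
  proof (cases "a \<in> P")
    case False
    then show ?thesis using a by auto
  next
    case True
    have "\<exists>b\<in>A. b \<notin> P \<and> (\<forall>B\<in>Q. b \<in> B)"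
    proof (rule prime_avoid_intersection)
      show "ideal B R \<and> \<not> B \<subseteq> P" if "B \<in> Q" for B
        using insert.prems(1)[of B] insert.prems(2)[of B P] insert.hyps that
        by (auto simp: primeideal_def)
    qed (use insert.hyps insert.prems(1) A in auto)
    then obtain b where b: "b \<in> A" "b \<notin> P" "\<forall>B\<in>Q. b \<in> B" by blast
    have car: "a \<in> carrier R" "b \<in> carrier R" using a b ideal.Icarr[OF A] by auto
    have cancel: "v \<in> J" if "ideal J R" "u \<in> J" "u \<oplus> v \<in> J" "v \<in> carrier R" for J u v
    proof -
      interpret J: ideal J R by fact
      have "(u \<oplus> v) \<ominus> u \<in> J" using that J.a_closed J.a_inv_closed by (simp add: minus_eq)
      moreover have "(u \<oplus> v) \<ominus> u = v" using that J.Icarr by algebra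
      ultimately show ?thesis by simp
    qed
    have "a \<oplus> b \<in> A" using a b A by (auto simp: ideal_def additive_subgroup.a_closed)
    moreover have "a \<oplus> b \<notin> P"
      using cancel[of P a b] True b car insert.prems(1)[of P] by (auto simp: primeideal_def)
    moreover have "a \<oplus> b \<notin> B" if "B \<in> Q" for B
      using cancel[of B b a] a b car that insert.prems(1)[of B] by (auto simp: primeideal_def a_comm)
    ultimately show ?thesis by blast
  qed
qed

lemma (in cring) colon_ideal:
  assumes I: "ideal I R" and s: "s \<in> carrier R"
  shows "ideal {a \<in> carrier R. a \<otimes> s \<in> I} R"
proof -
  interpret I: ideal I R by fact
  show ?thesis
  proof (rule idealI)
    show "ring R" by (rule ring_axioms)
    show "subgroup {a \<in> carrier R. a \<otimes> s \<in> I} (add_monoid R)"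
    proof (rule add.subgroupI)
      show "{a \<in> carrier R. a \<otimes> s \<in> I} \<noteq> {}" using s I.zero_closed by (auto intro!: exI[of _ \<zero>])
    next
      fix a assume a: "a \<in> {a \<in> carrier R. a \<otimes> s \<in> I}"
      then have "\<ominus> (a \<otimes> s) \<in> I" using I.a_inv_closed by auto
      then show "\<ominus> a \<in> {a \<in> carrier R. a \<otimes> s \<in> I}" using a s by (simp add: l_minus)
    qed (use s in \<open>auto simp: l_distr I.a_closed\<close>)
    fix a x assume a: "a \<in> {a \<in> carrier R. a \<otimes> s \<in> I}" and x: "x \<in> carrier R"
    have "x \<otimes> (a \<otimes> s) \<in> I" using a x by (auto simp: I.I_l_closed)
    then show "x \<otimes> a \<in> {a \<in> carrier R. a \<otimes> s \<in> I}" using a x s by (simp add: m_assoc)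
    then show "a \<otimes> x \<in> {a \<in> carrier R. a \<otimes> s \<in> I}" using a x by (simp add: m_comm)
  qed
qed

lemma (in noetherian_ring) genideal_finite_subset:
  assumes G: "G \<subseteq> carrier R"
  shows "\<exists>T\<subseteq>G. finite T \<and> Idl G = Idl T"
proof -
  let ?C = "{Idl T | T. T \<subseteq> G \<and> finite T}"
  have "\<exists>M\<in>?C. Idl {} \<subseteq> M \<and> (\<forall>J\<in>?C. \<not> M \<subset> J)"
    by (rule ideal_family_has_maximal) (use G in \<open>auto intro!: genideal_ideal\<close>)
  then obtain M where M: "M \<in> ?C" "\<forall>J\<in>?C. \<not> M \<subset> J" by (elim bexE conjE)
  then obtain T where T: "T \<subseteq> G" "finite T" and MT: "M = Idl T" by (elim CollectE exE conjE)
  have max: "\<not> Idl T \<subset> Idl T'" if "T' \<subseteq> G" "finite T'" for T'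
    using M(2) that unfolding MT by (intro notI) (drule bspec[of _ _ "Idl T'"], blast+)
  have "g \<in> Idl T" if g: "g \<in> G" for g
  proof -
    have "Idl T \<subseteq> Idl (insert g T)" using g G T by (intro subset_Idl_subset) auto
    moreover have "\<not> Idl T \<subset> Idl (insert g T)" using g T by (intro max) auto
    ultimately have "Idl (insert g T) = Idl T" by blast
    moreover have "insert g T \<subseteq> Idl (insert g T)" by (rule genideal_self) (use g G T in auto)
    ultimately show ?thesis by auto
  qed
  moreover have "ideal (Idl T) R" using G T by (intro genideal_ideal) auto
  ultimately have "Idl G \<subseteq> Idl T" by (intro genideal_minimal) auto
  moreover have "Idl T \<subseteq> Idl G" using G T by (intro subset_Idl_subset) auto
  ultimately show ?thesis using T by blast
qed

text \<open>A maximal ideal consisting of zero divisors on \<open>R / I\<close> is the annihilator of an element of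
  \<open>R / I\<close>. The maximal ones among the annihilators of nonzero elements are prime; there are only
  finitely many of them, since the elements that they annihilate generate a finitely generated ideal;
  and every zero divisor lies in one of them, so that prime avoidance applies.\<close>
lemma zero_divisors_imp_associated:
  fixes R (structure)
  assumes noeth: "noetherian_ring R" and cring: "cring R"
    and m: "maximalideal \<mm> R" and I: "ideal I R"
    and zd: "\<And>z. z \<in> \<mm> \<Longrightarrow> \<exists>a\<in>carrier R - I. z \<otimes> a \<in> I"
  shows "\<exists>s\<in>carrier R - I. \<forall>z\<in>\<mm>. z \<otimes> s \<in> I"
proof -
  interpret noetherian_ring R by fact
  interpret cring R by fact
  interpret m: maximalideal \<mm> R by fact
  interpret I: ideal I R by fact
  define Ann where "Ann s = {a \<in> carrier R. a \<otimes> s \<in> I}" for s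
  have AnnI: "ideal (Ann s) R" if "s \<in> carrier R" for s
    unfolding Ann_def using colon_ideal[OF I that] .
  define \<A> where "\<A> = Ann ` (carrier R - I)"
  define G where "G = {s \<in> carrier R - I. \<forall>J\<in>\<A>. \<not> Ann s \<subset> J}"
  have above: "\<exists>s\<in>G. Ann a \<subseteq> Ann s" if "a \<in> carrier R - I" for a
  proof -
    have "\<exists>M\<in>\<A>. Ann a \<subseteq> M \<and> (\<forall>J\<in>\<A>. \<not> M \<subset> J)"
      by (rule ideal_family_has_maximal) (use that AnnI in \<open>auto simp: \<A>_def\<close>)
    then obtain M where M: "M \<in> \<A>" "Ann a \<subseteq> M" "\<forall>J\<in>\<A>. \<not> M \<subset> J" by (elim bexE conjE)
    then obtain s where "s \<in> carrier R - I" "M = Ann s" unfolding \<A>_def by (elim imageE)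
    then show ?thesis using M unfolding G_def by (intro bexI[of _ s]) simp_all
  qed
  have prime: "primeideal (Ann s) R" if s: "s \<in> G" for s
  proof (rule primeidealI)
    have sc: "s \<in> carrier R" "s \<notin> I" using s by (auto simp: G_def)
    show "ideal (Ann s) R" using AnnI sc by blast
    show "cring R" by (rule is_cring)
    show "carrier R \<noteq> Ann s"
    proof
      assume "carrier R = Ann s"
      then have "\<one> \<in> Ann s" by auto
      then show False using sc by (simp add: Ann_def)
    qed
    fix a b assume ab: "a \<in> carrier R" "b \<in> carrier R" "a \<otimes> b \<in> Ann s"
    show "a \<in> Ann s \<or> b \<in> Ann s"
    proof (rule disjCI)
      assume "b \<notin> Ann s"
      then have bs: "b \<otimes> s \<in> carrier R - I" using ab sc by (auto simp: Ann_def)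
      have "Ann s \<subseteq> Ann (b \<otimes> s)"
      proof
        fix c assume c: "c \<in> Ann s"
        then have "b \<otimes> (c \<otimes> s) \<in> I" "c \<in> carrier R" using ab by (auto simp: Ann_def I.I_l_closed)
        then show "c \<in> Ann (b \<otimes> s)" using ab sc by (simp add: Ann_def m_lcomm)
      qed
      then have "Ann (b \<otimes> s) = Ann s" using s bs by (auto simp: G_def \<A>_def)
      moreover have "a \<in> Ann (b \<otimes> s)" using ab sc by (simp add: Ann_def m_assoc)
      ultimately show "a \<in> Ann s" by simp
    qed
  qed
  obtain T where T: "T \<subseteq> G" "finite T" "Idl G = Idl T"
    using genideal_finite_subset[of G] by (auto simp: G_def)
  \<comment> \<open>\<open>s\<close> is a combination of \<open>T\<close>, so its annihilator contains the intersection of those of \<open>T\<close>; being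
    prime it contains one of them, and by maximality it is equal to it.\<close>
  have fin: "Ann s \<in> Ann ` T" if s: "s \<in> G" for s
  proof (rule ccontr)
    assume no: "Ann s \<notin> Ann ` T"
    have sc: "s \<in> carrier R" "s \<notin> I" using s by (auto simp: G_def)
    have Tc: "t \<in> carrier R" if "t \<in> T" for t using T that by (auto simp: G_def)
    have "\<exists>b\<in>carrier R. b \<notin> Ann s \<and> (\<forall>B\<in>Ann ` T. b \<in> B)"
    proof (rule prime_avoid_intersection)
      show "primeideal (Ann s) R" using prime s by blast
      then show "\<not> carrier R \<subseteq> Ann s" by (auto simp: Ann_def primeideal_def primeideal_axioms_def)
      show "ideal B R \<and> \<not> B \<subseteq> Ann s" if B: "B \<in> Ann ` T" for B
      proof -
        obtain t where t: "t \<in> T" "B = Ann t" using B by auto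
        have "B \<noteq> Ann s" using no B by auto
        then have "\<not> B \<subseteq> Ann s" using T t s sc by (auto simp: G_def \<A>_def)
        then show ?thesis using t Tc AnnI by auto
      qed
    qed (use T oneideal in auto)
    then obtain b where b: "b \<in> carrier R" "b \<notin> Ann s" "\<And>t. t \<in> T \<Longrightarrow> b \<in> Ann t" by auto
    have "Idl T \<subseteq> {a \<in> carrier R. a \<otimes> b \<in> I}"
      by (rule genideal_minimal[OF colon_ideal[OF I b(1)]])
        (use b(3) Tc b(1) in \<open>auto simp: Ann_def m_comm\<close>)
    moreover have "s \<in> Idl T"
      using genideal_self[of G] s T(3) by (auto simp: G_def)
    ultimately show False using b sc by (auto simp: Ann_def m_comm)
  qed
  have "\<exists>t\<in>T. \<mm> \<subseteq> Ann t"
  proof (rule ccontr)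
    assume no: "\<not> ?thesis"
    have "\<exists>z\<in>\<mm>. \<forall>P\<in>Ann ` T. z \<notin> P"
    proof (rule prime_avoidance_antichain)
      show "ideal \<mm> R" by (rule m.is_ideal)
      show "primeideal P R \<and> \<not> \<mm> \<subseteq> P" if "P \<in> Ann ` T" for P
        using that no prime T by auto
      show "\<not> P \<subset> P'" if "P \<in> Ann ` T" "P' \<in> Ann ` T" for P P'
        using that T(1) unfolding G_def \<A>_def by blast
    qed (use T(2) in simp)
    then obtain z where z: "z \<in> \<mm>" "\<And>t. t \<in> T \<Longrightarrow> z \<notin> Ann t" by auto
    obtain a where a: "a \<in> carrier R - I" "z \<otimes> a \<in> I" using zd z by blast
    obtain s where s: "s \<in> G" "Ann a \<subseteq> Ann s" using above a by blast
    have "z \<in> Ann a" using a z m.Icarr by (auto simp: Ann_def)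
    then show False using s fin[of s] z by auto
  qed
  then obtain t where "t \<in> T" "\<mm> \<subseteq> Ann t" by blast
  then show ?thesis using T by (auto simp: Ann_def G_def)
qed

lemma (in cring) genideal_pair:
  assumes "x \<in> carrier R" "y \<in> carrier R"
  shows "Idl {x, y} = {x \<otimes> a \<oplus> y \<otimes> b | a b. a \<in> carrier R \<and> b \<in> carrier R}" (is "_ = ?J")
proof
  have J: "ideal ?J R"
  proof (rule idealI)
    show "ring R" by (rule ring_axioms)
    show "subgroup ?J (add_monoid R)"
    proof (rule add.subgroupI)
      show "?J \<subseteq> carrier R" using assms by auto
      show "?J \<noteq> {}" by blast
      fix c assume "c \<in> ?J"
      then obtain a b where c: "c = x \<otimes> a \<oplus> y \<otimes> b" "a \<in> carrier R" "b \<in> carrier R" by blast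
      then have "\<ominus> c = x \<otimes> (\<ominus> a) \<oplus> y \<otimes> (\<ominus> b)" using assms by (simp, algebra)
      then show "\<ominus> c \<in> ?J" using c by blast
      fix d assume "d \<in> ?J"
      then obtain a' b' where d: "d = x \<otimes> a' \<oplus> y \<otimes> b'" "a' \<in> carrier R" "b' \<in> carrier R" by blast
      have "c \<oplus> d = x \<otimes> (a \<oplus> a') \<oplus> y \<otimes> (b \<oplus> b')" using assms c d by (simp, algebra)
      then show "c \<oplus> d \<in> ?J" using c d by blast
    qed
    fix c r assume "c \<in> ?J" and r: "r \<in> carrier R"
    then obtain a b where c: "c = x \<otimes> a \<oplus> y \<otimes> b" "a \<in> carrier R" "b \<in> carrier R" by blast
    then have "r \<otimes> c = x \<otimes> (r \<otimes> a) \<oplus> y \<otimes> (r \<otimes> b)" "c \<otimes> r = x \<otimes> (r \<otimes> a) \<oplus> y \<otimes> (r \<otimes> b)"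
      using assms r by (simp, algebra)+
    then show "r \<otimes> c \<in> ?J" "c \<otimes> r \<in> ?J" using c r by blast+
  qed
  have "x = x \<otimes> \<one> \<oplus> y \<otimes> \<zero>" "y = x \<otimes> \<zero> \<oplus> y \<otimes> \<one>" using assms by auto
  then have "{x, y} \<subseteq> ?J" by blast
  then show "Idl {x, y} \<subseteq> ?J" by (rule genideal_minimal[OF J])
  have K: "ideal (Idl {x, y}) R" using assms by (intro genideal_ideal) auto
  then interpret K: ideal "Idl {x, y}" R .
  have "x \<in> Idl {x, y}" "y \<in> Idl {x, y}" using genideal_self[of "{x, y}"] assms by auto
  then show "?J \<subseteq> Idl {x, y}" by (auto intro!: K.a_closed K.I_r_closed)
qed

section \<open>Depth two after localization\<close>

lemma regular_sequence_snoc: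
  assumes "regular_sequence R xs" "z \<in> carrier R"
    and "\<And>r. r \<in> carrier R \<Longrightarrow> z \<otimes>\<^bsub>R\<^esub> r \<in> Idl\<^bsub>R\<^esub> (set xs) \<Longrightarrow> r \<in> Idl\<^bsub>R\<^esub> (set xs)"
    and "Idl\<^bsub>R\<^esub> (set (xs @ [z])) \<noteq> carrier R"
  shows "regular_sequence R (xs @ [z])"
proof -
  have "r \<in> Idl\<^bsub>R\<^esub> (set (take i (xs @ [z])))"
    if i: "i < length (xs @ [z])" and r: "r \<in> carrier R"
      "(xs @ [z]) ! i \<otimes>\<^bsub>R\<^esub> r \<in> Idl\<^bsub>R\<^esub> (set (take i (xs @ [z])))" for i r
  proof (cases "i = length xs")
    case True
    then show ?thesis using assms(3) r by simp
  next
    case False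
    then have "i < length xs" using i by simp
    then show ?thesis using assms(1) r by (simp add: regular_sequence_def nth_append)
  qed
  then show ?thesis using assms(1,2,4) by (simp add: regular_sequence_def)
qed

text \<open>A supremum that is a positive natural number is a maximum.\<close>
lemma depth_attained:
  assumes "depth_in R I = enat (Suc n)"
  obtains xs where "regular_sequence R xs" "set xs \<subseteq> I" "length xs = Suc n"
proof -
  have le: "length xs \<le> Suc n" if "regular_sequence R xs" "set xs \<subseteq> I" for xs
  proof -
    have "enat (length xs) \<le> depth_in R I"
      unfolding depth_in_def by (rule Sup_upper) (use that in blast)
    then show ?thesis using assms by simp
  qed
  have "\<not> depth_in R I \<le> enat n" using assms by simp
  then obtain xs where xs: "regular_sequence R xs" "set xs \<subseteq> I" "\<not> length xs \<le> n"
    unfolding depth_in_def Sup_le_iff by auto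
  with le[of xs] have "length xs = Suc n" by simp
  with xs that show ?thesis by blast
qed

text \<open>In \<open>R\<^sub>\<mm>\<close>, the element \<open>y\<close> is a nonzerodivisor modulo the nonzero element \<open>x\<close>, and \<open>s\<close> generates a copy of the
  residue field in \<open>R\<^sub>\<mm> / (x, y)\<close>. Denominators are cleared, so that all later arguments take place in
  \<open>R\<close>.\<close>
definition depth_two_witness :: "('a, 'm) ring_scheme \<Rightarrow> 'a set \<Rightarrow> 'a \<Rightarrow> 'a \<Rightarrow> 'a \<Rightarrow> bool" where
  "depth_two_witness R \<mm> x y s \<longleftrightarrow>
     x \<in> carrier R \<and> y \<in> carrier R \<and> s \<in> carrier R \<and> x \<noteq> \<zero>\<^bsub>R\<^esub> \<and>
     (\<forall>a\<in>carrier R. \<forall>b\<in>carrier R. y \<otimes>\<^bsub>R\<^esub> a = x \<otimes>\<^bsub>R\<^esub> b \<longrightarrow>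
        (\<exists>u\<in>carrier R - \<mm>. \<exists>c\<in>carrier R. u \<otimes>\<^bsub>R\<^esub> a = x \<otimes>\<^bsub>R\<^esub> c)) \<and>
     (\<forall>z\<in>\<mm>. \<exists>u\<in>carrier R - \<mm>. \<exists>b\<in>carrier R. \<exists>c\<in>carrier R.
        u \<otimes>\<^bsub>R\<^esub> (z \<otimes>\<^bsub>R\<^esub> s) = x \<otimes>\<^bsub>R\<^esub> b \<oplus>\<^bsub>R\<^esub> y \<otimes>\<^bsub>R\<^esub> c) \<and>
     (\<forall>u\<in>carrier R - \<mm>. \<forall>b\<in>carrier R. \<forall>c\<in>carrier R.
        u \<otimes>\<^bsub>R\<^esub> s \<noteq> x \<otimes>\<^bsub>R\<^esub> b \<oplus>\<^bsub>R\<^esub> y \<otimes>\<^bsub>R\<^esub> c)"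

text \<open>A regular sequence of length two in \<open>R\<^sub>\<mm>\<close> supplies \<open>x\<close> and \<open>y\<close> as numerators. It cannot be
  prolonged, so \<open>\<mm>\<close> consists of zero divisors modulo the contraction of the ideal \<open>(x, y) R\<^sub>\<mm>\<close>, and
  \<open>s\<close> is an element annihilated by \<open>\<mm>\<close> there.\<close>
lemma cohen_macaulay_depth_two_witness:
  fixes R :: "('a, 'm) ring_scheme" (structure)
  assumes dom: "noetherian_domain R" and CM: "cohen_macaulay R" and m: "maximalideal \<mm> R"
    and dim: "krull_dim (localization_at R \<mm>) = 2"
  shows "\<exists>x y s. depth_two_witness R \<mm> x y s"
proof -
  interpret noetherian_domain R by fact
  have cR: "cring R" by (rule is_cring)
  interpret m: maximalideal \<mm> R by fact
  interpret mp: primeideal \<mm> R by (rule maximalideal_prime[OF m])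
  define S where "S = carrier R - \<mm>"
  define L where "L = localization_at R \<mm>"
  define fr where "fr = frac_class R S"
  have S1: "\<one> \<in> S" using m.one_imp_carrier m.I_notcarr by (auto simp: S_def)
  have SR: "t \<in> carrier R" if "t \<in> S" for t using that by (simp add: S_def)
  have S0: "t \<noteq> \<zero>" if "t \<in> S" for t using that by (auto simp: S_def)
  have Sm: "t \<otimes> t' \<in> S" if "t \<in> S" "t' \<in> S" for t t'
    using that mp.I_prime[of t t'] by (auto simp: S_def)
  have Ssub: "S \<subseteq> carrier R" using SR by blast
  have fr_eq: "fr a t = fr b w \<longleftrightarrow> w \<otimes> a = t \<otimes> b"
    if "a \<in> carrier R" "t \<in> S" "b \<in> carrier R" "w \<in> S" for a t b w
  proof -
    have "fr a t = fr b w \<longleftrightarrow> (\<exists>u\<in>S. u \<otimes> (w \<otimes> a \<ominus> t \<otimes> b) = \<zero>)"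
      unfolding fr_def by (rule frac_class_eq_iff) (use Ssub Sm that in auto)
    also have "\<dots> \<longleftrightarrow> w \<otimes> a \<ominus> t \<otimes> b = \<zero>"
      using that SR S0 S1 by (auto simp: integral_iff)
    also have "\<dots> \<longleftrightarrow> w \<otimes> a = t \<otimes> b" using that SR by simp
    finally show ?thesis .
  qed
  have fr_mult: "fr a t \<otimes>\<^bsub>L\<^esub> fr b w = fr (a \<otimes> b) (t \<otimes> w)"
    and fr_add: "fr a t \<oplus>\<^bsub>L\<^esub> fr b w = fr (w \<otimes> a \<oplus> t \<otimes> b) (t \<otimes> w)"
    if "a \<in> carrier R" "t \<in> S" "b \<in> carrier R" "w \<in> S" for a t b w
    unfolding fr_def L_def localization_at_def S_def[symmetric]
    by (rule fraction_ring_ops; use Ssub Sm that in auto)+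
  have frL: "fr a t \<in> carrier L" if "a \<in> carrier R" "t \<in> S" for a t
    using that unfolding fr_def L_def localization_at_def S_def[symmetric] fraction_ring_def by auto
  have Lfr: "\<exists>a\<in>carrier R. \<exists>t\<in>S. \<xi> = fr a t" if "\<xi> \<in> carrier L" for \<xi>
    using that unfolding fr_def L_def localization_at_def S_def[symmetric] fraction_ring_def by auto
  have L0: "\<zero>\<^bsub>L\<^esub> = fr \<zero> \<one>" and L1: "\<one>\<^bsub>L\<^esub> = fr \<one> \<one>"
    unfolding fr_def L_def localization_at_def S_def[symmetric] fraction_ring_def by auto
  from CM m have "cohen_macaulay_local L" unfolding L_def cohen_macaulay_def by blast
  then obtain M where cL: "cring L" and nL: "noetherian_ring L"
    and Mmax: "\<And>J. maximalideal J L \<longleftrightarrow> J = M" and depth: "depth_in L M = krull_dim L"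
    unfolding cohen_macaulay_local_def by blast
  interpret L: cring L by (rule cL)
  interpret nL: noetherian_ring L by (rule nL)
  interpret M: maximalideal M L using Mmax by blast
  have depth2: "depth_in L M = enat (Suc 1)"
    using depth dim unfolding L_def by (simp add: numeral_eq_enat)
  then obtain xs where xs: "regular_sequence L xs" "set xs \<subseteq> M" "length xs = Suc 1"
    using depth_attained by blast
  then obtain \<xi> \<eta> where xs_eq: "xs = [\<xi>, \<eta>]"
    by (cases xs; cases "tl xs") auto
  have \<xi>L: "\<xi> \<in> carrier L" "\<eta> \<in> carrier L" using xs xs_eq by (auto simp: regular_sequence_def)
  have proper: "Idl\<^bsub>L\<^esub> {\<xi>, \<eta>} \<noteq> carrier L" using xs xs_eq by (auto simp: regular_sequence_def)
  have reg: "r \<in> Idl\<^bsub>L\<^esub> (set (take i [\<xi>, \<eta>]))"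
    if "i < 2" "r \<in> carrier L" "[\<xi>, \<eta>] ! i \<otimes>\<^bsub>L\<^esub> r \<in> Idl\<^bsub>L\<^esub> (set (take i [\<xi>, \<eta>]))" for i r
    using xs(1) that unfolding xs_eq regular_sequence_def by auto
  have reg1: "r \<in> Idl\<^bsub>L\<^esub> {\<xi>}" if "r \<in> carrier L" "\<eta> \<otimes>\<^bsub>L\<^esub> r \<in> Idl\<^bsub>L\<^esub> {\<xi>}" for r
    using reg[of 1 r] that by simp
  have reg0: "r \<in> Idl\<^bsub>L\<^esub> {}" if "r \<in> carrier L" "\<xi> \<otimes>\<^bsub>L\<^esub> r \<in> Idl\<^bsub>L\<^esub> {}" for r
    using reg[of 0 r] that by simp
  obtain x t where x: "x \<in> carrier R" "t \<in> S" "\<xi> = fr x t" using Lfr \<xi>L by blast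
  obtain y t' where y: "y \<in> carrier R" "t' \<in> S" "\<eta> = fr y t'" using Lfr \<xi>L by blast
  have x0: "x \<noteq> \<zero>"
  proof
    assume "x = \<zero>"
    then have \<xi>0: "\<xi> \<otimes>\<^bsub>L\<^esub> \<one>\<^bsub>L\<^esub> = \<zero>\<^bsub>L\<^esub>" using x S1 SR \<xi>L by (simp add: L0 fr_eq)
    have E: "ideal (Idl\<^bsub>L\<^esub> {}) L" by (rule L.genideal_ideal) simp
    have "\<one>\<^bsub>L\<^esub> \<in> Idl\<^bsub>L\<^esub> {}"
      by (rule reg0, rule L.one_closed, unfold \<xi>0)
        (rule additive_subgroup.zero_closed[OF ideal.axioms(1)[OF E]])
    moreover have "Idl\<^bsub>L\<^esub> {} \<subseteq> Idl\<^bsub>L\<^esub> {\<xi>, \<eta>}"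
      using \<xi>L by (intro L.subset_Idl_subset) auto
    moreover have "ideal (Idl\<^bsub>L\<^esub> {\<xi>, \<eta>}) L" using \<xi>L by (intro L.genideal_ideal) auto
    ultimately show False using proper ideal.one_imp_carrier by blast
  qed
  have PI: "Idl\<^bsub>L\<^esub> {\<xi>} = {\<rho> \<otimes>\<^bsub>L\<^esub> \<xi> | \<rho>. \<rho> \<in> carrier L}"
    using L.cgenideal_eq_genideal[OF \<xi>L(1)] by (simp add: cgenideal_def)
  have y_reg: "\<exists>u\<in>S. \<exists>c\<in>carrier R. u \<otimes> a = x \<otimes> c"
    if ab: "a \<in> carrier R" "b \<in> carrier R" "y \<otimes> a = x \<otimes> b" for a b
  proof -
    have "\<eta> \<otimes>\<^bsub>L\<^esub> fr a \<one> = fr (y \<otimes> a) t'" using y ab S1 SR by (simp add: fr_mult)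
    also have "\<dots> = fr (t \<otimes> b) t' \<otimes>\<^bsub>L\<^esub> \<xi>"
      using x y ab SR[OF x(2)] SR[OF y(2)] Sm[OF y(2) x(2)]
      by (simp add: fr_mult fr_eq) algebra
    finally have "\<eta> \<otimes>\<^bsub>L\<^esub> fr a \<one> \<in> Idl\<^bsub>L\<^esub> {\<xi>}"
      unfolding PI using frL[of "t \<otimes> b" t'] ab x y SR by auto
    then have "fr a \<one> \<in> Idl\<^bsub>L\<^esub> {\<xi>}" by (rule reg1[OF frL[OF ab(1) S1]])
    then obtain \<rho> where "\<rho> \<in> carrier L" and 1: "fr a \<one> = \<rho> \<otimes>\<^bsub>L\<^esub> \<xi>" unfolding PI by blast
    then obtain c v where c: "c \<in> carrier R" "v \<in> S" "\<rho> = fr c v" using Lfr by blast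
    have "fr a \<one> = fr (c \<otimes> x) (v \<otimes> t)" using 1 c x by (simp add: fr_mult)
    then have "(v \<otimes> t) \<otimes> a = \<one> \<otimes> (c \<otimes> x)" using c x ab S1 Sm by (subst (asm) fr_eq) auto
    then have "(v \<otimes> t) \<otimes> a = x \<otimes> c" using c x by (simp add: m_comm)
    then show ?thesis using c x Sm by blast
  qed
  \<comment> \<open>The contraction to \<open>R\<close> of the ideal generated by \<open>\<xi>\<close> and \<open>\<eta>\<close>.\<close>
  define I where "I = {a \<in> carrier R. \<exists>u\<in>S. \<exists>b\<in>carrier R. \<exists>c\<in>carrier R. u \<otimes> a = x \<otimes> b \<oplus> y \<otimes> c}"
  have I_iff: "fr a w \<in> Idl\<^bsub>L\<^esub> {\<xi>, \<eta>} \<longleftrightarrow> a \<in> I" if aw: "a \<in> carrier R" "w \<in> S" for a w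
  proof
    assume "fr a w \<in> Idl\<^bsub>L\<^esub> {\<xi>, \<eta>}"
    then obtain \<beta> \<gamma> where bg: "\<beta> \<in> carrier L" "\<gamma> \<in> carrier L" and 1: "fr a w = \<xi> \<otimes>\<^bsub>L\<^esub> \<beta> \<oplus>\<^bsub>L\<^esub> \<eta> \<otimes>\<^bsub>L\<^esub> \<gamma>"
      using L.genideal_pair[OF \<xi>L] by auto
    obtain b v where b: "b \<in> carrier R" "v \<in> S" "\<beta> = fr b v" using Lfr bg by blast
    obtain c v' where c: "c \<in> carrier R" "v' \<in> S" "\<gamma> = fr c v'" using Lfr bg by blast
    have d: "t \<otimes> v \<in> S" "t' \<otimes> v' \<in> S" using b c x y Sm by auto
    then have dd: "t \<otimes> v \<otimes> (t' \<otimes> v') \<in> S" using Sm by blast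
    have car: "t \<in> carrier R" "v \<in> carrier R" "t' \<in> carrier R" "v' \<in> carrier R" "w \<in> carrier R"
      using SR x y b c aw by auto
    have "fr a w = fr (t' \<otimes> v' \<otimes> (x \<otimes> b) \<oplus> t \<otimes> v \<otimes> (y \<otimes> c)) (t \<otimes> v \<otimes> (t' \<otimes> v'))"
      using 1 b c x y d by (simp add: fr_mult fr_add)
    then have "(t \<otimes> v \<otimes> (t' \<otimes> v')) \<otimes> a = w \<otimes> (t' \<otimes> v' \<otimes> (x \<otimes> b) \<oplus> t \<otimes> v \<otimes> (y \<otimes> c))"
      using aw dd car b c x y by (subst (asm) fr_eq) auto
    also have "\<dots> = x \<otimes> (w \<otimes> (t' \<otimes> v' \<otimes> b)) \<oplus> y \<otimes> (w \<otimes> (t \<otimes> v \<otimes> c))"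
      using car b(1) c(1) x(1) y(1) by algebra
    finally show "a \<in> I" unfolding I_def using aw dd car b c by blast
  next
    assume "a \<in> I"
    then obtain u b c where u: "u \<in> S" "b \<in> carrier R" "c \<in> carrier R" "u \<otimes> a = x \<otimes> b \<oplus> y \<otimes> c"
      unfolding I_def by blast
    have car: "t \<in> carrier R" "u \<in> carrier R" "t' \<in> carrier R" "w \<in> carrier R"
      using SR x y u aw by auto
    have d: "w \<otimes> u \<in> S" using aw u Sm by blast
    have d': "t \<otimes> (w \<otimes> u) \<in> S" "t' \<otimes> (w \<otimes> u) \<in> S" using d x y Sm by auto
    have dd: "t \<otimes> (w \<otimes> u) \<otimes> (t' \<otimes> (w \<otimes> u)) \<in> S" using d' Sm by blast
    have "(t \<otimes> (w \<otimes> u) \<otimes> (t' \<otimes> (w \<otimes> u))) \<otimes> a = t \<otimes> t' \<otimes> w \<otimes> w \<otimes> u \<otimes> (u \<otimes> a)"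
      using car aw(1) by algebra
    also have "\<dots> = w \<otimes> (t' \<otimes> (w \<otimes> u) \<otimes> (x \<otimes> (t \<otimes> b)) \<oplus> t \<otimes> (w \<otimes> u) \<otimes> (y \<otimes> (t' \<otimes> c)))"
      unfolding u(4) using car u(2,3) x(1) y(1) by algebra
    finally have "fr a w = fr (t' \<otimes> (w \<otimes> u) \<otimes> (x \<otimes> (t \<otimes> b)) \<oplus> t \<otimes> (w \<otimes> u) \<otimes> (y \<otimes> (t' \<otimes> c)))
        (t \<otimes> (w \<otimes> u) \<otimes> (t' \<otimes> (w \<otimes> u)))"
      using aw dd car u(2,3) x(1) y(1) by (subst fr_eq) auto
    also have "\<dots> = \<xi> \<otimes>\<^bsub>L\<^esub> fr (t \<otimes> b) (w \<otimes> u) \<oplus>\<^bsub>L\<^esub> \<eta> \<otimes>\<^bsub>L\<^esub> fr (t' \<otimes> c) (w \<otimes> u)"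
      using x y u car d d' by (simp add: fr_mult fr_add)
    also have "\<dots> \<in> Idl\<^bsub>L\<^esub> {\<xi>, \<eta>}"
      unfolding L.genideal_pair[OF \<xi>L]
      by (intro CollectI exI conjI, rule refl) (use frL[OF _ d] car u(2,3) in simp_all)
    finally show "fr a w \<in> Idl\<^bsub>L\<^esub> {\<xi>, \<eta>}" .
  qed
  have idealI: "ideal I R"
  proof (rule idealI)
    show "ring R" by (rule ring_axioms)
    have mul: "r \<otimes> a \<in> I" if a: "a \<in> I" and r: "r \<in> carrier R" for a r
    proof -
      obtain u b c where u: "u \<in> S" "b \<in> carrier R" "c \<in> carrier R" "u \<otimes> a = x \<otimes> b \<oplus> y \<otimes> c"
        "a \<in> carrier R" using a unfolding I_def by blast
      have "u \<otimes> (r \<otimes> a) = r \<otimes> (u \<otimes> a)" using SR[OF u(1)] u(5) r by algebra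
      also have "\<dots> = x \<otimes> (r \<otimes> b) \<oplus> y \<otimes> (r \<otimes> c)" unfolding u(4) using u(2,3) x(1) y(1) r by algebra
      finally show ?thesis unfolding I_def using u r by blast
    qed
    show "r \<otimes> a \<in> I" "a \<otimes> r \<in> I" if "a \<in> I" "r \<in> carrier R" for a r
      using mul[OF that] that by (auto simp: m_comm I_def)
    show "subgroup I (add_monoid R)"
    proof (rule add.subgroupI)
      show "I \<subseteq> carrier R" by (auto simp: I_def)
      have "\<one> \<otimes> \<zero> = x \<otimes> \<zero> \<oplus> y \<otimes> \<zero>" using x y by simp
      then have "\<zero> \<in> I" unfolding I_def using S1 by blast
      then show "I \<noteq> {}" by blast
      show "\<ominus> a \<in> I" if "a \<in> I" for a
      proof -
        have "\<ominus> a = (\<ominus> \<one>) \<otimes> a" using that by (simp add: I_def l_minus)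
        then show ?thesis using mul[OF that, of "\<ominus> \<one>"] by simp
      qed
      show "a \<oplus> a' \<in> I" if a: "a \<in> I" and a': "a' \<in> I" for a a'
      proof -
        obtain u b c where u: "u \<in> S" "b \<in> carrier R" "c \<in> carrier R" "u \<otimes> a = x \<otimes> b \<oplus> y \<otimes> c"
          "a \<in> carrier R" using a unfolding I_def by blast
        obtain u' b' c' where u': "u' \<in> S" "b' \<in> carrier R" "c' \<in> carrier R"
          "u' \<otimes> a' = x \<otimes> b' \<oplus> y \<otimes> c'" "a' \<in> carrier R" using a' unfolding I_def by blast
        have cu: "u \<in> carrier R" "u' \<in> carrier R" using u u' SR by auto
        have "(u \<otimes> u') \<otimes> (a \<oplus> a') = u' \<otimes> (u \<otimes> a) \<oplus> u \<otimes> (u' \<otimes> a')"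
          using cu u(5) u'(5) by algebra
        also have "\<dots> = x \<otimes> (u' \<otimes> b \<oplus> u \<otimes> b') \<oplus> y \<otimes> (u' \<otimes> c \<oplus> u \<otimes> c')"
          unfolding u(4) u'(4) using cu u(2,3) u'(2,3) x(1) y(1) by algebra
        finally have "(u \<otimes> u') \<otimes> (a \<oplus> a') = x \<otimes> (u' \<otimes> b \<oplus> u \<otimes> b') \<oplus> y \<otimes> (u' \<otimes> c \<oplus> u \<otimes> c')" .
        moreover have "u \<otimes> u' \<in> S" using u u' Sm by blast
        moreover have "u' \<otimes> b \<oplus> u \<otimes> b' \<in> carrier R" "u' \<otimes> c \<oplus> u \<otimes> c' \<in> carrier R" "a \<oplus> a' \<in> carrier R"
          using cu u u' by auto
        ultimately show ?thesis unfolding I_def by blast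
      qed
    qed
  qed
  have "\<exists>a\<in>carrier R - I. z \<otimes> a \<in> I" if z: "z \<in> \<mm>" for z
  proof (rule ccontr)
    assume no: "\<not> ?thesis"
    have zc: "z \<in> carrier R" using z m.Icarr by blast
    define \<zeta> where "\<zeta> = fr z \<one>"
    have \<zeta>L: "\<zeta> \<in> carrier L" unfolding \<zeta>_def using zc S1 frL by blast
    \<comment> \<open>Only the uniqueness of the maximal ideal \<open>M\<close> is known; that \<open>\<zeta>\<close> lies in it follows since \<open>\<zeta>\<close>
      is not a unit.\<close>
    have "PIdl\<^bsub>L\<^esub> \<zeta> \<noteq> carrier L"
    proof
      assume "PIdl\<^bsub>L\<^esub> \<zeta> = carrier L"
      then obtain \<rho> where "\<rho> \<in> carrier L" and 1: "\<one>\<^bsub>L\<^esub> = \<rho> \<otimes>\<^bsub>L\<^esub> \<zeta>"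
        using L.one_closed unfolding cgenideal_def by blast
      then obtain a w where a: "a \<in> carrier R" "w \<in> S" "\<rho> = fr a w" using Lfr by blast
      have "fr \<one> \<one> = fr (a \<otimes> z) (w \<otimes> \<one>)" using 1 a zc S1 by (simp add: L1 \<zeta>_def fr_mult)
      then have "w = a \<otimes> z" using a zc S1 SR by (simp add: fr_eq)
      moreover have "a \<otimes> z \<in> \<mm>" using a z m.I_l_closed by blast
      ultimately show False using a by (simp add: S_def)
    qed
    then have "\<zeta> \<in> M"
      using nL.proper_ideal_le_maximalideal[OF L.cgenideal_ideal[OF \<zeta>L]] L.cgenideal_self[OF \<zeta>L] Mmax by blast
    have inM: "set ([\<xi>, \<eta>] @ [\<zeta>]) \<subseteq> M" using \<open>\<zeta> \<in> M\<close> xs xs_eq by auto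
    have "regular_sequence L ([\<xi>, \<eta>] @ [\<zeta>])"
    proof (rule regular_sequence_snoc)
      show "regular_sequence L [\<xi>, \<eta>]" using xs xs_eq by simp
      show "\<zeta> \<in> carrier L" by fact
      show "Idl\<^bsub>L\<^esub> (set ([\<xi>, \<eta>] @ [\<zeta>])) \<noteq> carrier L"
        using L.genideal_minimal[OF M.is_ideal inM] M.I_notcarr M.a_subset by blast
      fix r assume r: "r \<in> carrier L" "\<zeta> \<otimes>\<^bsub>L\<^esub> r \<in> Idl\<^bsub>L\<^esub> (set [\<xi>, \<eta>])"
      obtain a w where a: "a \<in> carrier R" "w \<in> S" "r = fr a w" using Lfr r by blast
      have "fr (z \<otimes> a) w \<in> Idl\<^bsub>L\<^esub> {\<xi>, \<eta>}"
        using r(2) a zc S1 SR unfolding \<zeta>_def by (simp add: fr_mult)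
      then have "z \<otimes> a \<in> I" using a zc by (simp add: I_iff)
      then have "a \<in> I" using no a by blast
      then show "r \<in> Idl\<^bsub>L\<^esub> (set [\<xi>, \<eta>])" using a I_iff by simp
    qed
    then have "enat (length ([\<xi>, \<eta>] @ [\<zeta>])) \<le> depth_in L M"
      unfolding depth_in_def by (intro Sup_upper) (use inM in blast)
    then show False using depth2 by simp
  qed
  then obtain s where s: "s \<in> carrier R - I" "\<forall>z\<in>\<mm>. z \<otimes> s \<in> I"
    using zero_divisors_imp_associated[OF noetherian_ring_axioms cR m idealI] by blast
  have "depth_two_witness R \<mm> x y s"
    unfolding depth_two_witness_def S_def[symmetric]
  proof (intro conjI ballI impI)
    fix z assume "z \<in> \<mm>"
    then show "\<exists>u\<in>S. \<exists>b\<in>carrier R. \<exists>c\<in>carrier R. u \<otimes> (z \<otimes> s) = x \<otimes> b \<oplus> y \<otimes> c"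
      using s(2) unfolding I_def by blast
  next
    fix u b c assume "u \<in> S" "b \<in> carrier R" "c \<in> carrier R"
    then show "u \<otimes> s \<noteq> x \<otimes> b \<oplus> y \<otimes> c" using s(1) unfolding I_def by blast
  qed (use x y x0 s y_reg in auto)
  then show ?thesis by blast
qed

section \<open>Module maps\<close>

lemma (in abelian_group) diff_eq_zero_iff:
  "a \<in> carrier G \<Longrightarrow> b \<in> carrier G \<Longrightarrow> a \<ominus> b = \<zero> \<longleftrightarrow> a = b"
  by (metis a_minus_def add.inv_closed minus_equality minus_minus r_neg)

lemma (in abelian_group) diff_zero: "a \<in> carrier G \<Longrightarrow> a \<ominus> \<zero> = a"
  by (metis a_minus_def add.inv_one r_zero a_inv_def)

lemma (in abelian_group) add_eq_imp_diff_eq: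
  assumes "a \<in> carrier G" "b \<in> carrier G" "c \<in> carrier G" "d \<in> carrier G" "a \<oplus> b = c \<oplus> d"
  shows "a \<ominus> c = d \<ominus> b"
proof -
  have "a = (a \<oplus> b) \<ominus> b" using assms(1-4) by (simp add: a_minus_def a_assoc r_neg)
  then have "a \<ominus> c = ((c \<oplus> d) \<ominus> b) \<ominus> c" by (simp only: assms(5))
  also have "\<dots> = c \<oplus> (\<ominus> c \<oplus> (d \<ominus> b))" using assms(1-4) unfolding a_minus_def by (simp add: a_ac)
  also have "\<dots> = d \<ominus> b" using assms(1-4) by (simp add: r_neg2)
  finally show ?thesis .
qed

lemma module_maps_closed: "h \<in> module_maps R M N \<Longrightarrow> x \<in> carrier M \<Longrightarrow> h x \<in> carrier N"
  by (auto simp: module_maps_def hom_def)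

lemma module_maps_add:
  "h \<in> module_maps R M N \<Longrightarrow> x \<in> carrier M \<Longrightarrow> y \<in> carrier M \<Longrightarrow> h (x \<oplus>\<^bsub>M\<^esub> y) = h x \<oplus>\<^bsub>N\<^esub> h y"
  by (auto simp: module_maps_def hom_def)

lemma module_maps_smult:
  "h \<in> module_maps R M N \<Longrightarrow> a \<in> carrier R \<Longrightarrow> x \<in> carrier M \<Longrightarrow> h (a \<odot>\<^bsub>M\<^esub> x) = a \<odot>\<^bsub>N\<^esub> h x"
  by (auto simp: module_maps_def hom_def)

lemma module_mapsI:
  assumes "\<And>x. x \<in> carrier M \<Longrightarrow> h x \<in> carrier N"
    and "\<And>x y. x \<in> carrier M \<Longrightarrow> y \<in> carrier M \<Longrightarrow> h (x \<oplus>\<^bsub>M\<^esub> y) = h x \<oplus>\<^bsub>N\<^esub> h y"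
    and "\<And>a x. a \<in> carrier R \<Longrightarrow> x \<in> carrier M \<Longrightarrow> h (a \<odot>\<^bsub>M\<^esub> x) = a \<odot>\<^bsub>N\<^esub> h x"
  shows "h \<in> module_maps R M N"
  using assms by (auto simp: module_maps_def hom_def)

lemma module_maps_zero:
  assumes "module R M" "module R N" "h \<in> module_maps R M N"
  shows "h \<zero>\<^bsub>M\<^esub> = \<zero>\<^bsub>N\<^esub>"
proof -
  interpret M: module R M by fact
  interpret N: module R N by fact
  have "h (\<zero>\<^bsub>R\<^esub> \<odot>\<^bsub>M\<^esub> \<zero>\<^bsub>M\<^esub>) = \<zero>\<^bsub>R\<^esub> \<odot>\<^bsub>N\<^esub> h \<zero>\<^bsub>M\<^esub>"
    using assms(3) by (intro module_maps_smult) auto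
  then show ?thesis using module_maps_closed[OF assms(3) M.M.zero_closed] by simp
qed

lemma module_maps_uminus:
  assumes "module R M" "module R N" "h \<in> module_maps R M N" "x \<in> carrier M"
  shows "h (\<ominus>\<^bsub>M\<^esub> x) = \<ominus>\<^bsub>N\<^esub> h x"
proof -
  interpret M: module R M by fact
  interpret N: module R N by fact
  have "h ((\<ominus>\<^bsub>R\<^esub> \<one>\<^bsub>R\<^esub>) \<odot>\<^bsub>M\<^esub> x) = (\<ominus>\<^bsub>R\<^esub> \<one>\<^bsub>R\<^esub>) \<odot>\<^bsub>N\<^esub> h x"
    using assms by (intro module_maps_smult[of h R]) auto
  then show ?thesis
    using assms(4) module_maps_closed[OF assms(3,4)] by (simp add: M.smult_l_minus N.smult_l_minus)
qed

lemma module_maps_minus: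
  assumes "module R M" "module R N" "h \<in> module_maps R M N" "x \<in> carrier M" "y \<in> carrier M"
  shows "h (x \<ominus>\<^bsub>M\<^esub> y) = h x \<ominus>\<^bsub>N\<^esub> h y"
proof -
  interpret M: module R M by fact
  show ?thesis using assms
    by (simp add: a_minus_def module_maps_add[of h R] module_maps_uminus)
qed

lemma module_maps_comp:
  assumes "f \<in> module_maps R M N" "g \<in> module_maps R N L"
  shows "(\<lambda>x. g (f x)) \<in> module_maps R M L"
  using assms
  by (intro module_mapsI)
    (auto simp: module_maps_closed module_maps_add[of f R M N] module_maps_add[of g R N L]
      module_maps_smult[of f R M N] module_maps_smult[of g R N L])

lemma module_maps_id: "(\<lambda>x. x) \<in> module_maps R M M"
  by (intro module_mapsI) auto

lemma module_maps_plus: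
  assumes "module R M" "module R N" "f \<in> module_maps R M N" "g \<in> module_maps R M N"
  shows "(\<lambda>x. f x \<oplus>\<^bsub>N\<^esub> g x) \<in> module_maps R M N"
proof -
  interpret N: module R N by fact
  note c = module_maps_closed[OF assms(3)] module_maps_closed[OF assms(4)]
  show ?thesis
    by (intro module_mapsI)
      (use c assms in \<open>simp_all add: module_maps_add[of _ R M N] module_maps_smult[of _ R M N]
         N.smult_r_distr N.M.a_assoc N.M.a_lcomm\<close>)
qed

lemma module_maps_scale:
  assumes "module R M" "module R N" "f \<in> module_maps R M N" "a \<in> carrier R"
  shows "(\<lambda>x. a \<odot>\<^bsub>N\<^esub> f x) \<in> module_maps R M N"
proof -
  interpret N: module R N by fact
  note c = module_maps_closed[OF assms(3)]
  show ?thesis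
    by (intro module_mapsI)
      (use c assms(3,4) in \<open>simp_all add: module_maps_add[of _ R M N] module_maps_smult[of _ R M N]
         N.smult_r_distr N.smult_assoc1[symmetric] N.R.m_comm\<close>)
qed

lemma module_maps_cong:
  assumes "module R M" "h \<in> module_maps R M N" "\<And>x. x \<in> carrier M \<Longrightarrow> h x = h' x"
  shows "h' \<in> module_maps R M N"
proof -
  interpret M: module R M by fact
  show ?thesis
    by (intro module_mapsI)
      (use assms(3) in \<open>simp_all add: assms(3)[symmetric] module_maps_closed[OF assms(2)]
        module_maps_add[OF assms(2)] module_maps_smult[OF assms(2)]\<close>)
qed

lemma module_maps_diff:
  assumes "module R M" "module R N" "f \<in> module_maps R M N" "g \<in> module_maps R M N"
  shows "(\<lambda>x. f x \<ominus>\<^bsub>N\<^esub> g x) \<in> module_maps R M N"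
proof -
  interpret N: module R N by fact
  have "(\<lambda>x. f x \<oplus>\<^bsub>N\<^esub> (\<ominus>\<^bsub>R\<^esub> \<one>\<^bsub>R\<^esub>) \<odot>\<^bsub>N\<^esub> g x) \<in> module_maps R M N"
    by (intro module_maps_plus module_maps_scale assms) auto
  moreover have "f x \<oplus>\<^bsub>N\<^esub> (\<ominus>\<^bsub>R\<^esub> \<one>\<^bsub>R\<^esub>) \<odot>\<^bsub>N\<^esub> g x = f x \<ominus>\<^bsub>N\<^esub> g x" if "x \<in> carrier M" for x
    using module_maps_closed[OF assms(4) that] by (simp add: a_minus_def N.smult_l_minus)
  ultimately show ?thesis by (rule module_maps_cong[OF assms(1)])
qed

lemma module_maps_restrict:
  assumes "h \<in> module_maps R M N" "\<And>x. x \<in> carrier M \<Longrightarrow> h x \<in> H"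
  shows "h \<in> module_maps R M (N\<lparr>carrier := H\<rparr>)"
  using assms by (auto simp: module_maps_def hom_def)

lemma image_submodule:
  assumes "module R M" "module R N" "h \<in> module_maps R M N"
  shows "submodule (h ` carrier M) R N"
proof -
  interpret M: module R M by fact
  interpret N: module R N by fact
  show ?thesis
  proof (rule N.submoduleI)
    show "h ` carrier M \<subseteq> carrier N" using module_maps_closed[OF assms(3)] by blast
    show "\<zero>\<^bsub>N\<^esub> \<in> h ` carrier M"
      using module_maps_zero[OF assms] M.M.zero_closed by (metis image_eqI)
    fix a assume "a \<in> h ` carrier M"
    then obtain x where x: "x \<in> carrier M" "a = h x" by blast
    then have "\<ominus>\<^bsub>N\<^esub> a = h (\<ominus>\<^bsub>M\<^esub> x)" using module_maps_uminus[OF assms] by simp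
    then show "\<ominus>\<^bsub>N\<^esub> a \<in> h ` carrier M" using x by simp
    {
      fix b assume "b \<in> h ` carrier M"
      then obtain y where y: "y \<in> carrier M" "b = h y" by blast
      then have "a \<oplus>\<^bsub>N\<^esub> b = h (x \<oplus>\<^bsub>M\<^esub> y)" using x module_maps_add[OF assms(3)] by simp
      then show "a \<oplus>\<^bsub>N\<^esub> b \<in> h ` carrier M" using x y by simp
    }
    fix r assume r: "r \<in> carrier R"
    then have "r \<odot>\<^bsub>N\<^esub> a = h (r \<odot>\<^bsub>M\<^esub> x)" using x module_maps_smult[OF assms(3)] by simp
    then show "r \<odot>\<^bsub>N\<^esub> a \<in> h ` carrier M" using x r by simp
  qed
qed

lemma vimage_submodule:
  assumes "module R M" "module R N" "h \<in> module_maps R M N" "submodule H R N"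
  shows "submodule {x \<in> carrier M. h x \<in> H} R M"
proof -
  interpret M: module R M by fact
  interpret N: module R N by fact
  note H = N.submoduleE[OF assms(4)]
  have "\<zero>\<^bsub>N\<^esub> \<in> H" using H(2,3,5,1) N.M.r_neg by (metis ex_in_conv subsetD)
  then show ?thesis
    by (intro M.submoduleI)
      (use H in \<open>auto simp: module_maps_zero[OF assms(1-3)] module_maps_uminus[OF assms(1-3)]
        module_maps_add[OF assms(3)] module_maps_smult[OF assms(3)]\<close>)
qed

lemma zero_submodule:
  assumes "module R M"
  shows "submodule {\<zero>\<^bsub>M\<^esub>} R M"
proof -
  interpret M: module R M by fact
  show ?thesis by (rule M.submoduleI) auto
qed

lemma kernel_submodule:
  assumes "module R M" "module R N" "h \<in> module_maps R M N"
  shows "submodule {x \<in> carrier M. h x = \<zero>\<^bsub>N\<^esub>} R M"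
  using vimage_submodule[OF assms zero_submodule[OF assms(2)]] by simp

lemma submodule_zero_mem: "submodule H R M \<Longrightarrow> \<zero>\<^bsub>M\<^esub> \<in> H"
  using subgroup.one_closed[OF submodule.axioms(1)] by fastforce

lemma submodule_minus_mem:
  "module R M \<Longrightarrow> submodule H R M \<Longrightarrow> x \<in> H \<Longrightarrow> y \<in> H \<Longrightarrow> x \<ominus>\<^bsub>M\<^esub> y \<in> H"
  by (simp add: a_minus_def module.submoduleE)

section \<open>Free modules\<close>

definition unit_vec :: "('a, 'm) ring_scheme \<Rightarrow> 'i set \<Rightarrow> 'i \<Rightarrow> 'i \<Rightarrow> 'a" where
  "unit_vec R I i = (\<lambda>j\<in>I. if j = i then \<one>\<^bsub>R\<^esub> else \<zero>\<^bsub>R\<^esub>)"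

lemma free_module_carrier_finite: "finite I \<Longrightarrow> carrier (free_module R I) = I \<rightarrow>\<^sub>E carrier R"
  by (auto simp: free_module_def)

lemma free_module_coord: "f \<in> carrier (free_module R I) \<Longrightarrow> i \<in> I \<Longrightarrow> f i \<in> carrier R"
  by (auto simp: free_module_def)

lemma free_module_ext:
  "f \<in> carrier (free_module R I) \<Longrightarrow> g \<in> carrier (free_module R I) \<Longrightarrow> (\<And>i. i \<in> I \<Longrightarrow> f i = g i) \<Longrightarrow> f = g"
  by (auto simp: free_module_def intro: PiE_ext)

lemma free_module_apply:
  "i \<in> I \<Longrightarrow> (f \<oplus>\<^bsub>free_module R I\<^esub> g) i = f i \<oplus>\<^bsub>R\<^esub> g i"
  "i \<in> I \<Longrightarrow> (a \<odot>\<^bsub>free_module R I\<^esub> f) i = a \<otimes>\<^bsub>R\<^esub> f i"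
  "i \<in> I \<Longrightarrow> \<zero>\<^bsub>free_module R I\<^esub> i = \<zero>\<^bsub>R\<^esub>"
  by (auto simp: free_module_def)

context cring
begin

lemma free_module_uminus_apply:
  assumes "f \<in> carrier (free_module R I)" "i \<in> I"
  shows "(\<ominus>\<^bsub>free_module R I\<^esub> f) i = \<ominus> f i"
proof -
  interpret F: module R "free_module R I" by (rule free_module_is_module)
  have "\<ominus>\<^bsub>free_module R I\<^esub> f = (\<ominus> \<one>) \<odot>\<^bsub>free_module R I\<^esub> f" using assms F.smult_l_minus[of \<one> f] by simp
  then show ?thesis using assms by (simp add: free_module_apply l_minus free_module_coord)
qed

lemma free_module_minus_apply:
  assumes "f \<in> carrier (free_module R I)" "g \<in> carrier (free_module R I)" "i \<in> I"
  shows "(f \<ominus>\<^bsub>free_module R I\<^esub> g) i = f i \<ominus> g i"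
  using assms by (simp add: a_minus_def free_module_apply free_module_uminus_apply)

lemma unit_vec_closed: "i \<in> I \<Longrightarrow> unit_vec R I i \<in> carrier (free_module R I)"
  by (auto simp: unit_vec_def free_module_def intro: finite_subset[of _ "{i}"])

text \<open>An induction principle for vectors. The hypothesis mentions the multiples \<open>f i \<cdot> e\<^sub>i\<close> and not
  the unit vectors themselves, so that it also applies to submodules such as \<open>\<mm> F\<close>.\<close>
lemma free_module_submodule_mem:
  assumes H: "submodule H R (free_module R I)" and f: "f \<in> carrier (free_module R I)"
    and unit: "\<And>i. i \<in> I \<Longrightarrow> f i \<odot>\<^bsub>free_module R I\<^esub> unit_vec R I i \<in> H"
  shows "f \<in> H"
proof -
  let ?F = "free_module R I"
  interpret F: module R ?F by (rule free_module_is_module)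
  have part: "(\<lambda>i\<in>I. if i \<in> A then f i else \<zero>) \<in> H" if "finite A" "A \<subseteq> I" for A
    using that
  proof (induction A rule: finite_induct)
    case empty
    have "(\<lambda>i\<in>I. if i \<in> {} then f i else \<zero>) = \<zero>\<^bsub>?F\<^esub>" by (auto simp: free_module_def)
    then show ?case using submodule_zero_mem[OF H] by simp
  next
    case (insert k A)
    have "(\<lambda>i\<in>I. if i \<in> insert k A then f i else \<zero>)
        = (\<lambda>i\<in>I. if i \<in> A then f i else \<zero>) \<oplus>\<^bsub>?F\<^esub> f k \<odot>\<^bsub>?F\<^esub> unit_vec R I k"
      using insert.hyps insert.prems free_module_coord[OF f]
      by (auto simp: free_module_def unit_vec_def fun_eq_iff)
    moreover have "(\<lambda>i\<in>I. if i \<in> A then f i else \<zero>) \<in> H" using insert by blast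
    moreover have "f k \<odot>\<^bsub>?F\<^esub> unit_vec R I k \<in> H" using unit insert.prems by blast
    ultimately show ?case using F.submoduleE(5)[OF H] by (simp only:)
  qed
  have "finite {i \<in> I. f i \<noteq> \<zero>}" using f by (auto simp: free_module_def)
  then have "(\<lambda>i\<in>I. if i \<in> {i \<in> I. f i \<noteq> \<zero>} then f i else \<zero>) \<in> H" by (rule part) simp
  moreover have "(\<lambda>i\<in>I. if i \<in> {i \<in> I. f i \<noteq> \<zero>} then f i else \<zero>) = f"
    using f by (auto simp: free_module_def fun_eq_iff)
  ultimately show ?thesis by simp
qed

lemma free_module_maps_eqI:
  assumes M: "module R M" and h: "h \<in> module_maps R (free_module R I) M" "h' \<in> module_maps R (free_module R I) M"
    and eq: "\<And>i. i \<in> I \<Longrightarrow> h (unit_vec R I i) = h' (unit_vec R I i)"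
    and f: "f \<in> carrier (free_module R I)"
  shows "h f = h' f"
proof -
  let ?F = "free_module R I"
  interpret M: module R M by fact
  have F: "module R ?F" by (rule free_module_is_module)
  have "f \<in> {f \<in> carrier ?F. h f \<ominus>\<^bsub>M\<^esub> h' f = \<zero>\<^bsub>M\<^esub>}"
  proof (rule free_module_submodule_mem[OF _ f])
    show "submodule {f \<in> carrier ?F. h f \<ominus>\<^bsub>M\<^esub> h' f = \<zero>\<^bsub>M\<^esub>} R ?F"
      by (rule kernel_submodule[OF F M module_maps_diff[OF F M h]])
    fix i assume i: "i \<in> I"
    note u = unit_vec_closed[OF i]
    have "h (f i \<odot>\<^bsub>?F\<^esub> unit_vec R I i) = h' (f i \<odot>\<^bsub>?F\<^esub> unit_vec R I i)"
      using eq[OF i] module_maps_smult[OF h(1) free_module_coord[OF f i] u]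
        module_maps_smult[OF h(2) free_module_coord[OF f i] u] by simp
    moreover have c: "f i \<odot>\<^bsub>?F\<^esub> unit_vec R I i \<in> carrier ?F"
      using F u free_module_coord[OF f i] by (simp add: module.smult_closed)
    ultimately show "f i \<odot>\<^bsub>?F\<^esub> unit_vec R I i \<in> {f \<in> carrier ?F. h f \<ominus>\<^bsub>M\<^esub> h' f = \<zero>\<^bsub>M\<^esub>}"
      using module_maps_closed[OF h(2) c] by (simp add: M.M.diff_eq_zero_iff)
  qed
  then show ?thesis using module_maps_closed[OF h(1) f] module_maps_closed[OF h(2) f]
    by (simp add: M.M.diff_eq_zero_iff)
qed

text \<open>The index set may be infinite, since the modules of a projective resolution are summands of free
  modules of arbitrary rank.\<close>
lemma free_module_map_exists:
  fixes I :: "'i set"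
  assumes M: "module R M" and g: "\<And>i. i \<in> I \<Longrightarrow> g i \<in> carrier M"
  shows "\<exists>h\<in>module_maps R (free_module R I) M. \<forall>i\<in>I. h (unit_vec R I i) = g i"
proof -
  let ?F = "free_module R I"
  interpret M: module R M by fact
  define supp where "supp f = {i \<in> I. f i \<noteq> \<zero>}" for f :: "'i \<Rightarrow> 'a"
  define h where "h f = finsum M (\<lambda>i. f i \<odot>\<^bsub>M\<^esub> g i) (supp f)" for f :: "'i \<Rightarrow> 'a"
  have fin: "finite (supp f)" "supp f \<subseteq> I" if "f \<in> carrier ?F" for f :: "'i \<Rightarrow> 'a"
    using that by (auto simp: free_module_def supp_def)
  have h_eq: "h f = finsum M (\<lambda>i. f i \<odot>\<^bsub>M\<^esub> g i) A"
    if f: "f \<in> carrier ?F" and A: "finite A" "supp f \<subseteq> A" "A \<subseteq> I" for f A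
    unfolding h_def
  proof (rule M.M.add.finprod_mono_neutral_cong_left)
    show "f i \<odot>\<^bsub>M\<^esub> g i = \<zero>\<^bsub>M\<^esub>" if "i \<in> A - supp f" for i
      using that A g by (auto simp: supp_def)
    show "(\<lambda>i. f i \<odot>\<^bsub>M\<^esub> g i) \<in> A \<rightarrow> carrier M"
      using A g free_module_coord[OF f] by auto
  qed (use A in auto)
  have c: "(\<lambda>i. f i \<odot>\<^bsub>M\<^esub> g i) \<in> A \<rightarrow> carrier M" if "f \<in> carrier ?F" "A \<subseteq> I" for f A
    using that g free_module_coord[of f R I] by blast
  interpret F: module R ?F by (rule free_module_is_module)
  have "h \<in> module_maps R ?F M"
  proof (rule module_mapsI)
    fix x assume x: "x \<in> carrier ?F"
    show "h x \<in> carrier M" unfolding h_def by (rule M.M.finsum_closed[OF c[OF x fin(2)[OF x]]])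
    {
      fix y assume y: "y \<in> carrier ?F"
      let ?A = "supp x \<union> supp y"
      have A: "finite ?A" "?A \<subseteq> I" using fin x y by auto
      have "supp (x \<oplus>\<^bsub>?F\<^esub> y) \<subseteq> ?A" by (auto simp: supp_def free_module_apply)
      then have "h (x \<oplus>\<^bsub>?F\<^esub> y) = finsum M (\<lambda>i. (x \<oplus>\<^bsub>?F\<^esub> y) i \<odot>\<^bsub>M\<^esub> g i) ?A"
        using A x y by (intro h_eq) auto
      also have "\<dots> = finsum M (\<lambda>i. x i \<odot>\<^bsub>M\<^esub> g i \<oplus>\<^bsub>M\<^esub> y i \<odot>\<^bsub>M\<^esub> g i) ?A"
      proof (rule M.M.finsum_cong')
        show "(\<lambda>i. x i \<odot>\<^bsub>M\<^esub> g i \<oplus>\<^bsub>M\<^esub> y i \<odot>\<^bsub>M\<^esub> g i) \<in> ?A \<rightarrow> carrier M"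
          using c[OF x A(2)] c[OF y A(2)] by (auto simp: Pi_def)
        fix i assume "i \<in> ?A"
        then have "i \<in> I" using A by blast
        then show "(x \<oplus>\<^bsub>?F\<^esub> y) i \<odot>\<^bsub>M\<^esub> g i = x i \<odot>\<^bsub>M\<^esub> g i \<oplus>\<^bsub>M\<^esub> y i \<odot>\<^bsub>M\<^esub> g i"
          using g x y by (simp add: free_module_apply free_module_coord M.smult_l_distr)
      qed simp
      also have "\<dots> = finsum M (\<lambda>i. x i \<odot>\<^bsub>M\<^esub> g i) ?A \<oplus>\<^bsub>M\<^esub> finsum M (\<lambda>i. y i \<odot>\<^bsub>M\<^esub> g i) ?A"
        by (rule M.M.finsum_addf[OF c[OF x A(2)] c[OF y A(2)]])
      also have "\<dots> = h x \<oplus>\<^bsub>M\<^esub> h y" using h_eq[OF x A(1) _ A(2)] h_eq[OF y A(1) _ A(2)] by simp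
      finally show "h (x \<oplus>\<^bsub>?F\<^esub> y) = h x \<oplus>\<^bsub>M\<^esub> h y" .
    }
    fix a assume a: "a \<in> carrier R"
    have "supp (a \<odot>\<^bsub>?F\<^esub> x) \<subseteq> supp x" using a by (auto simp: supp_def free_module_apply)
    then have "h (a \<odot>\<^bsub>?F\<^esub> x) = finsum M (\<lambda>i. (a \<odot>\<^bsub>?F\<^esub> x) i \<odot>\<^bsub>M\<^esub> g i) (supp x)"
      using fin[OF x] a x by (intro h_eq) auto
    also have "\<dots> = finsum M (\<lambda>i. a \<odot>\<^bsub>M\<^esub> (x i \<odot>\<^bsub>M\<^esub> g i)) (supp x)"
    proof (rule M.M.finsum_cong')
      show "(\<lambda>i. a \<odot>\<^bsub>M\<^esub> (x i \<odot>\<^bsub>M\<^esub> g i)) \<in> supp x \<rightarrow> carrier M"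
        using c[OF x fin(2)[OF x]] a by (auto simp: Pi_def)
      fix i assume "i \<in> supp x"
      then have "i \<in> I" by (simp add: supp_def)
      then show "(a \<odot>\<^bsub>?F\<^esub> x) i \<odot>\<^bsub>M\<^esub> g i = a \<odot>\<^bsub>M\<^esub> (x i \<odot>\<^bsub>M\<^esub> g i)"
        using g x a by (simp add: free_module_apply free_module_coord M.smult_assoc1)
    qed simp
    also have "\<dots> = a \<odot>\<^bsub>M\<^esub> h x"
      unfolding h_def by (rule M.finsum_smult_ldistr[symmetric, OF fin(1)[OF x] a c[OF x fin(2)[OF x]]])
    finally show "h (a \<odot>\<^bsub>?F\<^esub> x) = a \<odot>\<^bsub>M\<^esub> h x" .
  qed
  moreover have "h (unit_vec R I i) = g i" if i: "i \<in> I" for i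
  proof -
    have "h (unit_vec R I i) = finsum M (\<lambda>j. unit_vec R I i j \<odot>\<^bsub>M\<^esub> g j) {i}"
      using i by (intro h_eq unit_vec_closed) (auto simp: supp_def unit_vec_def)
    then show ?thesis using i g by (simp add: unit_vec_def)
  qed
  ultimately show ?thesis by blast
qed

lemma free_module_lift:
  assumes N: "module R N" and L: "module R L"
    and p: "p \<in> module_maps R N L" and q: "q \<in> module_maps R (free_module R I) L"
    and sub: "\<And>i. i \<in> I \<Longrightarrow> q (unit_vec R I i) \<in> p ` carrier N"
  shows "\<exists>t\<in>module_maps R (free_module R I) N. \<forall>z\<in>carrier (free_module R I). p (t z) = q z"
proof -
  define g where "g i = inv_into (carrier N) p (q (unit_vec R I i))" for i
  have g: "g i \<in> carrier N" "p (g i) = q (unit_vec R I i)" if "i \<in> I" for i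
    unfolding g_def by (rule inv_into_into[OF sub[OF that]], rule f_inv_into_f[OF sub[OF that]])
  obtain t where t: "t \<in> module_maps R (free_module R I) N" "\<forall>i\<in>I. t (unit_vec R I i) = g i"
    by (rule bexE[OF free_module_map_exists[of N I g, OF N g(1)]])
  have "p (t z) = q z" if "z \<in> carrier (free_module R I)" for z
    by (rule free_module_maps_eqI[OF L module_maps_comp[OF t(1) p] q _ that]) (use t g in simp)
  then show ?thesis using t(1) by (intro bexI ballI)
qed

end

section \<open>Splittings near a maximal ideal\<close>

context cring
begin

lemma ideal_vectors_submodule:
  assumes "ideal \<mm> R"
  shows "submodule {g \<in> carrier (free_module R K). \<forall>k\<in>K. g k \<in> \<mm>} R (free_module R K)"
proof -
  interpret m: ideal \<mm> R by fact
  interpret F: module R "free_module R K" by (rule free_module_is_module)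
  show ?thesis
    by (rule F.submoduleI)
      (auto simp: free_module_apply free_module_uminus_apply m.a_closed m.a_inv_closed m.I_l_closed)
qed

text \<open>A linear map sends \<open>\<mm> F\<close> into \<open>\<mm> E\<close>; the vectors with all coordinates in \<open>\<mm>\<close> serve as \<open>\<mm> F\<close>.\<close>
lemma module_map_ideal_vectors:
  assumes m: "ideal \<mm> R" and G: "G \<in> module_maps R (free_module R I) (free_module R K)"
    and f: "f \<in> carrier (free_module R I)" "\<And>i. i \<in> I \<Longrightarrow> f i \<in> \<mm>" and k: "k \<in> K"
  shows "G f k \<in> \<mm>"
proof -
  interpret m: ideal \<mm> R by fact
  let ?F = "free_module R I"
  have F: "module R ?F" by (rule free_module_is_module)
  let ?H = "{f \<in> carrier ?F. G f \<in> {g \<in> carrier (free_module R K). \<forall>k\<in>K. g k \<in> \<mm>}}"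
  have "f \<in> ?H"
  proof (rule free_module_submodule_mem[OF _ f(1)])
    show "submodule ?H R ?F"
      by (rule vimage_submodule[OF F free_module_is_module G ideal_vectors_submodule[OF m]])
    fix i assume i: "i \<in> I"
    note u = unit_vec_closed[OF i] and fi = free_module_coord[OF f(1) i]
    have c: "f i \<odot>\<^bsub>?F\<^esub> unit_vec R I i \<in> carrier ?F" using F u fi by (simp add: module.smult_closed)
    moreover have "G (f i \<odot>\<^bsub>?F\<^esub> unit_vec R I i) k \<in> \<mm>" if "k \<in> K" for k
      using that m.I_r_closed[OF f(2)[OF i] free_module_coord[OF module_maps_closed[OF G u] that]]
      by (simp add: module_maps_smult[OF G fi u] free_module_apply)
    ultimately show "f i \<odot>\<^bsub>?F\<^esub> unit_vec R I i \<in> ?H" using module_maps_closed[OF G c] by blast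
  qed
  then show ?thesis using k by blast
qed

lemma rank_one_map:
  assumes "module R N" "module R M" "L \<in> module_maps R N (free_module R J)" "k \<in> J" "w \<in> carrier M"
  shows "(\<lambda>v. L v k \<odot>\<^bsub>M\<^esub> w) \<in> module_maps R N M"
proof -
  interpret M: module R M by fact
  have "L v k \<in> carrier R" if "v \<in> carrier N" for v
    using free_module_coord[OF module_maps_closed[OF assms(3) that] assms(4)] .
  then show ?thesis
    by (intro module_mapsI)
      (use assms(4,5) in \<open>simp_all add: module_maps_add[OF assms(3)] module_maps_smult[OF assms(3)]
        free_module_apply M.smult_l_distr M.smult_assoc1\<close>)
qed

text \<open>The hypothesis says that \<open>K / \<mm> K \<rightarrow> E / \<mm> E\<close> is injective, where \<open>K\<close> is the image of \<open>B\<close>. A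
  basis of \<open>K / \<mm> K\<close> then extends to one of \<open>E / \<mm> E\<close>, and by Nakayama's lemma a lift of that basis generates
  \<open>K\<close> near \<open>\<mm>\<close>, which gives a retraction. The proof carries this out by elimination: \<open>X\<close> is a minimal set of
  columns of \<open>B\<close> that generates \<open>K\<close> near \<open>\<mm>\<close>, and \<open>S\<close> a maximal subset of \<open>X\<close> on which a
  retraction exists near \<open>\<mm>\<close>. For a column \<open>b\<^sub>j\<close> in \<open>X\<close> but not in \<open>S\<close>, let \<open>B w\<close> be the error
  \<open>r b\<^sub>j - B T b\<^sub>j\<close>. If it has a coordinate outside \<open>\<mm>\<close>, it serves as a pivot and \<open>S\<close>
  can be enlarged; otherwise the error lies in \<open>\<mm> K\<close>, and the Nakayama argument shows that the column
  \<open>b\<^sub>j\<close> is superfluous in \<open>X\<close>.\<close>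
lemma splitting_near_maximal_ideal:
  assumes fin: "finite I" "finite J" and m: "maximalideal \<mm> R"
    and B: "B \<in> module_maps R (free_module R I) (free_module R J)"
    and inj: "\<And>f. f \<in> carrier (free_module R I) \<Longrightarrow> \<forall>j\<in>J. B f j \<in> \<mm> \<Longrightarrow>
      \<exists>f'\<in>carrier (free_module R I). (\<forall>i\<in>I. f' i \<in> \<mm>) \<and> B f = B f'"
  shows "\<exists>r\<in>carrier R - \<mm>. \<exists>\<tau>\<in>module_maps R (free_module R J) (free_module R I).
    \<forall>f\<in>carrier (free_module R I). B (\<tau> (B f)) = r \<odot>\<^bsub>free_module R J\<^esub> B f"
proof -
  let ?F = "free_module R I" and ?E = "free_module R J"
  let ?e = "unit_vec R I"
  interpret m: maximalideal \<mm> R by fact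
  interpret mp: primeideal \<mm> R by (rule maximalideal_prime[OF m])
  interpret F: module R ?F by (rule free_module_is_module)
  interpret E: module R ?E by (rule free_module_is_module)
  have Fm: "module R ?F" and Em: "module R ?E" by (rule free_module_is_module)+
  have mult_notin: "a \<otimes> b \<in> carrier R - \<mm>" if "a \<in> carrier R - \<mm>" "b \<in> carrier R - \<mm>" for a b
    using that mp.I_prime[of a b] by auto
  have one_notin: "\<one> \<in> carrier R - \<mm>" using m.one_imp_carrier m.I_notcarr by auto
  \<comment> \<open>\<open>G\<close> rewrites every vector, up to the factor \<open>u\<close>, as a combination of the columns in \<open>X\<close>; it is
    required to be linear so that it preserves \<open>\<mm> F\<close>.\<close>
  define Gen where "Gen X \<longleftrightarrow> X \<subseteq> I \<and> (\<exists>u\<in>carrier R - \<mm>. \<exists>G\<in>module_maps R ?F ?F.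
      \<forall>f\<in>carrier ?F. (\<forall>i\<in>I - X. G f i = \<zero>) \<and> B (G f) = u \<odot>\<^bsub>?E\<^esub> B f)" for X
  have "Gen I"
    unfolding Gen_def
    by (intro conjI bexI[OF _ one_notin] bexI[OF _ module_maps_id])
      (use module_maps_closed[OF B] in auto)
  then obtain X where X: "Gen X" and Xmin: "\<And>Y. Gen Y \<Longrightarrow> card X \<le> card Y"
    using ex_has_least_nat[of Gen I card] by blast
  then obtain u G where XI: "X \<subseteq> I" and u: "u \<in> carrier R - \<mm>" and G: "G \<in> module_maps R ?F ?F"
    and GX: "\<And>f i. f \<in> carrier ?F \<Longrightarrow> i \<in> I - X \<Longrightarrow> G f i = \<zero>"
    and BG: "\<And>f. f \<in> carrier ?F \<Longrightarrow> B (G f) = u \<odot>\<^bsub>?E\<^esub> B f"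
    unfolding Gen_def by blast
  have finX: "finite X" using XI fin(1) by (rule finite_subset)
  \<comment> \<open>The image of \<open>T\<close> is supported in \<open>S\<close>, so that \<open>T\<close> never uses the column that is treated next.\<close>
  define Ind where "Ind S \<longleftrightarrow> S \<subseteq> X \<and> (\<exists>r\<in>carrier R - \<mm>. \<exists>T\<in>module_maps R ?E ?F.
      (\<forall>v\<in>carrier ?E. \<forall>i\<in>I - S. T v i = \<zero>) \<and>
      (\<forall>i\<in>S. B (T (B (?e i))) = r \<odot>\<^bsub>?E\<^esub> B (?e i)))" for S
  have zmap: "(\<lambda>v. \<zero>\<^bsub>?F\<^esub>) \<in> module_maps R ?E ?F" by (rule module_mapsI) auto
  have "Ind {}"
    unfolding Ind_def
    by (intro conjI bexI[OF _ one_notin] bexI[OF _ zmap]) (auto simp: free_module_apply)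
  moreover have "card S \<le> card X" if "Ind S" for S
    using that finX by (auto simp: Ind_def card_mono)
  ultimately obtain S where S: "Ind S" and Smax: "\<And>Y. Ind Y \<Longrightarrow> card Y \<le> card S"
    using ex_has_greatest_nat[of Ind "{}" card "Suc (card X)"] by (auto simp: le_imp_less_Suc)
  then obtain r T where SX: "S \<subseteq> X" and r: "r \<in> carrier R - \<mm>" and T: "T \<in> module_maps R ?E ?F"
    and TS: "\<And>v i. v \<in> carrier ?E \<Longrightarrow> i \<in> I - S \<Longrightarrow> T v i = \<zero>"
    and BT: "\<And>i. i \<in> S \<Longrightarrow> B (T (B (?e i))) = r \<odot>\<^bsub>?E\<^esub> B (?e i)"
    unfolding Ind_def by blast
  have finS: "finite S" using SX finX by (rule finite_subset)
  have rc: "r \<in> carrier R" and uc: "u \<in> carrier R" using r u by auto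
  note Bc = module_maps_closed[OF B] and Gc = module_maps_closed[OF G] and Tc = module_maps_closed[OF T]
  note Bsimps = module_maps_add[OF B] module_maps_smult[OF B] module_maps_minus[OF Fm Em B]
  have coordF: "f i \<in> carrier R" if "f \<in> carrier ?F" "i \<in> I" for f i using free_module_coord that .
  have coordE: "f i \<in> carrier R" if "f \<in> carrier ?E" "i \<in> J" for f i using free_module_coord that .
  have "S = X"
  proof (rule ccontr)
    assume "S \<noteq> X"
    then obtain j where j: "j \<in> X" "j \<notin> S" using SX by blast
    have jI: "j \<in> I" using j XI by blast
    have ec: "?e j \<in> carrier ?F" using unit_vec_closed[OF jI] .
    define bj where "bj = B (?e j)"
    have bjc: "bj \<in> carrier ?E" unfolding bj_def using ec Bc by blast
    define w where "w = r \<odot>\<^bsub>?F\<^esub> ?e j \<ominus>\<^bsub>?F\<^esub> T bj"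
    have Tbj: "T bj \<in> carrier ?F" using Tc bjc by blast
    have wc: "w \<in> carrier ?F" unfolding w_def using rc ec Tbj by simp
    have BTc: "B (T bj) \<in> carrier ?E" using Bc Tbj by blast
    have Bw: "B w = r \<odot>\<^bsub>?E\<^esub> bj \<ominus>\<^bsub>?E\<^esub> B (T bj)"
      unfolding w_def bj_def using rc ec Tbj[unfolded bj_def] by (simp add: Bsimps)
    have wi: "w i = \<zero>" if "i \<in> I" "i \<notin> S" "i \<noteq> j" for i
      using that rc ec Tbj TS[OF bjc] unfolding w_def
      by (simp add: free_module_minus_apply free_module_apply unit_vec_def)
    show False
    proof (cases "\<forall>k\<in>J. B w k \<in> \<mm>")
      case False
      then obtain k where k: "k \<in> J" "B w k \<notin> \<mm>" by blast
      define c where "c = B w k"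
      have c: "c \<in> carrier R - \<mm>" using k coordE[OF Bc[OF wc]] by (simp add: c_def)
      have cc: "c \<in> carrier R" using c by simp
      define L where "L v = r \<odot>\<^bsub>?E\<^esub> v \<ominus>\<^bsub>?E\<^esub> B (T v)" for v
      have L: "L \<in> module_maps R ?E ?E"
        unfolding L_def
        by (intro module_maps_diff module_maps_scale module_maps_id module_maps_comp[OF T B] Em rc)
      \<comment> \<open>The \<open>k\<close>-th coordinate of the error \<open>L\<close> vanishes on the columns in \<open>S\<close> and is \<open>c\<close> on the new column, so adding
        the multiple of \<open>w\<close> repairs \<open>T\<close> there without disturbing \<open>S\<close>.\<close>
      define T' where "T' v = c \<odot>\<^bsub>?F\<^esub> T v \<oplus>\<^bsub>?F\<^esub> L v k \<odot>\<^bsub>?F\<^esub> w" for v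
      have T': "T' \<in> module_maps R ?E ?F"
        unfolding T'_def
        by (intro module_maps_plus module_maps_scale rank_one_map[OF Em Fm L k(1) wc] T Em Fm cc)
      have Lc: "L v k \<in> carrier R" if "v \<in> carrier ?E" for v
        using coordE[OF module_maps_closed[OF L that] k(1)] .
      have BT': "B (T' v) = c \<odot>\<^bsub>?E\<^esub> B (T v) \<oplus>\<^bsub>?E\<^esub> L v k \<odot>\<^bsub>?E\<^esub> B w" if "v \<in> carrier ?E" for v
        unfolding T'_def using that cc Tc Lc wc by (simp add: Bsimps)
      have "Ind (insert j S)"
        unfolding Ind_def
      proof (intro conjI bexI[OF _ mult_notin[OF c r]] bexI[OF _ T'] ballI)
        show "insert j S \<subseteq> X" using j SX by blast
        show "T' v i = \<zero>" if "v \<in> carrier ?E" "i \<in> I - insert j S" for v i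
          using that TS[of v i] wi[of i] cc Lc unfolding T'_def by (simp add: free_module_apply)
        fix i assume i: "i \<in> insert j S"
        then have iI: "i \<in> I" using jI SX XI by blast
        have bi: "B (?e i) \<in> carrier ?E" using Bc unit_vec_closed[OF iI] by blast
        show "B (T' (B (?e i))) = c \<otimes> r \<odot>\<^bsub>?E\<^esub> B (?e i)"
        proof (cases "i = j")
          case True
          have "L bj = B w" unfolding L_def Bw ..
          then have "B (T' bj) = c \<odot>\<^bsub>?E\<^esub> B (T bj) \<oplus>\<^bsub>?E\<^esub> c \<odot>\<^bsub>?E\<^esub> B w"
            using BT'[OF bjc] by (simp add: c_def)
          also have "\<dots> = c \<otimes> r \<odot>\<^bsub>?E\<^esub> bj"
          proof (rule free_module_ext[of _ R J])
            fix l assume l: "l \<in> J"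
            have "c \<otimes> B (T bj) l \<oplus> c \<otimes> (r \<otimes> bj l \<ominus> B (T bj) l) = c \<otimes> r \<otimes> bj l"
              using cc rc coordE[OF BTc l] coordE[OF bjc l] by algebra
            then show "(c \<odot>\<^bsub>?E\<^esub> B (T bj) \<oplus>\<^bsub>?E\<^esub> c \<odot>\<^bsub>?E\<^esub> B w) l = (c \<otimes> r \<odot>\<^bsub>?E\<^esub> bj) l"
              unfolding Bw using l rc bjc BTc by (simp add: free_module_apply free_module_minus_apply)
          qed (use cc rc bjc BTc Bc[OF wc] in simp_all)
          finally show ?thesis using True by (simp add: bj_def)
        next
          case False
          then have iS: "i \<in> S" using i by blast
          have "L (B (?e i)) = \<zero>\<^bsub>?E\<^esub>" unfolding L_def BT[OF iS] using bi rc by (simp add: E.M.diff_eq_zero_iff)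
          then have "L (B (?e i)) k = \<zero>" using k by (simp add: free_module_apply)
          then show ?thesis using BT'[OF bi] BT[OF iS] Bc[OF wc] bi cc rc by (simp add: E.smult_assoc1)
        qed
      qed
      then have "card (insert j S) \<le> card S" by (rule Smax)
      then show False using finS j by simp
    next
      case True
      obtain f' where f': "f' \<in> carrier ?F" "\<And>i. i \<in> I \<Longrightarrow> f' i \<in> \<mm>" "B w = B f'"
        using inj[OF wc True] by blast
      have Gf': "G f' \<in> carrier ?F" using Gc f' by blast
      define z where "z = G f' j"
      have z: "z \<in> \<mm>" unfolding z_def by (rule module_map_ideal_vectors[OF m.is_ideal G f'(1,2) jI])
      have zc: "z \<in> carrier R" using z m.Icarr by blast
      \<comment> \<open>Multiplying the error by \<open>u\<close> gives \<open>u r b\<^sub>j\<close> as a combination of \<open>X\<close> in which \<open>b\<^sub>j\<close> itself has the coefficient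
        \<open>z \<in> \<mm>\<close>; moving that term to the left leaves the factor \<open>d\<close> outside \<open>\<mm>\<close>.\<close>
      define d where "d = u \<otimes> r \<ominus> z"
      have d: "d \<in> carrier R - \<mm>"
      proof -
        have "d \<notin> \<mm>"
        proof
          assume "d \<in> \<mm>"
          then have "d \<oplus> z \<in> \<mm>" using z by (simp add: m.a_closed)
          moreover have "d \<oplus> z = u \<otimes> r" unfolding d_def using uc rc zc by algebra
          ultimately show False using mult_notin[OF u r] by simp
        qed
        then show ?thesis using uc rc zc by (simp add: d_def)
      qed
      have dc: "d \<in> carrier R" using d by simp
      define g where "g = (u \<odot>\<^bsub>?F\<^esub> T bj \<oplus>\<^bsub>?F\<^esub> G f') \<ominus>\<^bsub>?F\<^esub> z \<odot>\<^bsub>?F\<^esub> ?e j"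
      have gc: "g \<in> carrier ?F" unfolding g_def using uc Tbj Gf' zc ec by simp
      have Bg: "B g = d \<odot>\<^bsub>?E\<^esub> bj"
      proof -
        have "B g = (u \<odot>\<^bsub>?E\<^esub> B (T bj) \<oplus>\<^bsub>?E\<^esub> u \<odot>\<^bsub>?E\<^esub> B w) \<ominus>\<^bsub>?E\<^esub> z \<odot>\<^bsub>?E\<^esub> bj"
          unfolding g_def bj_def using uc Tbj[unfolded bj_def] Gf' zc ec f' by (simp add: Bsimps BG)
        also have "\<dots> = d \<odot>\<^bsub>?E\<^esub> bj"
        proof (rule free_module_ext[of _ R J])
          fix l assume l: "l \<in> J"
          have "u \<otimes> B (T bj) l \<oplus> u \<otimes> (r \<otimes> bj l \<ominus> B (T bj) l) \<ominus> z \<otimes> bj l = (u \<otimes> r \<ominus> z) \<otimes> bj l"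
            using uc rc zc coordE[OF BTc l] coordE[OF bjc l] by algebra
          then show "(u \<odot>\<^bsub>?E\<^esub> B (T bj) \<oplus>\<^bsub>?E\<^esub> u \<odot>\<^bsub>?E\<^esub> B w \<ominus>\<^bsub>?E\<^esub> z \<odot>\<^bsub>?E\<^esub> bj) l = (d \<odot>\<^bsub>?E\<^esub> bj) l"
            unfolding Bw d_def using l uc rc zc bjc BTc by (simp add: free_module_apply free_module_minus_apply)
        qed (use uc rc zc dc bjc BTc Bc[OF wc] in simp_all)
        finally show ?thesis .
      qed
      have gi: "g i = \<zero>" if i: "i \<in> I" "i \<notin> X - {j}" for i
      proof (cases "i = j")
        case True
        have "g j = u \<otimes> T bj j \<oplus> z \<ominus> z \<otimes> \<one>"
          unfolding g_def using uc Tbj Gf' zc ec jI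
          by (simp add: free_module_apply free_module_minus_apply z_def unit_vec_def)
        then show ?thesis using True TS[OF bjc] jI j uc zc by (simp add: minus_eq r_neg)
      next
        case False
        then have "i \<in> I - X" "i \<in> I - S" using i SX by auto
        then show ?thesis
          unfolding g_def using False uc Tbj Gf' zc ec GX[OF f'(1)] TS[OF bjc]
          by (simp add: free_module_apply free_module_minus_apply unit_vec_def minus_eq)
      qed
      \<comment> \<open>Replaces the column \<open>b\<^sub>j\<close> in \<open>G f\<close> by the combination \<open>g\<close> of the other columns.\<close>
      define G' where "G' f = d \<odot>\<^bsub>?F\<^esub> (G f \<ominus>\<^bsub>?F\<^esub> G f j \<odot>\<^bsub>?F\<^esub> ?e j) \<oplus>\<^bsub>?F\<^esub> G f j \<odot>\<^bsub>?F\<^esub> g" for f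
      have G': "G' \<in> module_maps R ?F ?F"
        unfolding G'_def
        by (intro module_maps_plus module_maps_scale module_maps_diff G dc Fm
            rank_one_map[OF Fm Fm G jI ec] rank_one_map[OF Fm Fm G jI gc])
      have "Gen (X - {j})"
        unfolding Gen_def
      proof (intro conjI bexI[OF _ mult_notin[OF d u]] bexI[OF _ G'] ballI)
        show "X - {j} \<subseteq> I" using XI by blast
        fix f assume f: "f \<in> carrier ?F"
        have Gf: "G f \<in> carrier ?F" and Gfj: "G f j \<in> carrier R" using Gc f coordF jI by auto
        show "G' f i = \<zero>" if i: "i \<in> I - (X - {j})" for i
        proof (cases "i = j")
          case True
          then show ?thesis
            unfolding G'_def using i Gf Gfj gi[of i] dc ec
            by (simp add: free_module_apply free_module_minus_apply unit_vec_def minus_eq r_neg)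
        next
          case False
          then show ?thesis
            unfolding G'_def using i Gf Gfj gi[of i] dc ec GX[OF f, of i]
            by (simp add: free_module_apply free_module_minus_apply unit_vec_def minus_eq)
        qed
        have Bf: "B f \<in> carrier ?E" using Bc f by blast
        have "B (G' f) = d \<odot>\<^bsub>?E\<^esub> (u \<odot>\<^bsub>?E\<^esub> B f \<ominus>\<^bsub>?E\<^esub> G f j \<odot>\<^bsub>?E\<^esub> bj) \<oplus>\<^bsub>?E\<^esub> G f j \<odot>\<^bsub>?E\<^esub> (d \<odot>\<^bsub>?E\<^esub> bj)"
          unfolding G'_def using Gf Gfj dc ec gc f by (simp add: Bsimps BG Bg bj_def)
        also have "\<dots> = d \<otimes> u \<odot>\<^bsub>?E\<^esub> B f"
        proof (rule free_module_ext[of _ R J])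
          fix l assume l: "l \<in> J"
          have "d \<otimes> (u \<otimes> B f l \<ominus> G f j \<otimes> bj l) \<oplus> G f j \<otimes> (d \<otimes> bj l) = d \<otimes> u \<otimes> B f l"
            using uc dc Gfj coordE[OF Bf l] coordE[OF bjc l] by algebra
          then show "(d \<odot>\<^bsub>?E\<^esub> (u \<odot>\<^bsub>?E\<^esub> B f \<ominus>\<^bsub>?E\<^esub> G f j \<odot>\<^bsub>?E\<^esub> bj) \<oplus>\<^bsub>?E\<^esub> G f j \<odot>\<^bsub>?E\<^esub> (d \<odot>\<^bsub>?E\<^esub> bj)) l
              = (d \<otimes> u \<odot>\<^bsub>?E\<^esub> B f) l"
            using l uc dc Gfj Bf bjc by (simp add: free_module_apply free_module_minus_apply)
        qed (use uc dc Gfj Bf bjc in simp_all)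
        finally show "B (G' f) = d \<otimes> u \<odot>\<^bsub>?E\<^esub> B f" .
      qed
      then have "card X \<le> card (X - {j})" by (rule Xmin)
      then show False using card_Diff1_less[OF finX j(1)] by simp
    qed
  qed
  have BTG: "B (T (B g)) = r \<odot>\<^bsub>?E\<^esub> B g" if g: "g \<in> carrier ?F" "\<And>i. i \<in> I - X \<Longrightarrow> g i = \<zero>" for g
  proof -
    define L where "L g = B (T (B g)) \<ominus>\<^bsub>?E\<^esub> r \<odot>\<^bsub>?E\<^esub> B g" for g
    have L: "L \<in> module_maps R ?F ?E"
      unfolding L_def
      by (intro module_maps_diff module_maps_scale module_maps_comp[OF module_maps_comp[OF B T] B] B Fm Em rc)
    have "g \<in> {g \<in> carrier ?F. L g = \<zero>\<^bsub>?E\<^esub>}"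
    proof (rule free_module_submodule_mem[OF kernel_submodule[OF Fm Em L] g(1)])
      fix i assume i: "i \<in> I"
      note e = unit_vec_closed[OF i] and gi = coordF[OF g(1) i]
      have "L (g i \<odot>\<^bsub>?F\<^esub> ?e i) = g i \<odot>\<^bsub>?E\<^esub> L (?e i)" by (rule module_maps_smult[OF L gi e])
      also have "\<dots> = \<zero>\<^bsub>?E\<^esub>"
      proof (cases "i \<in> X")
        case True
        then have "L (?e i) = \<zero>\<^bsub>?E\<^esub>"
          unfolding L_def using BT[of i] \<open>S = X\<close> Bc[OF e] rc by (simp add: E.M.diff_eq_zero_iff)
        then show ?thesis using gi by simp
      next
        case False
        then show ?thesis using g(2)[of i] i module_maps_closed[OF L e] by simp
      qed
      finally show "g i \<odot>\<^bsub>?F\<^esub> ?e i \<in> {g \<in> carrier ?F. L g = \<zero>\<^bsub>?E\<^esub>}" using gi e by simp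
    qed
    then show ?thesis
      using Bc[OF g(1)] Bc[OF Tc[OF Bc[OF g(1)]]] rc by (simp add: L_def E.M.diff_eq_zero_iff)
  qed
  show ?thesis
  proof (intro bexI[OF _ mult_notin[OF r u]] bexI[OF _ module_maps_scale[OF Em Fm T uc]] ballI)
    fix f assume f: "f \<in> carrier ?F"
    have "B (u \<odot>\<^bsub>?F\<^esub> T (B f)) = B (T (u \<odot>\<^bsub>?E\<^esub> B f))"
      using uc Bc[OF f] by (simp add: module_maps_smult[OF T])
    also have "\<dots> = B (T (B (G f)))" using BG[OF f] by simp
    also have "\<dots> = r \<odot>\<^bsub>?E\<^esub> (u \<odot>\<^bsub>?E\<^esub> B f)" using BTG[OF Gc[OF f] GX[OF f]] BG[OF f] by simp
    also have "\<dots> = r \<otimes> u \<odot>\<^bsub>?E\<^esub> B f" using rc uc Bc[OF f] by (simp add: E.smult_assoc1)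
    finally show "B (u \<odot>\<^bsub>?F\<^esub> T (B f)) = r \<otimes> u \<odot>\<^bsub>?E\<^esub> B f" .
  qed
qed

end

section \<open>Splittings and depth two\<close>

text \<open>The scalars \<open>r\<close> for which \<open>B \<tau> B = r B\<close> is solvable form an ideal; by hypothesis it lies in no
  maximal ideal.\<close>
lemma splitting_globalizes:
  fixes R (structure)
  assumes noeth: "noetherian_ring R" and cring: "cring R"
    and B: "B \<in> module_maps R (free_module R I) (free_module R J)"
    and loc: "\<And>\<mm>. maximalideal \<mm> R \<Longrightarrow>
      \<exists>r\<in>carrier R - \<mm>. \<exists>\<tau>\<in>module_maps R (free_module R J) (free_module R I).
        \<forall>f\<in>carrier (free_module R I). B (\<tau> (B f)) = r \<odot>\<^bsub>free_module R J\<^esub> B f"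
  shows "\<exists>\<tau>\<in>module_maps R (free_module R J) (free_module R I).
        \<forall>f\<in>carrier (free_module R I). B (\<tau> (B f)) = B f"
proof -
  let ?F = "free_module R I" and ?E = "free_module R J"
  interpret noetherian_ring R by fact
  interpret cring R by fact
  interpret F: module R ?F by (rule free_module_is_module)
  interpret E: module R ?E by (rule free_module_is_module)
  have Fm: "module R ?F" and Em: "module R ?E" by (rule free_module_is_module)+
  define Q where "Q r \<tau> \<longleftrightarrow> \<tau> \<in> module_maps R ?E ?F \<and> (\<forall>f\<in>carrier ?F. B (\<tau> (B f)) = r \<odot>\<^bsub>?E\<^esub> B f)" for r \<tau>
  define D where "D = {r \<in> carrier R. \<exists>\<tau>. Q r \<tau>}"
  have Q_add: "Q (r \<oplus> r') (\<lambda>v. \<tau> v \<oplus>\<^bsub>?F\<^esub> \<tau>' v)" if "Q r \<tau>" "Q r' \<tau>'" "r \<in> carrier R" "r' \<in> carrier R" for r r' \<tau> \<tau>'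
    using that unfolding Q_def
    by (auto simp: module_maps_plus[OF Em Fm] module_maps_closed[OF B] module_maps_add[OF B]
        module_maps_closed[of _ R ?E ?F] E.smult_l_distr)
  have Q_scale: "Q (a \<otimes> r) (\<lambda>v. a \<odot>\<^bsub>?F\<^esub> \<tau> v)" if "Q r \<tau>" "r \<in> carrier R" "a \<in> carrier R" for a r \<tau>
    using that unfolding Q_def
    by (auto simp: module_maps_scale[OF Em Fm] module_maps_closed[OF B] module_maps_smult[OF B]
        module_maps_closed[of _ R ?E ?F] E.smult_assoc1)
  have mult: "a \<otimes> r \<in> D" if "r \<in> D" "a \<in> carrier R" for a r
    using that Q_scale unfolding D_def by blast
  have "(\<lambda>v. \<zero>\<^bsub>?F\<^esub>) \<in> module_maps R ?E ?F" by (rule module_mapsI) auto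
  then have "Q \<zero> (\<lambda>v. \<zero>\<^bsub>?F\<^esub>)"
    unfolding Q_def using module_maps_closed[OF B] by (auto simp: module_maps_zero[OF Fm Em B])
  then have D0: "\<zero> \<in> D" unfolding D_def by blast
  have D: "ideal D R"
  proof (rule idealI)
    show "subgroup D (add_monoid R)"
    proof (rule add.subgroupI)
      show "D \<subseteq> carrier R" by (auto simp: D_def)
      show "D \<noteq> {}" using D0 by blast
      show "\<ominus> a \<in> D" if "a \<in> D" for a
        using mult[OF that, of "\<ominus> \<one>"] that by (simp add: D_def l_minus)
      show "a \<oplus> b \<in> D" if "a \<in> D" "b \<in> D" for a b
        using that Q_add unfolding D_def by blast
    qed
    show "x \<otimes> a \<in> D" "a \<otimes> x \<in> D" if "a \<in> D" "x \<in> carrier R" for a x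
      using mult[OF that] that by (auto simp: D_def m_comm)
  qed (rule ring_axioms)
  have "D = carrier R"
  proof (rule ccontr)
    assume "D \<noteq> carrier R"
    then obtain \<mm> where m: "maximalideal \<mm> R" "D \<subseteq> \<mm>"
      using proper_ideal_le_maximalideal[OF D] by blast
    then obtain r \<tau> where "r \<in> carrier R - \<mm>" "Q r \<tau>" using loc unfolding Q_def by blast
    then show False using m by (auto simp: D_def)
  qed
  then have "\<one> \<in> D" by simp
  then obtain \<tau> where "Q \<one> \<tau>" unfolding D_def by blast
  then have "\<tau> \<in> module_maps R ?E ?F" "\<forall>f\<in>carrier ?F. B (\<tau> (B f)) = B f"
    using module_maps_closed[OF B] unfolding Q_def by auto
  then show ?thesis by blast
qed

lemma finite_common_multiplier:
  fixes R (structure)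
  assumes "cring R" and m: "primeideal \<mm> R" and "finite J"
    and ex: "\<And>j. j \<in> J \<Longrightarrow> \<exists>u\<in>carrier R - \<mm>. Q j u"
    and mult: "\<And>j u v. j \<in> J \<Longrightarrow> Q j u \<Longrightarrow> u \<in> carrier R \<Longrightarrow> v \<in> carrier R \<Longrightarrow> Q j (v \<otimes> u)"
  shows "\<exists>u\<in>carrier R - \<mm>. \<forall>j\<in>J. Q j u"
  using assms(3-)
proof (induction J rule: finite_induct)
  case empty
  interpret cring R by fact
  have "\<one> \<in> carrier R - \<mm>"
    using ideal.one_imp_carrier[of \<mm> R] m by (auto simp: primeideal_def primeideal_axioms_def)
  then show ?case by blast
next
  case (insert j J)
  interpret cring R by fact
  obtain u where u: "u \<in> carrier R - \<mm>" "\<forall>j\<in>J. Q j u" using insert.IH insert.prems by blast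
  obtain v where v: "v \<in> carrier R - \<mm>" "Q j v" using insert.prems by blast
  have "v \<otimes> u \<in> carrier R - \<mm>" using u v primeideal.I_prime[OF m, of v u] by auto
  moreover have "Q j (u \<otimes> v)" using insert.prems u v by blast
  then have "Q j (v \<otimes> u)" using u v by (simp add: m_comm)
  moreover have "Q i (v \<otimes> u)" if "i \<in> J" for i using insert.prems u v that by blast
  ultimately show ?case by blast
qed

text \<open>The cokernel of \<open>K\<close> in the free module on \<open>J\<close> is torsion-free, and the elements \<open>x, y\<close> of each witness form
  a weakly regular sequence on its localization at \<open>\<mm>\<close>. The condition is phrased on representatives, which
  avoids quotient modules.\<close>
definition depth_two_cokernel :: "('a, 'm) ring_scheme \<Rightarrow> 'i set \<Rightarrow> ('i \<Rightarrow> 'a) set \<Rightarrow> bool" where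
  "depth_two_cokernel R J K \<longleftrightarrow> submodule K R (free_module R J) \<and>
     (\<forall>a\<in>carrier R. \<forall>f\<in>carrier (free_module R J).
        a \<noteq> \<zero>\<^bsub>R\<^esub> \<longrightarrow> a \<odot>\<^bsub>free_module R J\<^esub> f \<in> K \<longrightarrow> f \<in> K) \<and>
     (\<forall>\<mm> x y s. maximalideal \<mm> R \<longrightarrow> depth_two_witness R \<mm> x y s \<longrightarrow>
        (\<forall>f\<in>carrier (free_module R J). \<forall>f'\<in>carrier (free_module R J).
           x \<odot>\<^bsub>free_module R J\<^esub> f \<oplus>\<^bsub>free_module R J\<^esub> y \<odot>\<^bsub>free_module R J\<^esub> f' \<in> K \<longrightarrow>
           (\<exists>u\<in>carrier R - \<mm>. \<exists>g\<in>carrier (free_module R J).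
              u \<odot>\<^bsub>free_module R J\<^esub> f' \<ominus>\<^bsub>free_module R J\<^esub> x \<odot>\<^bsub>free_module R J\<^esub> g \<in> K)))"

text \<open>All coordinates are divided by \<open>x\<close> with one common multiplier, as there are finitely many of
  them.\<close>
lemma depth_two_witness_vector:
  fixes R (structure)
  assumes "domain R" and m: "maximalideal \<mm> R" and w: "depth_two_witness R \<mm> x y s" and "finite J"
    and f: "\<And>j. j \<in> J \<Longrightarrow> f j \<in> carrier R" "\<And>j. j \<in> J \<Longrightarrow> f' j \<in> carrier R"
    and rel: "\<And>j. j \<in> J \<Longrightarrow> x \<otimes> f j \<oplus> y \<otimes> f' j = \<zero>"
  shows "\<exists>u\<in>carrier R - \<mm>. \<forall>j\<in>J. \<exists>c\<in>carrier R. u \<otimes> f' j = x \<otimes> c"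
proof (rule finite_common_multiplier)
  interpret domain R by fact
  show "cring R" by (rule is_cring)
  show "primeideal \<mm> R" by (rule maximalideal_prime[OF m])
  have xy: "x \<in> carrier R" "y \<in> carrier R" using w by (auto simp: depth_two_witness_def)
  show "\<exists>u\<in>carrier R - \<mm>. \<exists>c\<in>carrier R. u \<otimes> f' j = x \<otimes> c" if j: "j \<in> J" for j
  proof -
    have "y \<otimes> f' j = (x \<otimes> f j \<oplus> y \<otimes> f' j) \<oplus> x \<otimes> (\<ominus> f j)" using f[OF j] xy by algebra
    then have "y \<otimes> f' j = x \<otimes> (\<ominus> f j)" unfolding rel[OF j] using f[OF j] xy by simp
    then show ?thesis
      using w f[OF j] unfolding depth_two_witness_def by (meson a_inv_closed)
  qed
  show "\<exists>c\<in>carrier R. (v \<otimes> u) \<otimes> f' j = x \<otimes> c"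
    if j: "j \<in> J" and c: "\<exists>c\<in>carrier R. u \<otimes> f' j = x \<otimes> c" and uv: "u \<in> carrier R" "v \<in> carrier R" for j u v
  proof -
    obtain c where c: "c \<in> carrier R" "u \<otimes> f' j = x \<otimes> c" using c by blast
    have "(v \<otimes> u) \<otimes> f' j = v \<otimes> (u \<otimes> f' j)" using uv f[OF j] by algebra
    also have "\<dots> = x \<otimes> (v \<otimes> c)" unfolding c(2) using uv c(1) xy by algebra
    finally show ?thesis using uv c by blast
  qed
qed fact

text \<open>The same weak regularity of \<open>x, y\<close> for a module embedded in a free module, for which torsion-freeness is
  automatic.\<close>
definition depth_two_submodule :: "('a, 'm) ring_scheme \<Rightarrow> 'i set \<Rightarrow> ('i \<Rightarrow> 'a) set \<Rightarrow> bool" where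
  "depth_two_submodule R J N \<longleftrightarrow>
     (\<forall>\<mm> x y s. maximalideal \<mm> R \<longrightarrow> depth_two_witness R \<mm> x y s \<longrightarrow>
        (\<forall>n\<in>N. \<forall>n'\<in>N.
           x \<odot>\<^bsub>free_module R J\<^esub> n \<oplus>\<^bsub>free_module R J\<^esub> y \<odot>\<^bsub>free_module R J\<^esub> n' = \<zero>\<^bsub>free_module R J\<^esub> \<longrightarrow>
           (\<exists>u\<in>carrier R - \<mm>. \<exists>g\<in>N. u \<odot>\<^bsub>free_module R J\<^esub> n' = x \<odot>\<^bsub>free_module R J\<^esub> g)))"

text \<open>If \<open>x n + y n' = 0\<close> in \<open>K\<close>, the quotient of \<open>n'\<close> by \<open>x\<close> exists in the free module near \<open>\<mm>\<close>,
  and it belongs to \<open>K\<close> because the cokernel of \<open>K\<close> is torsion-free.\<close>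
lemma depth_two_submodule_of_cokernel:
  fixes R (structure)
  assumes dom: "domain R" and fin: "finite J" and K: "depth_two_cokernel R J K"
  shows "depth_two_submodule R J K"
  unfolding depth_two_submodule_def
proof (intro allI impI ballI)
  let ?E = "free_module R J"
  interpret domain R by fact
  interpret E: module R ?E by (rule free_module_is_module)
  have sub: "submodule K R ?E" using K by (simp add: depth_two_cokernel_def)
  note KE = E.submoduleE[OF sub]
  fix \<mm> x y s n n'
  assume m: "maximalideal \<mm> R" and w: "depth_two_witness R \<mm> x y s"
    and n: "n \<in> K" and n': "n' \<in> K" and rel: "x \<odot>\<^bsub>?E\<^esub> n \<oplus>\<^bsub>?E\<^esub> y \<odot>\<^bsub>?E\<^esub> n' = \<zero>\<^bsub>?E\<^esub>"
  have xy: "x \<in> carrier R" "y \<in> carrier R" "x \<noteq> \<zero>" using w by (auto simp: depth_two_witness_def)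
  have nc: "n \<in> carrier ?E" "n' \<in> carrier ?E" using n n' KE(1) by auto
  have "\<exists>u\<in>carrier R - \<mm>. \<forall>j\<in>J. \<exists>c\<in>carrier R. u \<otimes> n' j = x \<otimes> c"
  proof (rule depth_two_witness_vector[OF dom m w fin])
    show "n j \<in> carrier R" "n' j \<in> carrier R" if "j \<in> J" for j
      using that free_module_coord nc by metis+
    show "x \<otimes> n j \<oplus> y \<otimes> n' j = \<zero>" if "j \<in> J" for j
      using arg_cong[OF rel, of "\<lambda>f. f j"] that by (simp add: free_module_apply)
  qed
  then obtain u c where u: "u \<in> carrier R - \<mm>"
    and c: "\<And>j. j \<in> J \<Longrightarrow> c j \<in> carrier R" "\<And>j. j \<in> J \<Longrightarrow> u \<otimes> n' j = x \<otimes> c j" by metis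
  define g where "g = (\<lambda>j\<in>J. c j)"
  have gc: "g \<in> carrier ?E" using c fin by (auto simp: g_def free_module_carrier_finite)
  have ug: "u \<odot>\<^bsub>?E\<^esub> n' = x \<odot>\<^bsub>?E\<^esub> g"
    by (rule free_module_ext[of _ R J]) (use u c xy gc nc in \<open>auto simp: g_def free_module_apply\<close>)
  have "u \<odot>\<^bsub>?E\<^esub> n' \<in> K" using KE(4) u n' by blast
  then have "g \<in> K" using ug K xy gc unfolding depth_two_cokernel_def by metis
  then show "\<exists>u\<in>carrier R - \<mm>. \<exists>g\<in>K. u \<odot>\<^bsub>?E\<^esub> n' = x \<odot>\<^bsub>?E\<^esub> g" using u ug by blast
qed

text \<open>The cokernel of the kernel of \<open>d\<close> is isomorphic to the image of \<open>d\<close>.\<close>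
lemma kernel_depth_two_cokernel:
  fixes R (structure)
  assumes dom: "domain R"
    and d: "d \<in> module_maps R (free_module R I) (free_module R J)"
    and N: "depth_two_submodule R J (d ` carrier (free_module R I))"
  shows "depth_two_cokernel R I {z \<in> carrier (free_module R I). d z = \<zero>\<^bsub>free_module R J\<^esub>}"
    (is "depth_two_cokernel R I ?Z")
proof -
  let ?F = "free_module R I" and ?E = "free_module R J"
  interpret domain R by fact
  interpret F: module R ?F by (rule free_module_is_module)
  interpret E: module R ?E by (rule free_module_is_module)
  have Fm: "module R ?F" and Em: "module R ?E" by (rule free_module_is_module)+
  note dc = module_maps_closed[OF d]
  note dsimps = module_maps_add[OF d] module_maps_smult[OF d] module_maps_minus[OF Fm Em d]
  have torsion_free: "v = \<zero>\<^bsub>?E\<^esub>"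
    if v: "v \<in> carrier ?E" "a \<in> carrier R" "a \<noteq> \<zero>" "a \<odot>\<^bsub>?E\<^esub> v = \<zero>\<^bsub>?E\<^esub>" for a v
  proof (rule free_module_ext[of _ R J])
    fix j assume j: "j \<in> J"
    have "a \<otimes> v j = \<zero>" using arg_cong[OF v(4), of "\<lambda>f. f j"] j by (simp add: free_module_apply)
    then show "v j = \<zero>\<^bsub>?E\<^esub> j" using v free_module_coord[OF v(1) j] j by (simp add: integral_iff free_module_apply)
  qed (use v in auto)
  show ?thesis
    unfolding depth_two_cokernel_def
  proof (intro conjI ballI allI impI)
    show "submodule ?Z R ?F" by (rule kernel_submodule[OF Fm Em d])
    show "f \<in> ?Z" if "a \<in> carrier R" "f \<in> carrier ?F" "a \<noteq> \<zero>" "a \<odot>\<^bsub>?F\<^esub> f \<in> ?Z" for a f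
      using that torsion_free[OF dc] by (simp add: dsimps)
    fix \<mm> x y s f f'
    assume m: "maximalideal \<mm> R" and w: "depth_two_witness R \<mm> x y s"
      and f: "f \<in> carrier ?F" and f': "f' \<in> carrier ?F" and rel: "x \<odot>\<^bsub>?F\<^esub> f \<oplus>\<^bsub>?F\<^esub> y \<odot>\<^bsub>?F\<^esub> f' \<in> ?Z"
    have xy: "x \<in> carrier R" "y \<in> carrier R" using w by (auto simp: depth_two_witness_def)
    have "x \<odot>\<^bsub>?E\<^esub> d f \<oplus>\<^bsub>?E\<^esub> y \<odot>\<^bsub>?E\<^esub> d f' = \<zero>\<^bsub>?E\<^esub>" using rel f f' xy by (simp add: dsimps)
    then have "\<exists>u\<in>carrier R - \<mm>. \<exists>g\<in>d ` carrier ?F. u \<odot>\<^bsub>?E\<^esub> d f' = x \<odot>\<^bsub>?E\<^esub> g"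
      using N m w imageI[OF f, of d] imageI[OF f', of d] unfolding depth_two_submodule_def by blast
    then obtain u h where u: "u \<in> carrier R - \<mm>" and h: "h \<in> carrier ?F"
      and ug: "u \<odot>\<^bsub>?E\<^esub> d f' = x \<odot>\<^bsub>?E\<^esub> d h" by blast
    have "d (u \<odot>\<^bsub>?F\<^esub> f' \<ominus>\<^bsub>?F\<^esub> x \<odot>\<^bsub>?F\<^esub> h) = \<zero>\<^bsub>?E\<^esub>"
      using u xy f' h ug dc[OF h] by (simp add: dsimps E.M.diff_eq_zero_iff)
    then show "\<exists>u\<in>carrier R - \<mm>. \<exists>g\<in>carrier ?F. u \<odot>\<^bsub>?F\<^esub> f' \<ominus>\<^bsub>?F\<^esub> x \<odot>\<^bsub>?F\<^esub> g \<in> ?Z"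
      using u h f' xy by (intro bexI[OF _ u] bexI[OF _ h]) simp
  qed
qed

text \<open>The step down the resolution. The map \<open>P = 1 - A \<sigma>\<close> is a projection with kernel the image of \<open>A\<close>, so \<open>B\<close>
  restricts to an isomorphism from the image of \<open>P\<close> onto \<open>K\<close>; this is how the projectivity of \<open>K\<close> enters. For
  \<open>B f \<in> \<mm> E\<close> the element \<open>s\<close> of the witness gives \<open>s B f \<in> (x, y) E\<close>, then depth two gives
  \<open>s B f \<in> (x, y) K\<close>, and applying the inverse of \<open>B\<close> yields \<open>s P f \<in> (x, y) F\<close>, all up to factors
  outside \<open>\<mm>\<close>. Since \<open>s\<close> is not in \<open>(x, y)\<close> near \<open>\<mm>\<close>, the coordinates of \<open>P f\<close> lie in \<open>\<mm>\<close>.\<close>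
lemma splitting_descends:
  fixes R (structure)
  assumes dom: "noetherian_domain R" and fin: "finite I" "finite J"
    and wit: "\<And>\<mm>. maximalideal \<mm> R \<Longrightarrow> \<exists>x y s. depth_two_witness R \<mm> x y s"
    and A: "A \<in> module_maps R (free_module R I') (free_module R I)"
    and B: "B \<in> module_maps R (free_module R I) (free_module R J)"
    and exact: "A ` carrier (free_module R I') = {z \<in> carrier (free_module R I). B z = \<zero>\<^bsub>free_module R J\<^esub>}"
    and K: "depth_two_cokernel R J (B ` carrier (free_module R I))"
    and \<sigma>: "\<sigma> \<in> module_maps R (free_module R I) (free_module R I')"
    and A\<sigma>A: "\<And>z. z \<in> carrier (free_module R I') \<Longrightarrow> A (\<sigma> (A z)) = A z"
  shows "\<exists>\<tau>\<in>module_maps R (free_module R J) (free_module R I).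
    \<forall>f\<in>carrier (free_module R I). B (\<tau> (B f)) = B f"
proof -
  let ?G = "free_module R I'" and ?F = "free_module R I" and ?E = "free_module R J"
  interpret noetherian_domain R by fact
  interpret F: module R ?F by (rule free_module_is_module)
  interpret E: module R ?E by (rule free_module_is_module)
  have Gm: "module R ?G" and Fm: "module R ?F" and Em: "module R ?E" by (rule free_module_is_module)+
  define P where "P f = f \<ominus>\<^bsub>?F\<^esub> A (\<sigma> f)" for f
  have P: "P \<in> module_maps R ?F ?F"
    unfolding P_def by (intro module_maps_diff module_maps_id module_maps_comp[OF \<sigma> A] Fm)
  note Ac = module_maps_closed[OF A] and Bc = module_maps_closed[OF B]
    and Pc = module_maps_closed[OF P] and \<sigma>c = module_maps_closed[OF \<sigma>]
  note Bsimps = module_maps_add[OF B] module_maps_smult[OF B] module_maps_minus[OF Fm Em B]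
  note Psimps = module_maps_add[OF P] module_maps_smult[OF P] module_maps_minus[OF Fm Fm P]
  have BA: "B (A z) = \<zero>\<^bsub>?E\<^esub>" if "z \<in> carrier ?G" for z using exact that by blast
  have BP: "B (P f) = B f" if f: "f \<in> carrier ?F" for f
  proof -
    have "B (P f) = B f \<ominus>\<^bsub>?E\<^esub> \<zero>\<^bsub>?E\<^esub>"
      using f BA[OF \<sigma>c[OF f]] Ac[OF \<sigma>c[OF f]] unfolding P_def by (simp add: Bsimps)
    then show ?thesis using Bc[OF f] by (simp add: a_minus_def)
  qed
  have P_ker: "P f = \<zero>\<^bsub>?F\<^esub>" if f: "f \<in> carrier ?F" "B f = \<zero>\<^bsub>?E\<^esub>" for f
  proof -
    obtain z where z: "z \<in> carrier ?G" "f = A z" using exact f by blast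
    then show ?thesis unfolding P_def using A\<sigma>A[OF z(1)] Ac by (simp add: F.M.diff_eq_zero_iff)
  qed
  have near: "\<exists>r\<in>carrier R - \<mm>. \<exists>\<tau>\<in>module_maps R ?E ?F. \<forall>f\<in>carrier ?F. B (\<tau> (B f)) = r \<odot>\<^bsub>?E\<^esub> B f"
    if m: "maximalideal \<mm> R" for \<mm>
  proof (rule splitting_near_maximal_ideal[OF fin m B])
    interpret m: maximalideal \<mm> R by fact
    have mp: "primeideal \<mm> R" by (rule maximalideal_prime[OF m])
    obtain x y s where w: "depth_two_witness R \<mm> x y s" using wit[OF m] by blast
    then have xys: "x \<in> carrier R" "y \<in> carrier R" "s \<in> carrier R" "x \<noteq> \<zero>"
      by (auto simp: depth_two_witness_def)
    fix f assume f: "f \<in> carrier ?F" and Bm: "\<forall>j\<in>J. B f j \<in> \<mm>"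
    have "\<exists>u\<in>carrier R - \<mm>. \<forall>j\<in>J. \<exists>b\<in>carrier R. \<exists>c\<in>carrier R. u \<otimes> (B f j \<otimes> s) = x \<otimes> b \<oplus> y \<otimes> c"
    proof (rule finite_common_multiplier[OF is_cring mp fin(2)])
      show "\<exists>u\<in>carrier R - \<mm>. \<exists>b\<in>carrier R. \<exists>c\<in>carrier R. u \<otimes> (B f j \<otimes> s) = x \<otimes> b \<oplus> y \<otimes> c"
        if "j \<in> J" for j
        using w Bm that unfolding depth_two_witness_def by blast
      fix j u v assume j: "j \<in> J" and uv: "u \<in> carrier R" "v \<in> carrier R"
        and "\<exists>b\<in>carrier R. \<exists>c\<in>carrier R. u \<otimes> (B f j \<otimes> s) = x \<otimes> b \<oplus> y \<otimes> c"
      then obtain b c where bc: "b \<in> carrier R" "c \<in> carrier R" "u \<otimes> (B f j \<otimes> s) = x \<otimes> b \<oplus> y \<otimes> c"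
        by blast
      have "(v \<otimes> u) \<otimes> (B f j \<otimes> s) = v \<otimes> (u \<otimes> (B f j \<otimes> s))"
        using uv xys free_module_coord[OF Bc[OF f] j] by algebra
      also have "\<dots> = x \<otimes> (v \<otimes> b) \<oplus> y \<otimes> (v \<otimes> c)" unfolding bc(3) using uv xys(1,2) bc(1,2) by algebra
      finally show "\<exists>b\<in>carrier R. \<exists>c\<in>carrier R. (v \<otimes> u) \<otimes> (B f j \<otimes> s) = x \<otimes> b \<oplus> y \<otimes> c"
        using uv bc by blast
    qed
    then obtain u b c where u: "u \<in> carrier R - \<mm>"
      and bc: "\<And>j. j \<in> J \<Longrightarrow> b j \<in> carrier R" "\<And>j. j \<in> J \<Longrightarrow> c j \<in> carrier R"
        "\<And>j. j \<in> J \<Longrightarrow> u \<otimes> (B f j \<otimes> s) = x \<otimes> b j \<oplus> y \<otimes> c j" by metis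
    have uc: "u \<in> carrier R" using u by simp
    define f1 where "f1 = (\<lambda>j\<in>J. b j)"
    define f2 where "f2 = (\<lambda>j\<in>J. c j)"
    have f12: "f1 \<in> carrier ?E" "f2 \<in> carrier ?E"
      using bc fin by (auto simp: f1_def f2_def free_module_carrier_finite)
    have usBf: "(u \<otimes> s) \<odot>\<^bsub>?E\<^esub> B f = x \<odot>\<^bsub>?E\<^esub> f1 \<oplus>\<^bsub>?E\<^esub> y \<odot>\<^bsub>?E\<^esub> f2"
    proof (rule free_module_ext[of _ R J])
      fix j assume j: "j \<in> J"
      have "(u \<otimes> s) \<otimes> B f j = u \<otimes> (B f j \<otimes> s)"
        using uc xys free_module_coord[OF Bc[OF f] j] by algebra
      then show "((u \<otimes> s) \<odot>\<^bsub>?E\<^esub> B f) j = (x \<odot>\<^bsub>?E\<^esub> f1 \<oplus>\<^bsub>?E\<^esub> y \<odot>\<^bsub>?E\<^esub> f2) j"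
        using j bc by (simp add: free_module_apply f1_def f2_def)
    qed (use uc xys f12 Bc[OF f] in simp_all)
    have "x \<odot>\<^bsub>?E\<^esub> f1 \<oplus>\<^bsub>?E\<^esub> y \<odot>\<^bsub>?E\<^esub> f2 = B ((u \<otimes> s) \<odot>\<^bsub>?F\<^esub> f)"
      using usBf uc xys f by (simp add: Bsimps)
    then have "x \<odot>\<^bsub>?E\<^esub> f1 \<oplus>\<^bsub>?E\<^esub> y \<odot>\<^bsub>?E\<^esub> f2 \<in> B ` carrier ?F" using uc xys f by auto
    then obtain v g where v: "v \<in> carrier R - \<mm>" and g: "g \<in> carrier ?E"
      and vg: "v \<odot>\<^bsub>?E\<^esub> f2 \<ominus>\<^bsub>?E\<^esub> x \<odot>\<^bsub>?E\<^esub> g \<in> B ` carrier ?F"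
      using K m w f12 unfolding depth_two_cokernel_def by blast
    have vc: "v \<in> carrier R" using v by simp
    obtain k2 where k2: "k2 \<in> carrier ?F" "v \<odot>\<^bsub>?E\<^esub> f2 \<ominus>\<^bsub>?E\<^esub> x \<odot>\<^bsub>?E\<^esub> g = B k2" using vg by blast
    \<comment> \<open>Depth two in two steps: \<open>v f2\<close> is \<open>x g\<close> modulo \<open>K\<close>, so that \<open>x q\<close> lies in \<open>K\<close>, and then \<open>q\<close> lies in \<open>K\<close> by
      torsion-freeness.\<close>
    define q where "q = v \<odot>\<^bsub>?E\<^esub> f1 \<oplus>\<^bsub>?E\<^esub> y \<odot>\<^bsub>?E\<^esub> g"
    have qc: "q \<in> carrier ?E" unfolding q_def using vc xys f12 g by simp
    define a where "a = v \<otimes> (u \<otimes> s)"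
    have ac: "a \<in> carrier R" unfolding a_def using vc uc xys by simp
    have aBf: "a \<odot>\<^bsub>?E\<^esub> B f = x \<odot>\<^bsub>?E\<^esub> q \<oplus>\<^bsub>?E\<^esub> y \<odot>\<^bsub>?E\<^esub> B k2"
    proof -
      have "a \<odot>\<^bsub>?E\<^esub> B f = v \<odot>\<^bsub>?E\<^esub> (x \<odot>\<^bsub>?E\<^esub> f1 \<oplus>\<^bsub>?E\<^esub> y \<odot>\<^bsub>?E\<^esub> f2)"
        unfolding a_def usBf[symmetric] using vc uc xys Bc[OF f] by (simp add: E.smult_assoc1)
      also have "\<dots> = x \<odot>\<^bsub>?E\<^esub> q \<oplus>\<^bsub>?E\<^esub> y \<odot>\<^bsub>?E\<^esub> (v \<odot>\<^bsub>?E\<^esub> f2 \<ominus>\<^bsub>?E\<^esub> x \<odot>\<^bsub>?E\<^esub> g)"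
      proof (rule free_module_ext[of _ R J])
        fix j assume j: "j \<in> J"
        note co = free_module_coord[OF f12(1) j] free_module_coord[OF f12(2) j] free_module_coord[OF g j]
        have "v \<otimes> (x \<otimes> f1 j \<oplus> y \<otimes> f2 j) = x \<otimes> (v \<otimes> f1 j \<oplus> y \<otimes> g j) \<oplus> y \<otimes> (v \<otimes> f2 j \<ominus> x \<otimes> g j)"
          using vc xys(1,2) co by algebra
        then show "(v \<odot>\<^bsub>?E\<^esub> (x \<odot>\<^bsub>?E\<^esub> f1 \<oplus>\<^bsub>?E\<^esub> y \<odot>\<^bsub>?E\<^esub> f2)) j
            = (x \<odot>\<^bsub>?E\<^esub> q \<oplus>\<^bsub>?E\<^esub> y \<odot>\<^bsub>?E\<^esub> (v \<odot>\<^bsub>?E\<^esub> f2 \<ominus>\<^bsub>?E\<^esub> x \<odot>\<^bsub>?E\<^esub> g)) j"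
          unfolding q_def using j vc xys f12 g by (simp add: free_module_apply free_module_minus_apply)
      qed (use vc xys f12 g qc in simp_all)
      finally show ?thesis unfolding k2(2) .
    qed
    have "x \<odot>\<^bsub>?E\<^esub> q = a \<odot>\<^bsub>?E\<^esub> B f \<ominus>\<^bsub>?E\<^esub> y \<odot>\<^bsub>?E\<^esub> B k2"
      unfolding aBf using xys qc Bc[OF k2(1)] by (simp add: a_minus_def E.M.a_assoc E.M.r_neg)
    also have "\<dots> = B (a \<odot>\<^bsub>?F\<^esub> f \<ominus>\<^bsub>?F\<^esub> y \<odot>\<^bsub>?F\<^esub> k2)" using ac xys f k2(1) by (simp add: Bsimps)
    finally have "x \<odot>\<^bsub>?E\<^esub> q \<in> B ` carrier ?F" using ac xys f k2(1) by auto
    then have "q \<in> B ` carrier ?F" using K xys qc unfolding depth_two_cokernel_def by blast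
    then obtain k1 where k1: "k1 \<in> carrier ?F" "q = B k1" by blast
    have "B (a \<odot>\<^bsub>?F\<^esub> f \<ominus>\<^bsub>?F\<^esub> (x \<odot>\<^bsub>?F\<^esub> k1 \<oplus>\<^bsub>?F\<^esub> y \<odot>\<^bsub>?F\<^esub> k2)) = \<zero>\<^bsub>?E\<^esub>"
      using ac xys f k1 k2(1) aBf qc Bc by (simp add: Bsimps E.M.diff_eq_zero_iff)
    then have "P (a \<odot>\<^bsub>?F\<^esub> f \<ominus>\<^bsub>?F\<^esub> (x \<odot>\<^bsub>?F\<^esub> k1 \<oplus>\<^bsub>?F\<^esub> y \<odot>\<^bsub>?F\<^esub> k2)) = \<zero>\<^bsub>?F\<^esub>"
      using ac xys f k1 k2(1) by (intro P_ker) simp_all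
    then have aPf: "a \<odot>\<^bsub>?F\<^esub> P f = x \<odot>\<^bsub>?F\<^esub> P k1 \<oplus>\<^bsub>?F\<^esub> y \<odot>\<^bsub>?F\<^esub> P k2"
      using ac xys f k1(1) k2(1) Pc by (simp add: Psimps F.M.diff_eq_zero_iff)
    have "P f i \<in> \<mm>" if i: "i \<in> I" for i
    proof (rule ccontr)
      assume Pfi: "P f i \<notin> \<mm>"
      note co = free_module_coord[OF Pc[OF f] i] free_module_coord[OF Pc[OF k1(1)] i]
        free_module_coord[OF Pc[OF k2(1)] i]
      define t where "t = v \<otimes> (u \<otimes> P f i)"
      have t: "t \<in> carrier R - \<mm>"
        unfolding t_def using Pfi u v co primeideal.I_prime[OF mp, of v "u \<otimes> P f i"]
          primeideal.I_prime[OF mp, of u "P f i"] by auto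
      have "t \<otimes> s = a \<otimes> P f i" unfolding t_def a_def using uc vc xys co by algebra
      also have "\<dots> = x \<otimes> P k1 i \<oplus> y \<otimes> P k2 i"
        using arg_cong[OF aPf, of "\<lambda>f. f i"] i by (simp add: free_module_apply)
      finally show False using w t co unfolding depth_two_witness_def by blast
    qed
    then show "\<exists>f'\<in>carrier ?F. (\<forall>i\<in>I. f' i \<in> \<mm>) \<and> B f = B f'"
      using Pc[OF f] BP[OF f] by (intro bexI[of _ "P f"]) auto
  qed
  show ?thesis by (rule splitting_globalizes[OF noetherian_ring_axioms is_cring B near])
qed

section \<open>Finitely generated submodules\<close>

lemma (in cring) coordinates_ideal:
  assumes H: "submodule H R (free_module R I)" and j: "j \<in> I"
  shows "ideal ((\<lambda>f. f j) ` H) R"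
proof (rule idealI)
  let ?F = "free_module R I"
  interpret F: module R ?F by (rule free_module_is_module)
  note HE = F.submoduleE[OF H]
  have Hc: "f j \<in> carrier R" if "f \<in> H" for f by (rule free_module_coord[OF subsetD[OF HE(1) that] j])
  show "ring R" by (rule ring_axioms)
  have mult: "x \<otimes> a \<in> (\<lambda>f. f j) ` H" if a: "a \<in> (\<lambda>f. f j) ` H" and x: "x \<in> carrier R" for a x
  proof -
    obtain f where "a = f j" "f \<in> H" using a by auto
    then show ?thesis
      using HE(4)[OF x, of f] j by (intro image_eqI[of _ _ "x \<odot>\<^bsub>?F\<^esub> f"]) (simp_all add: free_module_apply)
  qed
  show "subgroup ((\<lambda>f. f j) ` H) (add_monoid R)"
  proof (rule add.subgroupI)
    show "(\<lambda>f. f j) ` H \<subseteq> carrier R" using Hc by blast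
    show "(\<lambda>f. f j) ` H \<noteq> {}" using HE(2) by blast
    show "\<ominus> a \<in> (\<lambda>f. f j) ` H" if "a \<in> (\<lambda>f. f j) ` H" for a
    proof -
      have "\<ominus> a = \<ominus> \<one> \<otimes> a" using that Hc by (auto simp: l_minus)
      then show ?thesis using mult[OF that, of "\<ominus> \<one>"] by simp
    qed
    show "a \<oplus> b \<in> (\<lambda>f. f j) ` H" if a: "a \<in> (\<lambda>f. f j) ` H" and b: "b \<in> (\<lambda>f. f j) ` H" for a b
    proof -
      obtain f g where "f \<in> H" "a = f j" "g \<in> H" "b = g j" using a b by auto
      then show ?thesis
        using HE(5)[of f g] j by (intro image_eqI[of _ _ "f \<oplus>\<^bsub>?F\<^esub> g"]) (simp_all add: free_module_apply)
    qed
  qed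
  show "x \<otimes> a \<in> (\<lambda>f. f j) ` H" "a \<otimes> x \<in> (\<lambda>f. f j) ` H"
    if "a \<in> (\<lambda>f. f j) ` H" "x \<in> carrier R" for a x
  proof -
    show "x \<otimes> a \<in> (\<lambda>f. f j) ` H" using mult that by blast
    moreover have "a \<in> carrier R" using that Hc by blast
    ultimately show "a \<otimes> x \<in> (\<lambda>f. f j) ` H" using that(2) by (simp add: m_comm)
  qed
qed

lemma submodule_Int:
  assumes "module R M" "submodule H R M" "submodule N R M"
  shows "submodule (H \<inter> N) R M"
proof -
  interpret M: module R M by fact
  note HE = M.submoduleE[OF assms(2)] and NE = M.submoduleE[OF assms(3)]
  show ?thesis
    by (rule M.submoduleI)
      (use HE NE submodule_zero_mem[OF assms(2)] submodule_zero_mem[OF assms(3)] in auto)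
qed

text \<open>Induction on the set of coordinates in which the elements of \<open>N\<close> may be nonzero: the \<open>j\<close>-th coordinates
  form a finitely generated ideal, and the elements of \<open>N\<close> with vanishing \<open>j\<close>-th coordinate are covered by
  the induction hypothesis. Generation is expressed by minimality, which avoids linear
  combinations.\<close>
lemma free_submodule_finitely_generated:
  fixes R (structure)
  assumes "noetherian_ring R" "cring R" and I: "finite I" and N: "submodule N R (free_module R I)"
  shows "\<exists>S. finite S \<and> S \<subseteq> N \<and> (\<forall>H. submodule H R (free_module R I) \<longrightarrow> S \<subseteq> H \<longrightarrow> N \<subseteq> H)"
proof -
  let ?F = "free_module R I"
  interpret noetherian_ring R by fact
  interpret cring R by fact
  interpret F: module R ?F by (rule free_module_is_module)
  have Fm: "module R ?F" by (rule free_module_is_module)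
  have "\<exists>S. finite S \<and> S \<subseteq> N \<and> (\<forall>H. submodule H R ?F \<longrightarrow> S \<subseteq> H \<longrightarrow> N \<subseteq> H)"
    if "finite J" "J \<subseteq> I" "submodule N R ?F" "\<And>f i. f \<in> N \<Longrightarrow> i \<in> I - J \<Longrightarrow> f i = \<zero>" for J N
    using that
  proof (induction J arbitrary: N rule: finite_induct)
    case empty
    have "f = \<zero>\<^bsub>?F\<^esub>" if "f \<in> N" for f
      using that empty F.submoduleE(1)[OF empty(2)]
      by (intro free_module_ext[of _ R I]) (auto simp: free_module_apply)
    then have "N \<subseteq> H" if "submodule H R ?F" for H using submodule_zero_mem[OF that] by auto
    then show ?case by (intro exI[of _ "{}"]) auto
  next
    case (insert j J)
    have jI: "j \<in> I" using insert.prems by blast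
    note NE = F.submoduleE[OF insert.prems(2)]
    define N' where "N' = {f \<in> N. f j = \<zero>}"
    have N': "submodule N' R ?F"
      unfolding N'_def
      by (rule F.submoduleI)
        (use NE jI submodule_zero_mem[OF insert.prems(2)] in
          \<open>auto simp: free_module_apply free_module_uminus_apply subset_iff\<close>)
    have "f i = \<zero>" if "f \<in> N'" "i \<in> I - J" for f i
      using that insert.prems(3)[of f i] by (cases "i = j") (auto simp: N'_def)
    then obtain S' where S': "finite S'" "S' \<subseteq> N'"
      "\<And>H. submodule H R ?F \<Longrightarrow> S' \<subseteq> H \<Longrightarrow> N' \<subseteq> H"
      using insert.IH[OF _ N'] insert.prems(1) by blast
    obtain A where A: "A \<subseteq> carrier R" "finite A" "(\<lambda>f. f j) ` N = Idl A"
      using finetely_gen[OF coordinates_ideal[OF insert.prems(2) jI]] by blast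
    have "A \<subseteq> (\<lambda>f. f j) ` N" using genideal_self[OF A(1)] A(3) by simp
    then obtain T where T: "T \<subseteq> N" "finite T" "A = (\<lambda>f. f j) ` T"
      using finite_subset_image[OF A(2)] by blast
    have "N \<subseteq> H" if H: "submodule H R ?F" "S' \<union> T \<subseteq> H" for H
    proof
      fix f assume f: "f \<in> N"
      have HN: "submodule (H \<inter> N) R ?F" by (rule submodule_Int[OF Fm H(1) insert.prems(2)])
      have "Idl A \<subseteq> (\<lambda>f. f j) ` (H \<inter> N)"
        by (rule genideal_minimal[OF coordinates_ideal[OF HN jI]]) (use T H in auto)
      then obtain h where h: "h \<in> H" "h \<in> N" "f j = h j" using f A(3) by blast
      have fh: "f \<in> carrier ?F" "h \<in> carrier ?F" using f h NE(1) by auto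
      have "f \<ominus>\<^bsub>?F\<^esub> h \<in> N" by (rule submodule_minus_mem[OF Fm insert.prems(2) f h(2)])
      moreover have "(f \<ominus>\<^bsub>?F\<^esub> h) j = \<zero>"
        using fh jI h(3) free_module_coord[OF fh(2) jI] by (simp add: free_module_minus_apply minus_eq r_neg)
      ultimately have "f \<ominus>\<^bsub>?F\<^esub> h \<in> H" using S'(3)[OF H(1)] H(2) by (auto simp: N'_def)
      then have "(f \<ominus>\<^bsub>?F\<^esub> h) \<oplus>\<^bsub>?F\<^esub> h \<in> H" using F.submoduleE(5)[OF H(1)] h by blast
      moreover have "(f \<ominus>\<^bsub>?F\<^esub> h) \<oplus>\<^bsub>?F\<^esub> h = f" using fh by (simp add: a_minus_def F.M.a_assoc F.M.l_neg)
      ultimately show "f \<in> H" by simp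
    qed
    then show ?case using S' T by (intro exI[of _ "S' \<union> T"]) (auto simp: N'_def)
  qed
  from this[OF I _ N] show ?thesis by blast
qed

lemma free_submodule_cover:
  fixes R (structure)
  assumes "noetherian_ring R" "cring R" and I: "finite I" and N: "submodule N R (free_module R I)"
  shows "\<exists>(k::nat). \<exists>d\<in>module_maps R (free_module R {..<k}) (free_module R I).
    d ` carrier (free_module R {..<k}) = N"
proof -
  let ?F = "free_module R I"
  interpret cring R by fact
  interpret F: module R ?F by (rule free_module_is_module)
  have Fm: "module R ?F" by (rule free_module_is_module)
  obtain S where S: "finite S" "S \<subseteq> N" "\<And>H. submodule H R ?F \<Longrightarrow> S \<subseteq> H \<Longrightarrow> N \<subseteq> H"
    using free_submodule_finitely_generated[OF assms] by blast
  obtain k :: nat and g where g: "S = g ` {i. i < k}"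
    using finite_imp_nat_seg_image_inj_on[OF S(1)] by blast
  let ?K = "free_module R {..<k}"
  have Km: "module R ?K" by (rule free_module_is_module)
  have gN: "g i \<in> N" if "i \<in> {..<k}" for i using that g S(2) by auto
  then have gF: "g i \<in> carrier ?F" if "i \<in> {..<k}" for i using that F.submoduleE(1)[OF N] by blast
  obtain d where d: "d \<in> module_maps R ?K ?F" and dg: "\<forall>i\<in>{..<k}. d (unit_vec R {..<k} i) = g i"
    by (rule bexE[OF free_module_map_exists[of ?F "{..<k}" g, OF Fm gF]])
  have "d ` carrier ?K \<subseteq> N"
  proof
    fix y assume "y \<in> d ` carrier ?K"
    then obtain f where f: "f \<in> carrier ?K" "y = d f" by blast
    have "f \<in> {f \<in> carrier ?K. d f \<in> N}"
    proof (rule free_module_submodule_mem[OF vimage_submodule[OF Km Fm d N] f(1)])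
      fix i assume i: "i \<in> {..<k}"
      note e = unit_vec_closed[OF i] and fi = free_module_coord[OF f(1) i]
      have "f i \<odot>\<^bsub>?K\<^esub> unit_vec R {..<k} i \<in> carrier ?K" using module.smult_closed[OF Km fi e] .
      moreover have "d (f i \<odot>\<^bsub>?K\<^esub> unit_vec R {..<k} i) \<in> N"
        using module_maps_smult[OF d fi e] dg i F.submoduleE(4)[OF N fi gN[OF i]] by simp
      ultimately show "f i \<odot>\<^bsub>?K\<^esub> unit_vec R {..<k} i \<in> {f \<in> carrier ?K. d f \<in> N}" by blast
    qed
    then show "y \<in> N" using f by blast
  qed
  moreover have "N \<subseteq> d ` carrier ?K"
  proof (rule S(3)[OF image_submodule[OF Km Fm d]])
    show "S \<subseteq> d ` carrier ?K"
    proof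
      fix y assume "y \<in> S"
      then obtain i where i: "i \<in> {..<k}" "y = g i" using g by auto
      then have "y = d (unit_vec R {..<k} i)" using dg by simp
      then show "y \<in> d ` carrier ?K" using unit_vec_closed[OF i(1)] by blast
    qed
  qed
  ultimately show ?thesis using d by blast
qed

section \<open>Projective modules\<close>

lemma projective_module_retract:
  fixes R (structure) and P :: "('a, 'b, 'p) module_scheme"
  assumes "is_projective_module R P"
  shows "\<exists>(I :: 'b set). \<exists>s\<in>module_maps R P (free_module R I). \<exists>r\<in>module_maps R (free_module R I) P.
    \<forall>z\<in>carrier P. r (s z) = z"
proof -
  interpret P: module R P using assms by (simp add: is_projective_module_def)
  obtain I :: "'b set" and N Q where sub: "submodule N R (free_module R I)" "submodule Q R (free_module R I)"
    and NQ: "N \<inter> Q = {\<zero>\<^bsub>free_module R I\<^esub>}" "N <+>\<^bsub>free_module R I\<^esub> Q = carrier (free_module R I)"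
    and iso: "module_isomorphic R P ((free_module R I)\<lparr>carrier := N\<rparr>)"
    using assms by (auto simp: is_projective_module_def Let_def)
  let ?F = "free_module R I"
  interpret F: module R ?F by (rule P.R.free_module_is_module)
  have Fm: "module R ?F" and Pm: "module R P" by (rule P.R.free_module_is_module) unfold_locales
  note NE = F.submoduleE[OF sub(1)] and QE = F.submoduleE[OF sub(2)]
  obtain s where s0: "s \<in> module_maps R P (?F\<lparr>carrier := N\<rparr>)" and bij: "bij_betw s (carrier P) N"
    using iso by (auto simp: module_isomorphic_def)
  have sN: "s z \<in> N" if "z \<in> carrier P" for z using bij that by (auto simp: bij_betw_def)
  have s: "s \<in> module_maps R P ?F"
    using s0 NE(1) by (auto simp: module_maps_def hom_def)
  note sc = module_maps_closed[OF s]
  have ex: "\<exists>z\<in>carrier P. \<exists>q\<in>Q. f = s z \<oplus>\<^bsub>?F\<^esub> q" if f: "f \<in> carrier ?F" for f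
  proof -
    obtain n q where "n \<in> N" "q \<in> Q" "f = n \<oplus>\<^bsub>?F\<^esub> q"
      using f unfolding NQ(2)[symmetric] by (auto simp: set_add_def set_mult_def)
    moreover then obtain z where "z \<in> carrier P" "n = s z" using bij by (auto simp: bij_betw_def)
    ultimately show ?thesis by blast
  qed
  define r where "r f = (SOME z. z \<in> carrier P \<and> (\<exists>q\<in>Q. f = s z \<oplus>\<^bsub>?F\<^esub> q))" for f
  have r_eq: "r (s z \<oplus>\<^bsub>?F\<^esub> q) = z" if z: "z \<in> carrier P" and q: "q \<in> Q" for z q
    unfolding r_def
  proof (rule some_equality)
    show "z \<in> carrier P \<and> (\<exists>q'\<in>Q. s z \<oplus>\<^bsub>?F\<^esub> q = s z \<oplus>\<^bsub>?F\<^esub> q')" using z q by blast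
    fix z' assume "z' \<in> carrier P \<and> (\<exists>q'\<in>Q. s z \<oplus>\<^bsub>?F\<^esub> q = s z' \<oplus>\<^bsub>?F\<^esub> q')"
    then obtain q' where z': "z' \<in> carrier P" and q': "q' \<in> Q" and eq: "s z \<oplus>\<^bsub>?F\<^esub> q = s z' \<oplus>\<^bsub>?F\<^esub> q'" by blast
    have c: "s z \<in> carrier ?F" "s z' \<in> carrier ?F" "q \<in> carrier ?F" "q' \<in> carrier ?F"
      using sc z z' q q' QE(1) by auto
    have "s z \<ominus>\<^bsub>?F\<^esub> s z' = q' \<ominus>\<^bsub>?F\<^esub> q" by (rule F.M.add_eq_imp_diff_eq[OF c(1,3,2,4) eq])
    then have "s z \<ominus>\<^bsub>?F\<^esub> s z' \<in> Q" using submodule_minus_mem[OF Fm sub(2) q' q] by simp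
    moreover have "s z \<ominus>\<^bsub>?F\<^esub> s z' \<in> N" by (rule submodule_minus_mem[OF Fm sub(1) sN[OF z] sN[OF z']])
    ultimately have "s z \<ominus>\<^bsub>?F\<^esub> s z' \<in> {\<zero>\<^bsub>?F\<^esub>}" unfolding NQ(1)[symmetric] by (intro IntI)
    then have "s z = s z'" using c by (simp add: F.M.diff_eq_zero_iff)
    then show "z' = z" using bij z z' by (auto simp: bij_betw_def inj_on_def)
  qed
  have "r \<in> module_maps R ?F P"
  proof (rule module_mapsI)
    fix x assume "x \<in> carrier ?F"
    then obtain z q where z: "z \<in> carrier P" "q \<in> Q" "x = s z \<oplus>\<^bsub>?F\<^esub> q" using ex by blast
    have c: "s z \<in> carrier ?F" "q \<in> carrier ?F" using sc z QE(1) by auto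
    show "r x \<in> carrier P" using z r_eq by simp
    {
      fix y assume "y \<in> carrier ?F"
      then obtain z' q' where z': "z' \<in> carrier P" "q' \<in> Q" "y = s z' \<oplus>\<^bsub>?F\<^esub> q'" using ex by blast
      have c': "s z' \<in> carrier ?F" "q' \<in> carrier ?F" using sc z' QE(1) by auto
      have "x \<oplus>\<^bsub>?F\<^esub> y = s (z \<oplus>\<^bsub>P\<^esub> z') \<oplus>\<^bsub>?F\<^esub> (q \<oplus>\<^bsub>?F\<^esub> q')"
        using z z' c c' by (simp add: module_maps_add[OF s] F.M.a_ac)
      then show "r (x \<oplus>\<^bsub>?F\<^esub> y) = r x \<oplus>\<^bsub>P\<^esub> r y"
        using z z' r_eq QE(5) by simp
    }
    fix a assume a: "a \<in> carrier R"
    have "a \<odot>\<^bsub>?F\<^esub> x = s (a \<odot>\<^bsub>P\<^esub> z) \<oplus>\<^bsub>?F\<^esub> a \<odot>\<^bsub>?F\<^esub> q"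
      using a z c by (simp add: module_maps_smult[OF s] F.smult_r_distr)
    then show "r (a \<odot>\<^bsub>?F\<^esub> x) = a \<odot>\<^bsub>P\<^esub> r x" using a z r_eq QE(4) by simp
  qed
  moreover have "r (s z) = z" if "z \<in> carrier P" for z
    using r_eq[OF that submodule_zero_mem[OF sub(2)]] sc[OF that] by simp
  ultimately show ?thesis using s by blast
qed

lemma projective_module_lift:
  fixes R (structure) and P :: "('a, 'b, 'p) module_scheme"
  assumes P: "is_projective_module R P" and N: "module R N" and L: "module R L"
    and p: "p \<in> module_maps R N L" and q: "q \<in> module_maps R P L"
    and sub: "\<And>z. z \<in> carrier P \<Longrightarrow> q z \<in> p ` carrier N"
  shows "\<exists>t\<in>module_maps R P N. \<forall>z\<in>carrier P. p (t z) = q z"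
proof -
  interpret N: module R N by fact
  obtain I :: "'b set" and s r where s: "s \<in> module_maps R P (free_module R I)" and r: "r \<in> module_maps R (free_module R I) P"
    and rs: "\<And>z. z \<in> carrier P \<Longrightarrow> r (s z) = z"
    using projective_module_retract[OF P] by blast
  have "\<exists>t\<in>module_maps R (free_module R I) N. \<forall>z\<in>carrier (free_module R I). p (t z) = q (r z)"
    by (rule N.R.free_module_lift[OF N L p module_maps_comp[OF r q]])
      (rule sub[OF module_maps_closed[OF r N.R.unit_vec_closed]])
  then obtain t where t: "t \<in> module_maps R (free_module R I) N"
    and pt: "\<forall>z\<in>carrier (free_module R I). p (t z) = q (r z)" by (rule bexE)
  have "\<forall>z\<in>carrier P. p (t (s z)) = q z" using pt rs module_maps_closed[OF s] by auto
  then show ?thesis using module_maps_comp[OF s t] by (intro bexI)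
qed

text \<open>The index type must be the type of the elements of \<open>M\<close>, as the definition of projectivity demands;
  \<open>finite_retract_of_free\<close> removes this restriction for finite rank.\<close>
lemma retract_of_free_is_projective:
  fixes R (structure) and M :: "('a, 'b, 'p) module_scheme" and I :: "'b set"
  assumes M: "module R M" and s: "s \<in> module_maps R M (free_module R I)"
    and p: "p \<in> module_maps R (free_module R I) M" and ps: "\<And>z. z \<in> carrier M \<Longrightarrow> p (s z) = z"
  shows "is_projective_module R M"
proof -
  let ?F = "free_module R I"
  interpret M: module R M by fact
  interpret F: module R ?F by (rule M.R.free_module_is_module)
  have Fm: "module R ?F" by (rule M.R.free_module_is_module)
  note sc = module_maps_closed[OF s] and pc = module_maps_closed[OF p]
  let ?N = "s ` carrier M" and ?Q = "{f \<in> carrier ?F. p f = \<zero>\<^bsub>M\<^esub>}"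
  have N: "submodule ?N R ?F" by (rule image_submodule[OF M Fm s])
  have Q: "submodule ?Q R ?F" by (rule kernel_submodule[OF Fm M p])
  have "?N \<inter> ?Q \<subseteq> {\<zero>\<^bsub>?F\<^esub>}" using ps module_maps_zero[OF M Fm s] by auto
  then have NQ: "?N \<inter> ?Q = {\<zero>\<^bsub>?F\<^esub>}" using submodule_zero_mem[OF N] submodule_zero_mem[OF Q] by blast
  have "?N <+>\<^bsub>?F\<^esub> ?Q = carrier ?F"
  proof
    show "?N <+>\<^bsub>?F\<^esub> ?Q \<subseteq> carrier ?F" using sc by (auto simp: set_add_def set_mult_def)
    show "carrier ?F \<subseteq> ?N <+>\<^bsub>?F\<^esub> ?Q"
    proof
      fix f assume f: "f \<in> carrier ?F"
      have spf: "s (p f) \<in> carrier ?F" using f pc sc by blast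
      have "f \<ominus>\<^bsub>?F\<^esub> s (p f) \<in> ?Q"
        using f spf ps pc by (simp add: module_maps_minus[OF Fm M p] M.M.diff_eq_zero_iff)
      moreover have "s (p f) \<in> ?N" using f pc by blast
      moreover have "f = s (p f) \<oplus>\<^bsub>?F\<^esub> (f \<ominus>\<^bsub>?F\<^esub> s (p f))"
        using f spf by (simp add: a_minus_def F.M.a_ac F.M.r_neg F.M.r_neg1 F.M.r_neg2)
      ultimately show "f \<in> ?N <+>\<^bsub>?F\<^esub> ?Q"
        unfolding set_add_def set_mult_def
        by (intro UN_I[of "s (p f)"] UN_I[of "f \<ominus>\<^bsub>?F\<^esub> s (p f)"]) simp_all
    qed
  qed
  moreover have "module_isomorphic R M (?F\<lparr>carrier := ?N\<rparr>)"
    unfolding module_isomorphic_def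
  proof (intro bexI[of _ s] module_maps_restrict[OF s])
    have "inj_on s (carrier M)" by (rule inj_on_inverseI[of _ p]) (use ps in blast)
    then show "bij_betw s (carrier M) (carrier (?F\<lparr>carrier := ?N\<rparr>))" by (simp add: inj_on_imp_bij_betw)
  qed auto
  ultimately show ?thesis
    unfolding is_projective_module_def Let_def using M N Q NQ by blast
qed

lemma finite_free_image_is_finite:
  fixes R (structure)
  assumes M: "module R M" and I: "finite I" and p: "p \<in> module_maps R (free_module R I) M"
    and onto: "carrier M \<subseteq> p ` carrier (free_module R I)"
  shows "is_finite_module R M"
proof -
  let ?F = "free_module R I"
  interpret M: module R M by fact
  have Fm: "module R ?F" by (rule M.R.free_module_is_module)
  let ?S = "(\<lambda>i. p (unit_vec R I i)) ` I"
  have "N = carrier M" if N: "submodule N R M" "?S \<subseteq> N" for N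
  proof
    show "N \<subseteq> carrier M" by (rule M.submoduleE(1)[OF N(1)])
    show "carrier M \<subseteq> N"
    proof
      fix z assume "z \<in> carrier M"
      then obtain f where f: "f \<in> carrier ?F" "z = p f" using onto by blast
      have "f \<in> {f \<in> carrier ?F. p f \<in> N}"
      proof (rule M.R.free_module_submodule_mem[OF vimage_submodule[OF Fm M p N(1)] f(1)])
        fix i assume i: "i \<in> I"
        note e = M.R.unit_vec_closed[OF i] and fi = free_module_coord[OF f(1) i]
        have "p (f i \<odot>\<^bsub>?F\<^esub> unit_vec R I i) \<in> N"
          unfolding module_maps_smult[OF p fi e] using M.submoduleE(4)[OF N(1) fi] N(2) i by blast
        then show "f i \<odot>\<^bsub>?F\<^esub> unit_vec R I i \<in> {f \<in> carrier ?F. p f \<in> N}"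
          using module.smult_closed[OF Fm fi e] by blast
      qed
      then show "z \<in> N" using f by blast
    qed
  qed
  moreover have "?S \<subseteq> carrier M" by (intro image_subsetI module_maps_closed[OF p] M.R.unit_vec_closed)
  moreover have "finite ?S" using I by simp
  ultimately show ?thesis unfolding is_finite_module_def using M by blast
qed

text \<open>To obtain an index set of the required type, the images of the unit vectors in \<open>M\<close> are used as
  indices.\<close>
lemma finite_retract_of_free:
  fixes R (structure) and M :: "('a, 'b, 'p) module_scheme" and I :: "'i set"
  assumes M: "module R M" and I: "finite I" and p: "p \<in> module_maps R (free_module R I) M"
    and s: "s \<in> module_maps R M (free_module R I)" and ps: "\<And>z. z \<in> carrier M \<Longrightarrow> p (s z) = z"
  shows "is_finite_module R M" "is_projective_module R M"
proof -
  let ?F = "free_module R I"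
  interpret M: module R M by fact
  note sc = module_maps_closed[OF s] and pc = module_maps_closed[OF p]
  show "is_finite_module R M"
  proof (rule finite_free_image_is_finite[OF M I p])
    show "carrier M \<subseteq> p ` carrier ?F" using ps sc by (metis image_eqI subsetI)
  qed
  define X where "X = (\<lambda>i. p (unit_vec R I i)) ` I"
  let ?G = "free_module R X"
  have Gm: "module R ?G" by (rule M.R.free_module_is_module)
  have XM: "x \<in> carrier M" if "x \<in> X" for x
    using that unfolding X_def by (elim imageE) (simp add: pc M.R.unit_vec_closed)
  obtain p' where p': "p' \<in> module_maps R ?G M" and p'x: "\<forall>x\<in>X. p' (unit_vec R X x) = x"
    by (rule bexE[OF M.R.free_module_map_exists[of M X "\<lambda>x. x", OF M XM]])
  have "\<exists>t\<in>module_maps R ?F ?G. \<forall>z\<in>carrier ?F. p' (t z) = p z"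
  proof (rule M.R.free_module_lift[OF Gm M p' p])
    fix i assume "i \<in> I"
    then have x: "p (unit_vec R I i) \<in> X" by (auto simp: X_def)
    show "p (unit_vec R I i) \<in> p' ` carrier ?G"
      by (rule image_eqI[OF _ M.R.unit_vec_closed[OF x]]) (use p'x x in simp)
  qed
  then obtain t where t: "t \<in> module_maps R ?F ?G" "\<forall>z\<in>carrier ?F. p' (t z) = p z" by (rule bexE)
  show "is_projective_module R M"
    by (rule retract_of_free_is_projective[OF M module_maps_comp[OF s t(1)] p'])
      (use t(2) sc ps in simp)
qed

section \<open>Comparing resolutions\<close>

text \<open>One step of the comparison theorem, in a form that can be iterated: the maps \<open>f\<close> and \<open>g\<close> relate the two
  resolutions in one degree, and \<open>h\<close> is a homotopy from \<open>g f\<close> to the identity that is only required on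
  boundaries, where the second term \<open>h d\<close> of the usual homotopy formula vanishes. Hence the data of a single
  degree determine those of the next one.\<close>
lemma comparison_step:
  fixes R (structure)
  assumes E0: "module R E0" and E2: "module R E2" and P0: "module R P0" and P1: "is_projective_module R P1"
    and d: "d \<in> module_maps R (free_module R I) E0" and d': "d' \<in> module_maps R E2 (free_module R I)"
    and exact: "d' ` carrier E2 = {z \<in> carrier (free_module R I). d z = \<zero>\<^bsub>E0\<^esub>}"
    and p: "p \<in> module_maps R P1 P0"
    and f: "f \<in> module_maps R E0 P0" and g: "g \<in> module_maps R P0 E0"
    and h: "h \<in> module_maps R E0 (free_module R I)"
    and fp: "\<And>w. w \<in> d ` carrier (free_module R I) \<Longrightarrow> f w \<in> p ` carrier P1"
    and gd: "\<And>w. w \<in> p ` carrier P1 \<Longrightarrow> g w \<in> d ` carrier (free_module R I)"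
    and homotopy: "\<And>w. w \<in> d ` carrier (free_module R I) \<Longrightarrow> w \<ominus>\<^bsub>E0\<^esub> g (f w) = d (h w)"
  shows "\<exists>f'\<in>module_maps R (free_module R I) P1. \<exists>g'\<in>module_maps R P1 (free_module R I).
    \<exists>h'\<in>module_maps R (free_module R I) E2.
      (\<forall>z\<in>carrier (free_module R I). p (f' z) = f (d z)) \<and>
      (\<forall>z\<in>carrier P1. d (g' z) = g (p z)) \<and>
      (\<forall>z\<in>carrier (free_module R I). d z = \<zero>\<^bsub>E0\<^esub> \<longrightarrow> z \<ominus>\<^bsub>free_module R I\<^esub> g' (f' z) = d' (h' z))"
proof -
  let ?F = "free_module R I"
  interpret E0: module R E0 by fact
  interpret E2: module R E2 by fact
  interpret F: module R ?F by (rule E0.R.free_module_is_module)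
  have Fm: "module R ?F" by (rule E0.R.free_module_is_module)
  have P1m: "module R P1" using P1 by (simp add: is_projective_module_def)
  note dc = module_maps_closed[OF d] and pc = module_maps_closed[OF p]
  have "\<exists>t\<in>module_maps R ?F P1. \<forall>z\<in>carrier ?F. p (t z) = f (d z)"
    by (rule E0.R.free_module_lift[OF P1m P0 p module_maps_comp[OF d f]])
      (rule fp[OF imageI[OF E0.R.unit_vec_closed]])
  then obtain f' where f': "f' \<in> module_maps R ?F P1" and pf': "\<forall>z\<in>carrier ?F. p (f' z) = f (d z)"
    by (rule bexE)
  have "\<exists>t\<in>module_maps R P1 ?F. \<forall>z\<in>carrier P1. d (t z) = g (p z)"
    by (rule projective_module_lift[OF P1 Fm E0 d module_maps_comp[OF p g]]) (rule gd[OF imageI])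
  then obtain g' where g': "g' \<in> module_maps R P1 ?F" and dg': "\<forall>z\<in>carrier P1. d (g' z) = g (p z)"
    by (rule bexE)
  \<comment> \<open>The part of the homotopy formula in the next degree that remains to be written as a boundary.\<close>
  define q where "q z = (z \<ominus>\<^bsub>?F\<^esub> g' (f' z)) \<ominus>\<^bsub>?F\<^esub> h (d z)" for z
  have q: "q \<in> module_maps R ?F ?F"
    unfolding q_def
    by (intro module_maps_diff module_maps_id module_maps_comp[OF f' g'] module_maps_comp[OF d h] Fm)
  have dq: "d (q z) = \<zero>\<^bsub>E0\<^esub>" if z: "z \<in> carrier ?F" for z
  proof -
    have c: "g' (f' z) \<in> carrier ?F" "h (d z) \<in> carrier ?F"
      using z module_maps_closed[OF f'] module_maps_closed[OF g'] dc module_maps_closed[OF h] by auto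
    have "d (q z) = (d z \<ominus>\<^bsub>E0\<^esub> d (g' (f' z))) \<ominus>\<^bsub>E0\<^esub> d (h (d z))"
      unfolding q_def using z c by (simp add: module_maps_minus[OF Fm E0 d])
    also have "d (g' (f' z)) = g (f (d z))" using dg' pf' z module_maps_closed[OF f'] by simp
    also have "d z \<ominus>\<^bsub>E0\<^esub> g (f (d z)) = d (h (d z))" by (rule homotopy[OF imageI[OF z]])
    finally show ?thesis using dc[OF c(2)] by (simp add: E0.M.diff_eq_zero_iff)
  qed
  have "\<exists>t\<in>module_maps R ?F E2. \<forall>z\<in>carrier ?F. d' (t z) = q z"
  proof (rule E0.R.free_module_lift[OF E2 Fm d' q])
    fix i assume "i \<in> I"
    then have e: "unit_vec R I i \<in> carrier ?F" by (rule E0.R.unit_vec_closed)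
    show "q (unit_vec R I i) \<in> d' ` carrier E2"
      unfolding exact using dq[OF e] module_maps_closed[OF q e] by simp
  qed
  then obtain h' where h': "h' \<in> module_maps R ?F E2" and dh': "\<forall>z\<in>carrier ?F. d' (h' z) = q z" by (rule bexE)
  have "z \<ominus>\<^bsub>?F\<^esub> g' (f' z) = d' (h' z)" if z: "z \<in> carrier ?F" "d z = \<zero>\<^bsub>E0\<^esub>" for z
  proof -
    have "z \<ominus>\<^bsub>?F\<^esub> g' (f' z) \<in> carrier ?F"
      using z(1) module_maps_closed[OF f'] module_maps_closed[OF g'] by simp
    then show ?thesis
      using dh' z module_maps_zero[OF E0 Fm h] unfolding q_def by (simp add: F.M.diff_zero)
  qed
  then show ?thesis using f' g' h' pf' dg' by (intro bexI[OF _ f'] bexI[OF _ g'] bexI[OF _ h']) simp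
qed

text \<open>The free resolution is constructed along the induction on the distance \<open>l\<close> to a degree in which \<open>P\<close> vanishes.
  On the way out the comparison maps are extended by one degree, and on the way back the
  splitting is carried down by \<open>splitting_descends\<close>.\<close>
lemma resolution_differential_splits:
  fixes R (structure) and P :: "nat \<Rightarrow> ('a, 'c) module"
  assumes dom: "noetherian_domain R"
    and wit: "\<And>\<mm>. maximalideal \<mm> R \<Longrightarrow> \<exists>x y s. depth_two_witness R \<mm> x y s"
    and proj: "\<And>i. is_projective_module R (P i)"
    and dP: "\<And>i. dP i \<in> module_maps R (P (Suc i)) (P i)"
    and exact: "\<And>i. dP (Suc i) ` carrier (P (Suc (Suc i))) = {z \<in> carrier (P (Suc i)). dP i z = \<zero>\<^bsub>P i\<^esub>}"
    and vanish: "carrier (P (i + l)) = {\<zero>\<^bsub>P (i + l)\<^esub>}"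
    and d: "d \<in> module_maps R (free_module R {..<k1::nat}) (free_module R {..<k0::nat})"
    and K: "depth_two_cokernel R {..<k0} (d ` carrier (free_module R {..<k1}))"
    and f: "f \<in> module_maps R (free_module R {..<k0}) (P i)"
    and g: "g \<in> module_maps R (P i) (free_module R {..<k0})"
    and h: "h \<in> module_maps R (free_module R {..<k0}) (free_module R {..<k1})"
    and fp: "\<And>w. w \<in> d ` carrier (free_module R {..<k1}) \<Longrightarrow> f w \<in> dP i ` carrier (P (Suc i))"
    and gd: "\<And>w. w \<in> dP i ` carrier (P (Suc i)) \<Longrightarrow> g w \<in> d ` carrier (free_module R {..<k1})"
    and homotopy: "\<And>w. w \<in> d ` carrier (free_module R {..<k1}) \<Longrightarrow>
      w \<ominus>\<^bsub>free_module R {..<k0}\<^esub> g (f w) = d (h w)"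
  shows "\<exists>\<tau>\<in>module_maps R (free_module R {..<k0}) (free_module R {..<k1}).
    \<forall>z\<in>carrier (free_module R {..<k1}). d (\<tau> (d z)) = d z"
  using vanish d K f g h fp gd homotopy
proof (induction l arbitrary: i d f g h k0 k1)
  case 0
  interpret noetherian_domain R by fact
  let ?E = "free_module R {..<k0}" and ?F = "free_module R {..<k1}"
  have Em: "module R ?E" by (rule free_module_is_module)
  interpret E: module R ?E by (rule Em)
  have Pm: "module R (P i)" using proj by (simp add: is_projective_module_def)
  have "d (h (d z)) = d z" if z: "z \<in> carrier ?F" for z
  proof -
    have dz: "d z \<in> carrier ?E" using module_maps_closed[OF 0(2) z] .
    then have "f (d z) = \<zero>\<^bsub>P i\<^esub>" using 0(1) module_maps_closed[OF 0(4)] by auto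
    then have "g (f (d z)) = \<zero>\<^bsub>?E\<^esub>" using module_maps_zero[OF Pm Em 0(5)] by simp
    then have "d z \<ominus>\<^bsub>?E\<^esub> g (f (d z)) = d z" using dz by (simp add: E.M.diff_zero)
    with 0(9)[OF imageI[OF z]] show ?thesis by (rule trans[OF sym])
  qed
  then show ?case using 0(6) by (intro bexI[of _ h]) simp_all
next
  case (Suc l)
  interpret noetherian_domain R by fact
  let ?E = "free_module R {..<k0}" and ?F = "free_module R {..<k1}"
  have Em: "module R ?E" and Fm: "module R ?F" by (rule free_module_is_module)+
  have Pm: "module R (P j)" for j using proj by (simp add: is_projective_module_def)
  note d = Suc.prems(2) and K = Suc.prems(3)
  have dom': "domain R" by (rule domain_axioms)
  let ?Z = "{z \<in> carrier ?F. d z = \<zero>\<^bsub>?E\<^esub>}"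
  obtain k2 :: nat and d' where d': "d' \<in> module_maps R (free_module R {..<k2}) ?F"
    and ex: "d' ` carrier (free_module R {..<k2}) = ?Z"
    using free_submodule_cover[OF noetherian_ring_axioms is_cring finite_lessThan kernel_submodule[OF Fm Em d]]
    by blast
  let ?G = "free_module R {..<k2}"
  have Gm: "module R ?G" by (rule free_module_is_module)
  obtain f' g' h' where f': "f' \<in> module_maps R ?F (P (Suc i))" and g': "g' \<in> module_maps R (P (Suc i)) ?F"
    and h': "h' \<in> module_maps R ?F ?G"
    and pf': "\<And>z. z \<in> carrier ?F \<Longrightarrow> dP i (f' z) = f (d z)"
    and dg': "\<And>z. z \<in> carrier (P (Suc i)) \<Longrightarrow> d (g' z) = g (dP i z)"
    and hom': "\<And>z. z \<in> carrier ?F \<Longrightarrow> d z = \<zero>\<^bsub>?E\<^esub> \<Longrightarrow> z \<ominus>\<^bsub>?F\<^esub> g' (f' z) = d' (h' z)"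
    using comparison_step[where d = d and d' = d' and p = "dP i" and f = f and g = g and h = h, OF Em Gm Pm proj d d' ex dP Suc.prems(4-9)] by blast
  have K': "depth_two_cokernel R {..<k1} (d' ` carrier ?G)"
    unfolding ex
    by (rule kernel_depth_two_cokernel[OF dom' d depth_two_submodule_of_cokernel[OF dom' finite_lessThan K]])
  have "\<exists>\<tau>\<in>module_maps R ?F ?G. \<forall>z\<in>carrier ?G. d' (\<tau> (d' z)) = d' z"
  proof (rule Suc.IH[OF _ d' K' f' g' h'])
    show "carrier (P (Suc i + l)) = {\<zero>\<^bsub>P (Suc i + l)\<^esub>}" using Suc.prems(1) by simp
    show "f' w \<in> dP (Suc i) ` carrier (P (Suc (Suc i)))" if "w \<in> d' ` carrier ?G" for w
    proof -
      have w: "w \<in> carrier ?F" "d w = \<zero>\<^bsub>?E\<^esub>" using that unfolding ex by auto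
      then have "dP i (f' w) = \<zero>\<^bsub>P i\<^esub>" using pf' module_maps_zero[OF Em Pm Suc.prems(4)] by simp
      then show ?thesis unfolding exact using module_maps_closed[OF f' w(1)] by simp
    qed
    show "g' w \<in> d' ` carrier ?G" if "w \<in> dP (Suc i) ` carrier (P (Suc (Suc i)))" for w
    proof -
      have w: "w \<in> carrier (P (Suc i))" "dP i w = \<zero>\<^bsub>P i\<^esub>" using that unfolding exact by auto
      then have "d (g' w) = \<zero>\<^bsub>?E\<^esub>" using dg' module_maps_zero[OF Pm Em Suc.prems(5)] by simp
      then show ?thesis unfolding ex using module_maps_closed[OF g' w(1)] by simp
    qed
    show "w \<ominus>\<^bsub>?F\<^esub> g' (f' w) = d' (h' w)" if "w \<in> d' ` carrier ?G" for w
      using that hom' unfolding ex by simp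
  qed
  then obtain \<sigma> where \<sigma>: "\<sigma> \<in> module_maps R ?F ?G" "\<And>z. z \<in> carrier ?G \<Longrightarrow> d' (\<sigma> (d' z)) = d' z" by blast
  show ?case
  proof (rule splitting_descends[where A = d' and B = d and \<sigma> = \<sigma> and I' = "{..<k2}"])
    show "\<exists>x y s. depth_two_witness R \<mm> x y s" if "maximalideal \<mm> R" for \<mm>
      using wit[OF that] .
    show "d' (\<sigma> (d' z)) = d' z" if "z \<in> carrier ?G" for z
      using \<sigma>(2)[OF that] .
  qed (rule dom finite_lessThan d' d ex K \<sigma>(1))+
qed

text \<open>The projection \<open>1 - d \<tau>\<close> annihilates the kernel of \<open>\<epsilon>\<close>, so it factors through \<open>M\<close>.\<close>
lemma section_of_split_presentation:
  fixes R (structure)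
  assumes M: "module R M" and F: "module R F" and E: "module R E"
    and \<epsilon>: "\<epsilon> \<in> module_maps R F M" and onto: "\<epsilon> ` carrier F = carrier M"
    and d: "d \<in> module_maps R E F" and exact: "d ` carrier E = {z \<in> carrier F. \<epsilon> z = \<zero>\<^bsub>M\<^esub>}"
    and \<tau>: "\<tau> \<in> module_maps R F E" and split: "\<And>z. z \<in> carrier E \<Longrightarrow> d (\<tau> (d z)) = d z"
  shows "\<exists>\<sigma>\<in>module_maps R M F. \<forall>m\<in>carrier M. \<epsilon> (\<sigma> m) = m"
proof -
  interpret M: module R M by fact
  interpret F: module R F by fact
  note \<epsilon>c = module_maps_closed[OF \<epsilon>] and dc = module_maps_closed[OF d] and \<tau>c = module_maps_closed[OF \<tau>]
  define P where "P z = z \<ominus>\<^bsub>F\<^esub> d (\<tau> z)" for z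
  have P: "P \<in> module_maps R F F"
    unfolding P_def by (intro module_maps_diff module_maps_id module_maps_comp[OF \<tau> d] F)
  have P_ker: "P z = \<zero>\<^bsub>F\<^esub>" if z: "z \<in> carrier F" "\<epsilon> z = \<zero>\<^bsub>M\<^esub>" for z
  proof -
    have "z \<in> d ` carrier E" unfolding exact using z by simp
    then obtain e where "e \<in> carrier E" "z = d e" by blast
    then show ?thesis unfolding P_def using split[of e] dc by (simp add: F.M.diff_eq_zero_iff)
  qed
  have \<epsilon>d: "\<epsilon> (d e) = \<zero>\<^bsub>M\<^esub>" if "e \<in> carrier E" for e using exact that by blast
  have \<epsilon>P: "\<epsilon> (P z) = \<epsilon> z" if z: "z \<in> carrier F" for z
  proof -
    have "\<epsilon> (P z) = \<epsilon> z \<ominus>\<^bsub>M\<^esub> \<zero>\<^bsub>M\<^esub>"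
      unfolding P_def using z \<tau>c dc \<epsilon>d by (simp add: module_maps_minus[OF F M \<epsilon>])
    then show ?thesis using \<epsilon>c[OF z] by (simp add: M.M.diff_zero)
  qed
  define \<sigma> where "\<sigma> m = P (inv_into (carrier F) \<epsilon> m)" for m
  have \<sigma>_eq: "\<sigma> (\<epsilon> z) = P z" if z: "z \<in> carrier F" for z
  proof -
    let ?w = "inv_into (carrier F) \<epsilon> (\<epsilon> z)"
    have w: "?w \<in> carrier F" "\<epsilon> ?w = \<epsilon> z"
      using z by (auto intro: inv_into_into f_inv_into_f)
    then have "P (?w \<ominus>\<^bsub>F\<^esub> z) = \<zero>\<^bsub>F\<^esub>"
      using z \<epsilon>c by (intro P_ker) (simp_all add: module_maps_minus[OF F M \<epsilon>] M.M.diff_eq_zero_iff)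
    then show ?thesis
      unfolding \<sigma>_def using w z module_maps_closed[OF P] by (simp add: module_maps_minus[OF F F P] F.M.diff_eq_zero_iff)
  qed
  have ex: "\<exists>z\<in>carrier F. m = \<epsilon> z" if "m \<in> carrier M" for m using that onto by blast
  have "\<sigma> \<in> module_maps R M F"
  proof (rule module_mapsI)
    fix m assume "m \<in> carrier M"
    then obtain z where z: "z \<in> carrier F" "m = \<epsilon> z" using ex by blast
    show "\<sigma> m \<in> carrier F" using z \<sigma>_eq module_maps_closed[OF P] by simp
    {
      fix m' assume "m' \<in> carrier M"
      then obtain z' where z': "z' \<in> carrier F" "m' = \<epsilon> z'" using ex by blast
      have "m \<oplus>\<^bsub>M\<^esub> m' = \<epsilon> (z \<oplus>\<^bsub>F\<^esub> z')" using z z' module_maps_add[OF \<epsilon>] by simp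
      then show "\<sigma> (m \<oplus>\<^bsub>M\<^esub> m') = \<sigma> m \<oplus>\<^bsub>F\<^esub> \<sigma> m'" using z z' \<sigma>_eq module_maps_add[OF P] by simp
    }
    fix a assume a: "a \<in> carrier R"
    have "a \<odot>\<^bsub>M\<^esub> m = \<epsilon> (a \<odot>\<^bsub>F\<^esub> z)" using z a module_maps_smult[OF \<epsilon>] by simp
    then show "\<sigma> (a \<odot>\<^bsub>M\<^esub> m) = a \<odot>\<^bsub>F\<^esub> \<sigma> m" using z a \<sigma>_eq module_maps_smult[OF P] by simp
  qed
  moreover have "\<epsilon> (\<sigma> m) = m" if m: "m \<in> carrier M" for m
  proof -
    obtain z where "z \<in> carrier F" "m = \<epsilon> z" using ex[OF m] by blast
    then show ?thesis using \<sigma>_eq \<epsilon>P by simp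
  qed
  ultimately show ?thesis by blast
qed

section \<open>Change of the index set\<close>

lemma free_module_reindex:
  fixes R (structure)
  assumes "cring R" and c: "bij_betw c I' I"
  shows "\<exists>h\<in>module_maps R (free_module R I) (free_module R I').
    bij_betw h (carrier (free_module R I)) (carrier (free_module R I'))"
proof -
  interpret cring R by fact
  define h where "h f = (\<lambda>x\<in>I'. f (c x))" for f :: "_ \<Rightarrow> 'a"
  let ?c' = "inv_into I' c"
  define h' where "h' f = (\<lambda>x\<in>I. f (?c' x))" for f :: "_ \<Rightarrow> 'a"
  have supp: "(\<lambda>x\<in>A. f (b x)) \<in> carrier (free_module R A)"
    if f: "f \<in> carrier (free_module R B)" and b: "bij_betw b A B" for f and b and A B
  proof -
    have "{x \<in> A. f (b x) \<noteq> \<zero>} \<subseteq> A" "b ` {x \<in> A. f (b x) \<noteq> \<zero>} \<subseteq> {i \<in> B. f i \<noteq> \<zero>}"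
      using b by (auto simp: bij_betw_def)
    moreover have "finite {i \<in> B. f i \<noteq> \<zero>}" using f by (simp add: free_module_def)
    ultimately have "finite {x \<in> A. f (b x) \<noteq> \<zero>}"
      using b by (meson bij_betw_def finite_imageD finite_subset inj_on_subset)
    moreover have "{x \<in> A. (\<lambda>x\<in>A. f (b x)) x \<noteq> \<zero>} = {x \<in> A. f (b x) \<noteq> \<zero>}" by auto
    moreover have "b x \<in> B" if "x \<in> A" for x using b that by (auto simp: bij_betw_def)
    ultimately show ?thesis using f by (auto simp: free_module_def)
  qed
  have c': "bij_betw ?c' I I'" by (rule bij_betw_inv_into[OF c])
  have cI: "c x \<in> I" if "x \<in> I'" for x using c that by (auto simp: bij_betw_def)
  have c'I: "?c' x \<in> I'" if "x \<in> I" for x using c' that by (auto simp: bij_betw_def)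
  have hc: "h f \<in> carrier (free_module R I')" if "f \<in> carrier (free_module R I)" for f
    unfolding h_def by (rule supp[OF that c])
  have hc': "h' f \<in> carrier (free_module R I)" if "f \<in> carrier (free_module R I')" for f
    unfolding h'_def by (rule supp[OF that c'])
  have "h \<in> module_maps R (free_module R I) (free_module R I')"
    by (rule module_mapsI) (use hc cI in \<open>auto simp: h_def free_module_def\<close>)
  moreover have "bij_betw h (carrier (free_module R I)) (carrier (free_module R I'))"
  proof (rule bij_betw_byWitness[of _ h'])
    show "\<forall>f\<in>carrier (free_module R I). h' (h f) = f"
    proof
      fix f assume f: "f \<in> carrier (free_module R I)"
      show "h' (h f) = f"
        by (rule free_module_ext[OF hc'[OF hc[OF f]] f])
          (use c'I bij_betw_inv_into_right[OF c] in \<open>simp add: h_def h'_def\<close>)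
    qed
    show "\<forall>f\<in>carrier (free_module R I'). h (h' f) = f"
    proof
      fix f assume f: "f \<in> carrier (free_module R I')"
      show "h (h' f) = f"
        by (rule free_module_ext[OF hc[OF hc'[OF f]] f])
          (use cI bij_betw_inv_into_left[OF c] in \<open>simp add: h_def h'_def\<close>)
    qed
  qed (use hc hc' in auto)
  ultimately show ?thesis by blast
qed

text \<open>The index type is arbitrary here: the preimages in \<open>M\<close> of the unit vectors are pairwise distinct if
  \<open>1 \<noteq> 0\<close>, and serve as indices of the type that the definition of freeness demands.\<close>
lemma is_free_moduleI:
  fixes R (structure) and M :: "('a, 'b, 'p) module_scheme" and I :: "'i set"
  assumes M: "module R M" and nontrivial: "\<one> \<noteq> \<zero>"
    and h: "h \<in> module_maps R M (free_module R I)" and bij: "bij_betw h (carrier M) (carrier (free_module R I))"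
  shows "is_free_module R M"
proof -
  interpret M: module R M by fact
  define b where "b i = inv_into (carrier M) h (unit_vec R I i)" for i
  have hb: "h (b i) = unit_vec R I i" if "i \<in> I" for i
    unfolding b_def using bij_betw_inv_into_right[OF bij M.R.unit_vec_closed[OF that]] .
  have "inj_on b I"
  proof (rule inj_onI)
    fix i j assume ij: "i \<in> I" "j \<in> I" "b i = b j"
    then have "unit_vec R I i i = unit_vec R I j i" using hb by metis
    then show "i = j" using ij nontrivial by (auto simp: unit_vec_def split: if_splits)
  qed
  then have "bij_betw (inv_into I b) (b ` I) I" by (intro bij_betw_inv_into inj_on_imp_bij_betw)
  then obtain r where r: "r \<in> module_maps R (free_module R I) (free_module R (b ` I))"
    and rb: "bij_betw r (carrier (free_module R I)) (carrier (free_module R (b ` I)))"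
    using free_module_reindex[OF M.R.is_cring] by blast
  have "bij_betw (\<lambda>x. r (h x)) (carrier M) (carrier (free_module R (b ` I)))"
    using bij_betw_trans[OF bij rb] by (simp add: comp_def)
  then show ?thesis
    unfolding is_free_module_def module_isomorphic_def using M module_maps_comp[OF h r] by blast
qed

section \<open>Splines\<close>

text \<open>The relation \<open>x n + y n' = 0\<close> between splines holds for the values at each vertex and, after cancelling the
  generator of the label, for the cofactors at each edge. Dividing all of these by \<open>x\<close> near \<open>\<mm>\<close> yields the
  values of the quotient together with the cofactors that show that it is a spline.\<close>
lemma spline_module_depth_two:
  fixes R :: "('a, 'm) ring_scheme" (structure)
    and V :: "'v set" and E :: "'e set" and ends :: "'e \<Rightarrow> 'v set" and \<alpha> :: "'e \<Rightarrow> 'a set"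
  assumes dom: "domain R" and graph: "edge_labeled_graph R V E ends \<alpha>"
    and principal: "\<And>e. e \<in> E \<Longrightarrow> principalideal (\<alpha> e) R \<and> \<alpha> e \<noteq> {\<zero>}"
  shows "depth_two_submodule R V (carrier (spline_module R V E ends \<alpha>))"
  unfolding depth_two_submodule_def
proof (intro allI impI ballI)
  let ?F = "free_module R V"
  let ?N = "carrier (spline_module R V E ends \<alpha>)"
  interpret domain R by fact
  interpret G: edge_labeled_graph R V E ends \<alpha> by fact
  interpret F: module R ?F by (rule free_module_is_module)
  have N_iff: "r \<in> ?N \<longleftrightarrow> r \<in> carrier ?F \<and> (\<forall>e\<in>E. \<forall>p q. ends e = {p, q} \<longrightarrow> r p \<ominus> r q \<in> \<alpha> e)" for r
    by (simp add: spline_module_def)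
  have endsV: "p \<in> V" "q \<in> V" if "e \<in> E" "ends e = {p, q}" for e p q
    using G.ends[OF that(1)] that(2) by (auto simp: doubleton_eq_iff)
  have "\<exists>a\<in>carrier R. a \<noteq> \<zero> \<and> \<alpha> e = PIdl a" if e: "e \<in> E" for e
  proof -
    obtain a where a: "a \<in> carrier R" "\<alpha> e = Idl {a}"
      using principal[OF e] unfolding principalideal_def principalideal_axioms_def by blast
    then have "a \<noteq> \<zero>" using principal[OF e] genideal_zero by auto
    then show ?thesis using a cgenideal_eq_genideal[OF a(1)] by auto
  qed
  then obtain gen where gen: "\<And>e. e \<in> E \<Longrightarrow> gen e \<in> carrier R" "\<And>e. e \<in> E \<Longrightarrow> gen e \<noteq> \<zero>"
    "\<And>e. e \<in> E \<Longrightarrow> \<alpha> e = PIdl (gen e)" by metis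
  fix \<mm> x y s n n'
  assume m: "maximalideal \<mm> R" and w: "depth_two_witness R \<mm> x y s"
    and n: "n \<in> ?N" and n': "n' \<in> ?N" and rel: "x \<odot>\<^bsub>?F\<^esub> n \<oplus>\<^bsub>?F\<^esub> y \<odot>\<^bsub>?F\<^esub> n' = \<zero>\<^bsub>?F\<^esub>"
  have xy: "x \<in> carrier R" "y \<in> carrier R" "x \<noteq> \<zero>" using w by (auto simp: depth_two_witness_def)
  have mp: "primeideal \<mm> R" by (rule maximalideal_prime[OF m])
  have nV: "n v \<in> carrier R" "n' v \<in> carrier R" if "v \<in> V" for v
    using free_module_coord[OF _ that] n n' unfolding N_iff by metis+
  have relV: "x \<otimes> n v \<oplus> y \<otimes> n' v = \<zero>" if "v \<in> V" for v
    using arg_cong[OF rel, of "\<lambda>f. f v"] that by (simp add: free_module_apply)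
  have "\<exists>u\<in>carrier R - \<mm>. \<forall>v\<in>V. \<exists>c\<in>carrier R. u \<otimes> n' v = x \<otimes> c"
    by (rule depth_two_witness_vector[where f = n, OF dom m w G.finite_V nV relV])
  then obtain u c where u: "u \<in> carrier R - \<mm>"
    and c: "\<And>v. v \<in> V \<Longrightarrow> c v \<in> carrier R" "\<And>v. v \<in> V \<Longrightarrow> u \<otimes> n' v = x \<otimes> c v"
    by metis
  \<comment> \<open>Edges with an order of their endpoints, since the edge condition is stated for both orders.\<close>
  define T where "T = {(e, p, q). e \<in> E \<and> ends e = {p, q}}"
  have "T \<subseteq> E \<times> V \<times> V" using endsV by (auto simp: T_def)
  then have finT: "finite T"
    by (rule finite_subset) (simp add: G.finite_E G.finite_V)
  have T: "fst t \<in> E" "ends (fst t) = {fst (snd t), snd (snd t)}" if "t \<in> T" for t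
    using that by (auto simp: T_def)
  have TV: "fst (snd t) \<in> V" "snd (snd t) \<in> V" if "t \<in> T" for t
    using endsV[OF T(1)[OF that] T(2)[OF that]] by auto
  have quot: "\<exists>k. \<forall>t\<in>T. k t \<in> carrier R \<and> r (fst (snd t)) \<ominus> r (snd (snd t)) = k t \<otimes> gen (fst t)"
    if r: "r \<in> ?N" for r
  proof (rule bchoice, rule ballI)
    fix t assume t: "t \<in> T"
    have "r (fst (snd t)) \<ominus> r (snd (snd t)) \<in> PIdl (gen (fst t))"
      using r T[OF t] gen(3)[OF T(1)[OF t]] unfolding N_iff by auto
    then show "\<exists>k. k \<in> carrier R \<and> r (fst (snd t)) \<ominus> r (snd (snd t)) = k \<otimes> gen (fst t)"
      unfolding cgenideal_def by blast
  qed
  obtain k where k: "\<And>t. t \<in> T \<Longrightarrow> k t \<in> carrier R"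
    "\<And>t. t \<in> T \<Longrightarrow> n (fst (snd t)) \<ominus> n (snd (snd t)) = k t \<otimes> gen (fst t)" using quot[OF n] by blast
  obtain k' where k': "\<And>t. t \<in> T \<Longrightarrow> k' t \<in> carrier R"
    "\<And>t. t \<in> T \<Longrightarrow> n' (fst (snd t)) \<ominus> n' (snd (snd t)) = k' t \<otimes> gen (fst t)" using quot[OF n'] by blast
  have relT: "x \<otimes> k t \<oplus> y \<otimes> k' t = \<zero>" if t: "t \<in> T" for t
  proof -
    note gt = gen(1,2)[OF T(1)[OF t]]
    note nc = nV[OF TV(1)[OF t]] nV[OF TV(2)[OF t]]
    have "(x \<otimes> k t \<oplus> y \<otimes> k' t) \<otimes> gen (fst t) = x \<otimes> (k t \<otimes> gen (fst t)) \<oplus> y \<otimes> (k' t \<otimes> gen (fst t))"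
      using xy(1,2) k(1)[OF t] k'(1)[OF t] gt(1) by algebra
    also have "\<dots> = (x \<otimes> n (fst (snd t)) \<oplus> y \<otimes> n' (fst (snd t))) \<ominus> (x \<otimes> n (snd (snd t)) \<oplus> y \<otimes> n' (snd (snd t)))"
      unfolding k(2)[OF t, symmetric] k'(2)[OF t, symmetric] using xy(1,2) nc by algebra
    also have "\<dots> = \<zero>" using relV TV[OF t] by (simp add: minus_eq)
    finally show ?thesis using gt k(1)[OF t] k'(1)[OF t] xy by (simp add: integral_iff)
  qed
  have "\<exists>u'\<in>carrier R - \<mm>. \<forall>t\<in>T. \<exists>c'\<in>carrier R. u' \<otimes> k' t = x \<otimes> c'"
    by (rule depth_two_witness_vector[where f = k, OF dom m w finT k(1) k'(1) relT])
  then obtain u' c' where u': "u' \<in> carrier R - \<mm>"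
    and c': "\<And>t. t \<in> T \<Longrightarrow> c' t \<in> carrier R" "\<And>t. t \<in> T \<Longrightarrow> u' \<otimes> k' t = x \<otimes> c' t"
    by metis
  have uc: "u \<in> carrier R" "u' \<in> carrier R" using u u' by auto
  define g where "g = (\<lambda>v\<in>V. u' \<otimes> c v)"
  have gF: "g \<in> carrier ?F" using c uc by (auto simp: g_def free_module_carrier_finite[OF G.finite_V])
  have xg: "(u \<otimes> u') \<otimes> n' v = x \<otimes> g v" if v: "v \<in> V" for v
  proof -
    have "(u \<otimes> u') \<otimes> n' v = u' \<otimes> (u \<otimes> n' v)" using uc nV[OF v] by algebra
    also have "\<dots> = x \<otimes> (u' \<otimes> c v)" unfolding c(2)[OF v] using uc xy(1) c(1)[OF v] by algebra
    finally show ?thesis using v by (simp add: g_def)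
  qed
  have "g p \<ominus> g q \<in> \<alpha> e" if e: "e \<in> E" "ends e = {p, q}" for e p q
  proof -
    have t: "(e, p, q) \<in> T" using e by (simp add: T_def)
    note pq = endsV[OF e]
    note co = free_module_coord[OF gF pq(1)] free_module_coord[OF gF pq(2)] gen(1)[OF e(1)]
      k'(1)[OF t] c'(1)[OF t] nV(2)[OF pq(1)] nV(2)[OF pq(2)]
    have "x \<otimes> (g p \<ominus> g q) = x \<otimes> g p \<ominus> x \<otimes> g q" using xy(1) co by algebra
    also have "\<dots> = (u \<otimes> u') \<otimes> (n' p \<ominus> n' q)"
      unfolding xg[OF pq(1), symmetric] xg[OF pq(2), symmetric] using uc co by algebra
    also have "\<dots> = u \<otimes> (u' \<otimes> k' (e, p, q)) \<otimes> gen e"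
      using k'(2)[OF t] uc co by (simp add: m_assoc)
    also have "\<dots> = x \<otimes> ((u \<otimes> c' (e, p, q)) \<otimes> gen e)"
      unfolding c'(2)[OF t] using uc xy(1) co by algebra
    finally have "g p \<ominus> g q = (u \<otimes> c' (e, p, q)) \<otimes> gen e"
      using xy uc co by (subst (asm) m_lcancel) auto
    moreover have "u \<otimes> c' (e, p, q) \<in> carrier R" using uc co by simp
    ultimately show ?thesis unfolding gen(3)[OF e(1)] cgenideal_def by blast
  qed
  then have "g \<in> ?N" unfolding N_iff using gF by blast
  moreover have "(u \<otimes> u') \<odot>\<^bsub>?F\<^esub> n' = x \<odot>\<^bsub>?F\<^esub> g"
  proof (rule free_module_ext[of _ R V])
    show "((u \<otimes> u') \<odot>\<^bsub>?F\<^esub> n') v = (x \<odot>\<^bsub>?F\<^esub> g) v" if "v \<in> V" for v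
      using xg[OF that] that by (simp add: free_module_apply)
  qed (use uc xy gF n' in \<open>simp_all add: N_iff\<close>)
  moreover have "u \<otimes> u' \<in> carrier R - \<mm>" using u u' primeideal.I_prime[OF mp, of u u'] by auto
  ultimately show "\<exists>u\<in>carrier R - \<mm>. \<exists>g\<in>?N. u \<odot>\<^bsub>?F\<^esub> n' = x \<odot>\<^bsub>?F\<^esub> g" by blast
qed

text \<open>The hypothesis on finite projective modules concerns modules whose elements have type \<open>nat \<Rightarrow> 'a\<close>, so it is applied to
  the image of \<open>M\<close> in \<open>R\<^sup>k\<close>.\<close>
lemma finite_retract_is_free:
  fixes R (structure) and M :: "('a, 'b, 'p) module_scheme"
  assumes M: "module R M" and nontrivial: "\<one> \<noteq> \<zero>"
    and \<epsilon>: "\<epsilon> \<in> module_maps R (free_module R {..<k::nat}) M"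
    and \<sigma>: "\<sigma> \<in> module_maps R M (free_module R {..<k})" and \<epsilon>\<sigma>: "\<And>m. m \<in> carrier M \<Longrightarrow> \<epsilon> (\<sigma> m) = m"
    and free: "all_finite_projectives_free R"
  shows "is_free_module R M"
proof -
  let ?F = "free_module R {..<k}"
  interpret M: module R M by fact
  have Fm: "module R ?F" by (rule M.R.free_module_is_module)
  interpret F: module R ?F by (rule Fm)
  let ?N = "\<sigma> ` carrier M"
  have N: "submodule ?N R ?F" by (rule image_submodule[OF M Fm \<sigma>])
  have NF: "?N \<subseteq> carrier ?F" by (rule F.submoduleE(1)[OF N])
  let ?P = "?F\<lparr>carrier := ?N\<rparr>"
  have Pm: "module R ?P" by (rule submodule.submodule_is_module[OF N Fm])
  have p: "(\<lambda>z. \<sigma> (\<epsilon> z)) \<in> module_maps R ?F ?P"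
    by (rule module_maps_restrict[OF module_maps_comp[OF \<epsilon> \<sigma>]]) (use module_maps_closed[OF \<epsilon>] in blast)
  have s: "(\<lambda>z. z) \<in> module_maps R ?P ?F" by (rule module_mapsI) (use NF in auto)
  have ps: "\<sigma> (\<epsilon> z) = z" if "z \<in> carrier ?P" for z using that \<epsilon>\<sigma> by auto
  have "is_free_module R ?P"
    using finite_retract_of_free[OF Pm finite_lessThan p s ps] free unfolding all_finite_projectives_free_def by blast
  then obtain I :: "(nat \<Rightarrow> 'a) set" and h where h: "h \<in> module_maps R ?P (free_module R I)"
    and hb: "bij_betw h ?N (carrier (free_module R I))"
    by (auto simp: is_free_module_def module_isomorphic_def)
  have \<sigma>P: "\<sigma> \<in> module_maps R M ?P" by (rule module_maps_restrict[OF \<sigma>]) blast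
  have "inj_on \<sigma> (carrier M)" by (rule inj_on_inverseI[of _ \<epsilon>]) (rule \<epsilon>\<sigma>)
  then have "bij_betw \<sigma> (carrier M) ?N" by (rule inj_on_imp_bij_betw)
  then have "bij_betw (\<lambda>m. h (\<sigma> m)) (carrier M) (carrier (free_module R I))"
    using bij_betw_trans[OF _ hb] by (simp add: comp_def)
  then show ?thesis by (rule is_free_moduleI[OF M nontrivial module_maps_comp[OF \<sigma>P h]])
qed

theorem theorem4p1:
  fixes R :: "('a, 'm) ring_scheme"
    and V :: "'v set" and E :: "'e set" and ends :: "'e \<Rightarrow> 'v set" and \<alpha> :: "'e \<Rightarrow> 'a set"
  assumes "noetherian_domain R"
    and "cohen_macaulay R"
    and "\<And>\<mm>. maximalideal \<mm> R \<Longrightarrow> krull_dim (localization_at R \<mm>) = 2"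
    and "edge_labeled_graph R V E ends \<alpha>"
    and "\<And>e. e \<in> E \<Longrightarrow> principalideal (\<alpha> e) R \<and> \<alpha> e \<noteq> {\<zero>\<^bsub>R\<^esub>}"
    and "finite_projective_dimension TYPE('c) R (spline_module R V E ends \<alpha>)"
  shows "(is_finite_module R (spline_module R V E ends \<alpha>) \<and>
          is_projective_module R (spline_module R V E ends \<alpha>)) \<and>
         (all_finite_projectives_free R \<longrightarrow> is_free_module R (spline_module R V E ends \<alpha>))"
proof -
  let ?M = "spline_module R V E ends \<alpha>" and ?V = "free_module R V"
  interpret noetherian_domain R by fact
  interpret G: edge_labeled_graph R V E ends \<alpha> by fact
  have dom: "domain R" by (rule domain_axioms)
  have Vm: "module R ?V" by (rule free_module_is_module)
  have sub: "submodule (carrier ?M) R ?V" by (rule G.spline_module_submodule)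
  have MV: "carrier ?M \<subseteq> carrier ?V" by (rule module.submoduleE(1)[OF Vm sub])
  have M_eq: "?M = ?V\<lparr>carrier := carrier ?M\<rparr>" by (simp add: spline_module_def)
  have Mm: "module R ?M" using assms(6) by (simp add: finite_projective_dimension_def)
  have zeroM: "\<zero>\<^bsub>?M\<^esub> = \<zero>\<^bsub>?V\<^esub>" by (simp add: spline_module_def)
  interpret M: module R ?M by (rule Mm)
  have wit: "\<exists>x y s. depth_two_witness R \<mm> x y s" if "maximalideal \<mm> R" for \<mm>
    by (rule cohen_macaulay_depth_two_witness[OF assms(1,2) that assms(3)[OF that]])
  obtain n and P :: "nat \<Rightarrow> ('a, 'c) module" and dP \<pi> where res: "projective_resolution R ?M P dP \<pi>"
    and vanish: "\<And>i. i > n \<Longrightarrow> carrier (P i) = {\<zero>\<^bsub>P i\<^esub>}"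
    using assms(6) unfolding finite_projective_dimension_def by blast
  have proj: "is_projective_module R (P i)" and dP: "dP i \<in> module_maps R (P (Suc i)) (P i)"
    and \<pi>: "\<pi> \<in> module_maps R (P 0) ?M" and \<pi>_onto: "\<pi> ` carrier (P 0) = carrier ?M"
    and ex0: "dP 0 ` carrier (P 1) = {z \<in> carrier (P 0). \<pi> z = \<zero>\<^bsub>?M\<^esub>}"
    and ex: "dP (Suc i) ` carrier (P (Suc (Suc i))) = {z \<in> carrier (P (Suc i)). dP i z = \<zero>\<^bsub>P i\<^esub>}" for i
    using res unfolding projective_resolution_def a_kernel_def kernel_def by simp_all
  have Pm: "module R (P i)" for i using proj by (simp add: is_projective_module_def)
  obtain k0 :: nat and \<epsilon> where \<epsilon>V: "\<epsilon> \<in> module_maps R (free_module R {..<k0}) ?V"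
    and \<epsilon>_onto: "\<epsilon> ` carrier (free_module R {..<k0}) = carrier ?M"
    using free_submodule_cover[OF noetherian_ring_axioms is_cring G.finite_V sub] by blast
  let ?E = "free_module R {..<k0}"
  have Em: "module R ?E" by (rule free_module_is_module)
  interpret E: module R ?E by (rule Em)
  have \<epsilon>: "\<epsilon> \<in> module_maps R ?E ?M"
    by (subst M_eq) (rule module_maps_restrict[OF \<epsilon>V], use \<epsilon>_onto in blast)
  obtain k1 :: nat and d where d: "d \<in> module_maps R (free_module R {..<k1}) ?E"
    and d_ex: "d ` carrier (free_module R {..<k1}) = {z \<in> carrier ?E. \<epsilon> z = \<zero>\<^bsub>?M\<^esub>}"
    using free_submodule_cover[OF noetherian_ring_axioms is_cring finite_lessThan kernel_submodule[OF Em Mm \<epsilon>]]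
    by blast
  let ?F = "free_module R {..<k1}"
  have Fm: "module R ?F" by (rule free_module_is_module)
  have zero_map: "(\<lambda>m. \<zero>\<^bsub>?E\<^esub>) \<in> module_maps R ?M ?E" by (rule module_mapsI) auto
  have "w \<ominus>\<^bsub>?M\<^esub> w = \<epsilon> \<zero>\<^bsub>?E\<^esub>" if "w \<in> \<epsilon> ` carrier ?E" for w
    using that \<epsilon>_onto module_maps_zero[OF Em Mm \<epsilon>] by (simp add: M.M.diff_eq_zero_iff)
  then have "\<exists>f\<in>module_maps R ?E (P 0). \<exists>g\<in>module_maps R (P 0) ?E. \<exists>h\<in>module_maps R ?E ?F.
      (\<forall>z\<in>carrier ?E. \<pi> (f z) = \<epsilon> z) \<and> (\<forall>z\<in>carrier (P 0). \<epsilon> (g z) = \<pi> z) \<and>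
      (\<forall>z\<in>carrier ?E. \<epsilon> z = \<zero>\<^bsub>?M\<^esub> \<longrightarrow> z \<ominus>\<^bsub>?E\<^esub> g (f z) = d (h z))"
    by (intro comparison_step[where d = \<epsilon> and d' = d and p = \<pi> and f = "\<lambda>m. m" and g = "\<lambda>m. m"
          and h = "\<lambda>m. \<zero>\<^bsub>?E\<^esub>", OF Mm Fm Mm proj \<epsilon> d d_ex \<pi> module_maps_id module_maps_id zero_map])
      (simp_all add: \<epsilon>_onto \<pi>_onto)
  then obtain f g h where f: "f \<in> module_maps R ?E (P 0)" and g: "g \<in> module_maps R (P 0) ?E"
    and h: "h \<in> module_maps R ?E ?F"
    and \<pi>f: "\<And>z. z \<in> carrier ?E \<Longrightarrow> \<pi> (f z) = \<epsilon> z"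
    and \<epsilon>g: "\<And>z. z \<in> carrier (P 0) \<Longrightarrow> \<epsilon> (g z) = \<pi> z"
    and hom: "\<And>z. z \<in> carrier ?E \<Longrightarrow> \<epsilon> z = \<zero>\<^bsub>?M\<^esub> \<Longrightarrow> z \<ominus>\<^bsub>?E\<^esub> g (f z) = d (h z)"
    by blast
  have "depth_two_submodule R V (\<epsilon> ` carrier ?E)"
    unfolding \<epsilon>_onto by (rule spline_module_depth_two[OF dom assms(4,5)])
  then have "depth_two_cokernel R {..<k0} {z \<in> carrier ?E. \<epsilon> z = \<zero>\<^bsub>?V\<^esub>}"
    by (rule kernel_depth_two_cokernel[OF dom \<epsilon>V])
  then have K: "depth_two_cokernel R {..<k0} (d ` carrier ?F)" unfolding d_ex zeroM .
  have "\<exists>\<tau>\<in>module_maps R ?E ?F. \<forall>z\<in>carrier ?F. d (\<tau> (d z)) = d z"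
  proof (rule resolution_differential_splits[where i = 0 and l = "Suc n" and dP = dP and P = P
        and d = d and f = f and g = g and h = h, OF assms(1) _ proj dP ex _ d K f g h])
    show "carrier (P (0 + Suc n)) = {\<zero>\<^bsub>P (0 + Suc n)\<^esub>}" using vanish by simp
    show "f w \<in> dP 0 ` carrier (P (Suc 0))" if "w \<in> d ` carrier ?F" for w
    proof -
      have w: "w \<in> carrier ?E" "\<epsilon> w = \<zero>\<^bsub>?M\<^esub>" using that unfolding d_ex by auto
      then show ?thesis using ex0 \<pi>f module_maps_closed[OF f w(1)] by simp
    qed
    show "g w \<in> d ` carrier ?F" if "w \<in> dP 0 ` carrier (P (Suc 0))" for w
    proof -
      have w: "w \<in> carrier (P 0)" "\<pi> w = \<zero>\<^bsub>?M\<^esub>" using that ex0 by auto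
      then show ?thesis unfolding d_ex using \<epsilon>g module_maps_closed[OF g w(1)] by simp
    qed
    show "w \<ominus>\<^bsub>?E\<^esub> g (f w) = d (h w)" if "w \<in> d ` carrier ?F" for w
      using that hom unfolding d_ex by simp
    show "\<exists>x y s. depth_two_witness R \<mm> x y s" if "maximalideal \<mm> R" for \<mm> by (rule wit[OF that])
  qed
  then obtain \<tau> where \<tau>: "\<tau> \<in> module_maps R ?E ?F" "\<And>z. z \<in> carrier ?F \<Longrightarrow> d (\<tau> (d z)) = d z" by blast
  obtain \<sigma> where \<sigma>: "\<sigma> \<in> module_maps R ?M ?E" "\<And>m. m \<in> carrier ?M \<Longrightarrow> \<epsilon> (\<sigma> m) = m"
    using section_of_split_presentation[where \<epsilon> = \<epsilon> and d = d and \<tau> = \<tau>, OF Mm Em Fm \<epsilon> \<epsilon>_onto d d_ex \<tau>] by blast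
  show ?thesis
    using finite_retract_of_free[where p = \<epsilon> and s = \<sigma>, OF Mm finite_lessThan \<epsilon> \<sigma>]
      finite_retract_is_free[where \<epsilon> = \<epsilon> and \<sigma> = \<sigma>, OF Mm one_not_zero \<epsilon> \<sigma>] by blast
qed

end
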